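(* Let $\alpha\in[1,2]$ and let $L_{\alpha+1}$ satisfy Hypothesis 1 (see context). Let $0<T<1$ and let $N_1,N_2$ be dyadic numbers with $N_1\vee N_2\gg N_1\wedge N_2\ge1$. Let $f_1,f_2\in L^\infty(]0,T[;L^2(\mathbb{T}))$, and let $a\in L^\infty(\mathbb{R}^2)$ with $\|a\|_{L^\infty}\lesssim1$. Let $u_1,u_2\in C([0,T];L^2(\mathbb{T}))$ satisfy $$\partial_t u_j+L_{\alpha+1}u_j+\partial_x f_j=0\quad\text{on } ]0,T[\times\mathbb{T},\qquad j=1,2.$$ Then for any $0\le\theta\le1$, $$\|\Lambda_a(P_{N_1}u_1,P_{N_2}u_2)\|_{L^2_{T,x}}\lesssim T^{\frac{\theta-1}{2}}(N_1\wedge N_2)^{\frac{\theta}{2}}\big(\|P_{N_1}u_1\|_{L^2_{T,x}}+\|P_{N_1}f_1\|_{L^2_{T,x}}\big)\big(\|P_{N_2}u_2\|_{L^\infty_TL^2_x}+\|P_{N_2}f_2\|_{L^\infty_TL^2_x}\big),$$ where the implicit constant is independent of $T,N_1,N_2,u_1,u_2,f_1,f_2$ (it depends only on $L_{\alpha+1}$ and on the bound for $\|a\|_{L^\infty}$).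
   Context: $\mathbb{T}=\mathbb{R}/2\pi\mathbb{Z}$; $a\vee b=\max\{a,b\}$, $a\wedge b=\min\{a,b\}$; $\hat u$ is the Fourier transform in $x$ ($\xi\in\mathbb{Z}$); $L^p_TL^2_x=L^p([0,T];L^2(\mathbb{T}))$, $L^2_{T,x}=L^2_TL^2_x$. $X\lesssim Y$ means $X\le CY$ with a constant $C>0$. The condition $N_1\vee N_2\gg N_1\wedge N_2$ means $N_1\vee N_2\ge C_0(N_1\wedge N_2)$ for a sufficiently large constant $C_0$ depending only on $L_{\alpha+1}$. Hypothesis 1 (on $L_{\alpha+1}$): $L_{\alpha+1}$ is the Fourier multiplier operator (in $x$) with symbol $-ip_{\alpha+1}(\xi)$, where $p_{\alpha+1}\in C^1(\mathbb{R})\cap C^2(\mathbb{R}\setminus\{0\})$ is a real-valued odd function such that for some $\xi_0>0$, $p_{\alpha+1}'(\xi)\sim\xi^{\alpha}$ and $p_{\alpha+1}''(\xi)\sim\xi^{\alpha-1}$ for all $\xi\ge\xi_0$ (where $a\sim b$ means $c\,b\le a\le C\,b$ with positive constants $c,C$). Frequency projectors: fix an even $\chi\in C_0^\infty(\mathbb{R})$ with $0\le\chi\le1$, $\chi=1$ on $[-1,1]$, $\operatorname{supp}\chi\subset[-2,2]$; $\phi(\xi)=\chi(\xi)-\chi(2\xi)$, $\phi_N(\xi)=\phi(\xi/N)$ for $N=2^l$, $l\in\mathbb{N}=\{0,1,2,\dots\}$. Dyadic numbers $N\ge1$ are the numbers $2^l$, $l\in\mathbb{N}$, and $\widehat{P_Nu}=\phi_N\hat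 u$. Bilinear multiplier: for $u,v\in L^2(\mathbb{T})$ and $a\in L^\infty(\mathbb{R}^2)$ (understood as a bounded function, $\|a\|_{L^\infty}$ being its supremum, since only its values at integer points are used), $$\widehat{\Lambda_a(u,v)}(\xi)=\sum_{\xi_1+\xi_2=\xi}a(\xi_1,\xi_2)\hat u(\xi_1)\hat v(\xi_2).$$ For time-dependent functions $\Lambda_a$ acts at each fixed time. *)

theory Defs
  imports "HOL-Analysis.Analysis" "HOL-Probability.Essential_Supremum"
begin

section \<open>Functions on the torus\<close>

text \<open>
  A function on \<open>\<real>/2\<pi>\<int>\<close> is represented by its restriction to the fundamental domain
  \<open>[0, 2\<pi>]\<close>; the double endpoint is a null set. Values outside that interval are never used.
\<close>

abbreviation torus :: "real measure" where
  "torus \<equiv> lebesgue_on {0..2 * pi}"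

definition L2_torus :: "(real \<Rightarrow> complex) set" where
  "L2_torus = {g. g \<in> borel_measurable torus \<and> integrable torus (\<lambda>x. (cmod (g x))\<^sup>2)}"

definition L2_norm :: "(real \<Rightarrow> complex) \<Rightarrow> real" where
  "L2_norm g = sqrt (LINT x|torus. (cmod (g x))\<^sup>2)"

text \<open>The normalisation is the one for which \<open>\<Lambda>\<^sub>1(u,v) = u v\<close>.\<close>

definition fourier :: "(real \<Rightarrow> complex) \<Rightarrow> int \<Rightarrow> complex" where
  "fourier g \<xi> = complex_of_real (1 / (2 * pi)) * (LINT x|torus. g x * cis (- (of_int \<xi> * x)))"

text \<open>
  The function with prescribed Fourier coefficients. It is only used for finitely supported or
  absolutely summable coefficients.
\<close>

definition fourier_series :: "(int \<Rightarrow> complex) \<Rightarrow> real \<Rightarrow> complex" where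
  "fourier_series c x = (\<Sum>\<^sub>\<infinity>\<xi>\<in>UNIV. c \<xi> * cis (of_int \<xi> * x))"

lemma integral_torus_cis:
  fixes k :: int
  shows "(LINT x|torus. cis (of_int k * x)) = (if k = 0 then complex_of_real (2 * pi) else 0)"
proof (cases "k = 0")
  case True
  then show ?thesis
    by (simp add: measure_restrict_space scaleR_conv_of_real)
next
  case False
  have cont: "continuous_on {0..2 * pi} (\<lambda>x. cis (of_int k * x))"
    by (intro continuous_intros)
  let ?F = "\<lambda>x::real. exp (\<i> * of_int k * of_real x) / (\<i> * of_int k)"
  have deriv: "(?F has_vector_derivative cis (of_int k * x)) (at x within {0..2 * pi})" for x
  proof -
    have "((\<lambda>z. exp (\<i> * of_int k * z) / (\<i> * of_int k)) has_field_derivative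
            exp (\<i> * of_int k * of_real x)) (at (of_real x))"
      using False by (auto intro!: derivative_eq_intros)
    from has_vector_derivative_real_field[OF this]
    show ?thesis
      by (simp add: cis_conv_exp mult.assoc)
  qed
  have "((\<lambda>x. cis (of_int k * x)) has_integral (?F (2 * pi) - ?F 0)) {0..2 * pi}"
    by (rule fundamental_theorem_of_calculus) (use deriv in auto)
  moreover have "?F (2 * pi) = ?F 0"
  proof -
    have "exp (\<i> * of_int k * of_real (2 * pi)) = cis (2 * pi * of_int k)"
      by (simp add: cis_conv_exp ac_simps)
    also have "\<dots> = 1"
      by (rule cis_multiple_2pi) simp
    finally show ?thesis
      by simp
  qed
  ultimately have "integral {0..2 * pi} (\<lambda>x. cis (of_int k * x)) = 0"
    by (simp add: integral_unique)
  moreover have "(LINT x|torus. cis (of_int k * x)) = integral {0..2 * pi} (\<lambda>x. cis (of_int k * x))"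
    by (intro lebesgue_integral_eq_integral continuous_imp_integrable_real cont) simp
  ultimately show ?thesis using False by simp
qed

lemma fourier_fourier_series:
  assumes "finite {\<xi>. c \<xi> \<noteq> 0}"
  shows "fourier (fourier_series c) \<xi> = c \<xi>"
proof -
  let ?S = "insert \<xi> {\<xi>. c \<xi> \<noteq> 0}"
  have fin: "finite ?S" using assms by simp
  have eq: "fourier_series c x = (\<Sum>k\<in>?S. c k * cis (of_int k * x))" for x
  proof -
    have "fourier_series c x = (\<Sum>\<^sub>\<infinity>k\<in>?S. c k * cis (of_int k * x))"
      unfolding fourier_series_def by (rule infsum_cong_neutral) auto
    then show ?thesis using fin by simp
  qed
  have int: "integrable torus (\<lambda>x. c k * cis (of_int (k - \<xi>) * x))" for k
    by (intro integrable_mult_right continuous_imp_integrable_real continuous_intros)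
  have "(LINT x|torus. fourier_series c x * cis (- (of_int \<xi> * x)))
      = (LINT x|torus. (\<Sum>k\<in>?S. c k * cis (of_int (k - \<xi>) * x)))"
    by (intro Bochner_Integration.integral_cong refl)
       (simp add: eq sum_distrib_right mult.assoc cis_mult left_diff_distrib del: sum.insert)
  also have "\<dots> = (\<Sum>k\<in>?S. c k * (if k = \<xi> then complex_of_real (2 * pi) else 0))"
    using int by (subst Bochner_Integration.integral_sum)
      (auto simp: integral_torus_cis simp del: of_int_diff intro!: sum.cong)
  also have "\<dots> = c \<xi> * complex_of_real (2 * pi)"
    using fin by (simp add: if_distrib sum.delta cong: if_cong)
  finally show ?thesis by (simp add: fourier_def)
qed

definition fourier_multiplier :: "(real \<Rightarrow> complex) \<Rightarrow> (real \<Rightarrow> complex) \<Rightarrow> real \<Rightarrow> complex" where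
  "fourier_multiplier m g = fourier_series (\<lambda>\<xi>. m (of_int \<xi>) * fourier g \<xi>)"

section \<open>Frequency projectors and the bilinear multiplier\<close>

definition freq_cutoff :: "(real \<Rightarrow> real) \<Rightarrow> bool" where
  "freq_cutoff chi \<longleftrightarrow>
     (\<forall>n x. (deriv ^^ n) chi field_differentiable at x) \<and>
     (\<forall>x. chi (- x) = chi x) \<and>
     (\<forall>x. 0 \<le> chi x \<and> chi x \<le> 1) \<and>
     (\<forall>x\<in>{-1..1}. chi x = 1) \<and>
     closure {x. chi x \<noteq> 0} \<subseteq> {-2..2}"

definition dyadic :: "real set" where
  "dyadic = range (\<lambda>l::nat. 2 ^ l)"

definition freq_block :: "(real \<Rightarrow> real) \<Rightarrow> real \<Rightarrow> real \<Rightarrow> real" where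
  "freq_block chi N \<xi> = chi (\<xi> / N) - chi (2 * (\<xi> / N))"

definition freq_proj :: "(real \<Rightarrow> real) \<Rightarrow> real \<Rightarrow> (real \<Rightarrow> complex) \<Rightarrow> real \<Rightarrow> complex" where
  "freq_proj chi N = fourier_multiplier (\<lambda>\<xi>. complex_of_real (freq_block chi N \<xi>))"

definition bilinear_mult ::
  "(real \<times> real \<Rightarrow> complex) \<Rightarrow> (real \<Rightarrow> complex) \<Rightarrow> (real \<Rightarrow> complex) \<Rightarrow> real \<Rightarrow> complex" where
  "bilinear_mult a u v = fourier_series (\<lambda>\<xi>.
     \<Sum>\<^sub>\<infinity>\<xi>\<^sub>1\<in>UNIV. a (of_int \<xi>\<^sub>1, of_int (\<xi> - \<xi>\<^sub>1)) * fourier u \<xi>\<^sub>1 * fourier v (\<xi> - \<xi>\<^sub>1))"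

section \<open>Hypothesis on the dispersion\<close>

definition dispersion_hyp :: "real \<Rightarrow> (real \<Rightarrow> real) \<Rightarrow> bool" where
  "dispersion_hyp \<alpha> p \<longleftrightarrow>
     p C1_differentiable_on UNIV \<and>
     deriv p C1_differentiable_on (- {0}) \<and>
     (\<forall>\<xi>. p (- \<xi>) = - p \<xi>) \<and>
     (\<exists>\<xi>\<^sub>0>0.
        (\<exists>c>0. \<exists>C>0. \<forall>\<xi>\<ge>\<xi>\<^sub>0. c * \<xi> powr \<alpha> \<le> deriv p \<xi> \<and> deriv p \<xi> \<le> C * \<xi> powr \<alpha>) \<and>
        (\<exists>c>0. \<exists>C>0. \<forall>\<xi>\<ge>\<xi>\<^sub>0. c * \<xi> powr (\<alpha> - 1) \<le> deriv (deriv p) \<xi> \<and>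
                                deriv (deriv p) \<xi> \<le> C * \<xi> powr (\<alpha> - 1)))"

section \<open>Functions of time with values in \<open>L\<^sup>2\<close> of the torus\<close>

definition L2_time_norm :: "real \<Rightarrow> (real \<Rightarrow> real \<Rightarrow> complex) \<Rightarrow> real" where
  "L2_time_norm T w = sqrt (LINT t|lebesgue_on {0<..<T}. (L2_norm (w t))\<^sup>2)"

definition Linf_time_norm :: "real \<Rightarrow> (real \<Rightarrow> real \<Rightarrow> complex) \<Rightarrow> real" where
  "Linf_time_norm T w = real_of_ereal (esssup (lebesgue_on {0<..<T}) (\<lambda>t. ereal (L2_norm (w t))))"

definition continuous_L2 :: "real \<Rightarrow> (real \<Rightarrow> real \<Rightarrow> complex) \<Rightarrow> bool" where
  "continuous_L2 T u \<longleftrightarrow>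
     (\<forall>t\<in>{0..T}. u t \<in> L2_torus) \<and>
     (\<forall>t\<in>{0..T}. ((\<lambda>s. L2_norm (\<lambda>x. u s x - u t x)) \<longlongrightarrow> 0) (at t within {0..T}))"

definition simple_L2 :: "real \<Rightarrow> (real \<Rightarrow> real \<Rightarrow> complex) \<Rightarrow> bool" where
  "simple_L2 T s \<longleftrightarrow>
     finite (s ` {0<..<T}) \<and> s ` {0<..<T} \<subseteq> L2_torus \<and>
     (\<forall>g. {t \<in> {0<..<T}. s t = g} \<in> sets lebesgue)"

text \<open>
  Strong (Bochner) measurability is expressed through approximation by simple functions, since
  \<^const>\<open>borel_measurable\<close> needs a topology on the codomain.
\<close>

definition Linf_L2 :: "real \<Rightarrow> (real \<Rightarrow> real \<Rightarrow> complex) \<Rightarrow> bool" where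
  "Linf_L2 T f \<longleftrightarrow>
     (\<forall>t\<in>{0<..<T}. f t \<in> L2_torus) \<and>
     (\<exists>s. (\<forall>n::nat. simple_L2 T (s n)) \<and>
          (AE t in lebesgue_on {0<..<T}. (\<lambda>n. L2_norm (\<lambda>x. s n t x - f t x)) \<longlonglongrightarrow> 0)) \<and>
     (\<exists>B. AE t in lebesgue_on {0<..<T}. L2_norm (f t) \<le> B)"

section \<open>Distributional solutions\<close>

text \<open>
  \<open>D j k\<close> is the partial derivative of order \<open>j\<close> in the first and \<open>k\<close> in the second variable.
\<close>

definition smooth2 :: "(real \<Rightarrow> real \<Rightarrow> complex) \<Rightarrow> bool" where
  "smooth2 \<psi> \<longleftrightarrow> (\<exists>D :: nat \<Rightarrow> nat \<Rightarrow> real \<Rightarrow> real \<Rightarrow> complex.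
     D 0 0 = \<psi> \<and>
     (\<forall>j k. continuous_on UNIV (\<lambda>(t, x). D j k t x)) \<and>
     (\<forall>j k t x. ((\<lambda>s. D j k s x) has_vector_derivative D (Suc j) k t x) (at t) \<and>
                ((\<lambda>y. D j k t y) has_vector_derivative D j (Suc k) t x) (at x)))"

definition test_function :: "real \<Rightarrow> (real \<Rightarrow> real \<Rightarrow> complex) \<Rightarrow> bool" where
  "test_function T \<psi> \<longleftrightarrow>
     smooth2 \<psi> \<and>
     (\<forall>t x. \<psi> t (x + 2 * pi) = \<psi> t x) \<and>
     (\<exists>t\<^sub>0 t\<^sub>1. 0 < t\<^sub>0 \<and> t\<^sub>1 < T \<and> (\<forall>t x. t \<notin> {t\<^sub>0..t\<^sub>1} \<longrightarrow> \<psi> t x = 0))"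

text \<open>
  \<open>\<partial>\<^sub>t u + L u + \<partial>\<^sub>x f = 0\<close> in the distributions on \<open>]0,T[\<close> times the torus, where \<open>L\<close> has symbol
  \<open>-i p(\<xi>)\<close>. All operators are moved to the test function; for the bilinear pairing
  \<open>\<integral> u \<psi>\<close> the transpose of a Fourier multiplier with symbol \<open>m(\<xi>)\<close> has symbol \<open>m(-\<xi>)\<close>.
\<close>

definition weak_solution ::
  "real \<Rightarrow> (real \<Rightarrow> real) \<Rightarrow> (real \<Rightarrow> real \<Rightarrow> complex) \<Rightarrow> (real \<Rightarrow> real \<Rightarrow> complex) \<Rightarrow> bool" where
  "weak_solution T p u f \<longleftrightarrow> (\<forall>\<psi>. test_function T \<psi> \<longrightarrow>
     (LINT t|lebesgue_on {0<..<T}. LINT x|torus.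
        u t x * (- vector_derivative (\<lambda>s. \<psi> s x) (at t)
                 + fourier_multiplier (\<lambda>\<xi>. - \<i> * complex_of_real (p (- \<xi>))) (\<psi> t) x)
        - f t x * vector_derivative (\<lambda>y. \<psi> t y) (at x)) = 0)"

end

theory Submission
  imports Defs
begin

text \<open>
  After undoing the linear flow, the coefficients \<open>exp(-i p(k) t) u^(t,k)\<close> are primitives of
  \<open>- i k exp(-i p(k) t) f^(t,k)\<close>, so they hardly move on time intervals of length
  \<open>T / (N\<^sub>1 \<or> N\<^sub>2)\<close>. For a fixed output frequency \<open>\<xi>\<close>, the phases \<open>p(k) + p(\<xi> - k)\<close> of the
  interacting pairs are separated by a multiple of \<open>N\<^sub>1 \<or> N\<^sub>2\<close>, because \<open>p'\<close> is much larger at the high frequency.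
  Hence a large sieve inequality on each such interval, applied with moving coefficients through a
  Sobolev inequality in time and Fubini, gives the case \<open>\<theta> = 0\<close> after summing over the intervals.
  The case \<open>\<theta> = 1\<close> is Cauchy--Schwarz over the at most \<open>5 (N\<^sub>1 \<and> N\<^sub>2)\<close> interacting pairs, and the
  two bounds are interpolated.
\<close>

section \<open>A large sieve inequality\<close>

text \<open>The obstacle is the derivative on the forcing. Write M for
  \<open>max N\<^sub>1 N\<^sub>2\<close>. The coefficients freed from the linear flow move with a
  speed of order M, so the Sobolev inequality on a window of length h costs 1 / h for the
  coefficients and h * M^2 for their derivatives. With h = T / M these are M / T and T * M, and T <
  1 lets the first dominate the second. The remaining factor M is paid by the separation of the
  phases: a large sieve with gap c * M, on a window no longer than 1 / (c * M), gains 1 / (c * M).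
  The powers of M cancel and 1 / T is left, the square of the factor in T at \<theta> = 0. The
  right-hand side is asymmetric because, once the sieve estimates are summed over the output
  frequencies, the second factor is taken out by its supremum in time while the first stays under
  the time integral. The forcing is merely measurable in time, so the coefficients are treated as
  integrals of bounded functions and never differentiated pointwise.\<close>

lemma norm_integral_parabola_cis_le:
  fixes w b L :: real
  assumes L: "0 < L" and w: "2 \<le> \<bar>w\<bar> * L"
  shows "norm (integral {b..b + L} (\<lambda>t. complex_of_real ((t - b) * (b + L - t)) * cis (w * t))) \<le> 4 * L / w\<^sup>2"
proof -
  have w0: "w \<noteq> 0" using w by auto
  \<comment> \<open>Two integrations by parts, written as an explicit antiderivative: with q the
    parabola, the bracket is q / (iw) - q' / (iw)^2 + q'' / (iw)^3. Since q vanishes at both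
    endpoints, only the terms of order w^-2 and w^-3 survive there.\<close>
  define G where "G = (\<lambda>t. cis (w * t) * (complex_of_real ((t - b) * (b + L - t)) / (\<i> * w)
      + complex_of_real (2 * b + L - 2 * t) / w\<^sup>2 + 2 / (\<i> * w ^ 3)))"
  have der: "(G has_vector_derivative complex_of_real ((t - b) * (b + L - t)) * cis (w * t)) (at t within S)" for t S
  proof -
    have c: "((\<lambda>t. cis (w * t)) has_vector_derivative \<i> * w * cis (w * t)) (at t within S)"
    proof -
      have "((\<lambda>t. cis (w * t)) has_vector_derivative w *\<^sub>R (\<i> * cis (w * t))) (at t within S)"
        unfolding has_vector_derivative_def
        by (auto intro!: derivative_eq_intros simp: algebra_simps scaleR_conv_of_real)
      then show ?thesis by (simp add: scaleR_conv_of_real mult_ac)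
    qed
    have q: "((\<lambda>t. complex_of_real ((t - b) * (b + L - t)) / (\<i> * w)
      + complex_of_real (2 * b + L - 2 * t) / w\<^sup>2 + 2 / (\<i> * w ^ 3)) has_vector_derivative
        (complex_of_real (2 * b + L - 2 * t) / (\<i> * w) + complex_of_real (- 2) / w\<^sup>2)) (at t within S)"
    proof -
      have 1: "((\<lambda>t. complex_of_real ((t - b) * (b + L - t))) has_vector_derivative complex_of_real (2 * b + L - 2 * t)) (at t within S)"
        by (rule has_vector_derivative_of_real) (auto intro!: derivative_eq_intros simp: algebra_simps has_real_derivative_iff_has_vector_derivative[symmetric])
      have 2: "((\<lambda>t. complex_of_real (2 * b + L - 2 * t)) has_vector_derivative complex_of_real (- 2)) (at t within S)"
        by (rule has_vector_derivative_of_real) (auto intro!: derivative_eq_intros simp: algebra_simps has_real_derivative_iff_has_vector_derivative[symmetric])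
      show ?thesis
        using has_vector_derivative_add[OF has_vector_derivative_add[OF has_vector_derivative_divide[OF 1] has_vector_derivative_divide[OF 2]] has_vector_derivative_const]
        by simp
    qed
    have iw: "\<i> * complex_of_real w \<noteq> 0" using w0 by simp
    have ws: "complex_of_real w ^ 3 = complex_of_real w * (complex_of_real w)\<^sup>2" by (simp add: power3_eq_cube power2_eq_square)
    show ?thesis
      unfolding G_def
      by (rule has_vector_derivative_eq_rhs[OF has_vector_derivative_mult[OF c q]])
        (use w0 in \<open>simp add: field_simps ws power2_eq_square\<close>)
  qed
  have "((\<lambda>t. complex_of_real ((t - b) * (b + L - t)) * cis (w * t)) has_integral (G (b + L) - G b)) {b..b + L}"
    by (rule fundamental_theorem_of_calculus) (use L der in auto)
  then have eq: "integral {b..b + L} (\<lambda>t. complex_of_real ((t - b) * (b + L - t)) * cis (w * t)) = G (b + L) - G b"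
    by (rule integral_unique)
  define e0 e1 where "e0 = cis (w * b)" and "e1 = cis (w * (b + L))"
  have G1: "G (b + L) = e1 * (- complex_of_real L / w\<^sup>2 + 2 / (\<i> * w ^ 3))"
    by (simp add: G_def e1_def)
  have G0: "G b = e0 * (complex_of_real L / w\<^sup>2 + 2 / (\<i> * w ^ 3))"
    by (simp add: G_def e0_def)
  have A: "norm (complex_of_real L / w\<^sup>2) = L / w\<^sup>2"
    using L by (simp add: norm_divide norm_power)
  \<comment> \<open>The hypothesis on |w| * L absorbs the cubic term, so that each endpoint
    contributes at most 2 * L / w^2.\<close>
  have B: "norm (2 / (\<i> * complex_of_real w ^ 3)) \<le> L / w\<^sup>2"
  proof -
    have "norm (2 / (\<i> * complex_of_real w ^ 3)) = 2 / \<bar>w\<bar> ^ 3"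
      by (simp add: norm_divide norm_mult norm_power)
    also have "\<dots> \<le> (\<bar>w\<bar> * L) / \<bar>w\<bar> ^ 3"
      using w w0 by (intro divide_right_mono) auto
    also have "\<dots> = L / w\<^sup>2"
      using w0 by (simp add: power3_eq_cube power2_eq_square field_simps)
    finally show ?thesis .
  qed
  have b1: "norm (G (b + L)) \<le> L / w\<^sup>2 + L / w\<^sup>2"
  proof -
    have "norm (G (b + L)) = norm (- complex_of_real L / w\<^sup>2 + 2 / (\<i> * w ^ 3))"
      unfolding G1 by (simp add: norm_mult e1_def)
    also have "\<dots> \<le> norm (- complex_of_real L / w\<^sup>2) + norm (2 / (\<i> * complex_of_real w ^ 3))"
      using norm_triangle_ineq[of "- complex_of_real L / w\<^sup>2" "2 / (\<i> * complex_of_real w ^ 3)"] by simp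
    also have "\<dots> \<le> L / w\<^sup>2 + L / w\<^sup>2" using A B by simp
    finally show ?thesis .
  qed
  have b0: "norm (G b) \<le> L / w\<^sup>2 + L / w\<^sup>2"
  proof -
    have "norm (G b) = norm (complex_of_real L / w\<^sup>2 + 2 / (\<i> * w ^ 3))"
      unfolding G0 by (simp add: norm_mult e0_def)
    also have "\<dots> \<le> norm (complex_of_real L / w\<^sup>2) + norm (2 / (\<i> * complex_of_real w ^ 3))"
      using norm_triangle_ineq[of "complex_of_real L / w\<^sup>2" "2 / (\<i> * complex_of_real w ^ 3)"] by simp
    also have "\<dots> \<le> L / w\<^sup>2 + L / w\<^sup>2" using A B by simp
    finally show ?thesis .
  qed
  show ?thesis
    unfolding eq using norm_triangle_ineq4[of "G (b + L)" "G b"] b0 b1 by simp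
qed

lemma integral_parabola_le:
  fixes b L :: real
  assumes L: "0 < L"
  shows "integral {b..b + L} (\<lambda>t. (t - b) * (b + L - t)) \<le> L ^ 3"
proof -
  have "integral {b..b + L} (\<lambda>t. (t - b) * (b + L - t)) \<le> integral {b..b + L} (\<lambda>t. L * L)"
    by (intro integral_le integrable_continuous_real continuous_intros) (use L in \<open>auto intro!: mult_mono\<close>)
  also have "\<dots> = L ^ 3" using L by (simp add: power3_eq_cube)
  finally show ?thesis .
qed

text \<open>Telescoping against 1 / (n (n + 1)). The subtracted term on the right is what makes the
  induction close.\<close>

lemma sum_inverse_squares_le:
  "(\<Sum>d = 1..Suc n. 1 / (real d)\<^sup>2) \<le> 2 - 1 / real (Suc n)"
proof (induction n)
  case (Suc n)
  have "1 / (real (Suc (Suc n)))\<^sup>2 \<le> 1 / (real (Suc n) * real (Suc (Suc n)))"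
    unfolding power2_eq_square by (intro divide_left_mono mult_right_mono) auto
  also have "\<dots> = 1 / real (Suc n) - 1 / real (Suc (Suc n))"
    by (simp add: field_simps)
  finally show ?case using Suc by simp
qed simp

text \<open>The row sum needed for Schur's test in the large sieve. The 5 is 1 + 2 + 2: the diagonal
  and two one-sided sums of inverse squares, each below 2.\<close>

lemma sum_off_diagonal_le:
  fixes J :: "int set"
  assumes "finite J"
  shows "(\<Sum>l\<in>J. if k = l then 1 else 1 / (real_of_int (k - l))\<^sup>2) \<le> 5"
proof -
  define q where "q = (\<lambda>d::int. if d = 0 then 1 else 1 / (real_of_int d)\<^sup>2)"
  obtain n :: nat where n: "\<And>l. l \<in> J \<Longrightarrow> \<bar>k - l\<bar> \<le> int n"
  proof -
    have "finite ((\<lambda>l. nat \<bar>k - l\<bar>) ` J)" using assms by simp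
    then obtain n where "\<forall>x\<in>(\<lambda>l. nat \<bar>k - l\<bar>) ` J. x \<le> n"
      using finite_nat_set_iff_bounded_le by blast
    then have "\<bar>k - l\<bar> \<le> int n" if "l \<in> J" for l using that by auto
    then show ?thesis by (rule that)
  qed
  define m where "m = Suc n"
  have "(\<Sum>l\<in>J. if k = l then 1 else 1 / (real_of_int (k - l))\<^sup>2) = (\<Sum>l\<in>J. q (k - l))"
    by (intro sum.cong) (auto simp: q_def)
  also have "\<dots> = (\<Sum>d\<in>(\<lambda>l. k - l) ` J. q d)"
    by (subst sum.reindex) (auto simp: inj_on_def)
  also have "\<dots> \<le> (\<Sum>d\<in>{0} \<union> (int ` {1..m} \<union> (\<lambda>i. - int i) ` {1..m}). q d)"
  proof (rule sum_mono2)
    show "(\<lambda>l. k - l) ` J \<subseteq> {0} \<union> (int ` {1..m} \<union> (\<lambda>i. - int i) ` {1..m})"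
    proof
      fix d assume "d \<in> (\<lambda>l. k - l) ` J"
      then have d: "\<bar>d\<bar> \<le> int m" using n by (force simp: m_def)
      consider "d = 0" | "d > 0" | "d < 0" by linarith
      then show "d \<in> {0} \<union> (int ` {1..m} \<union> (\<lambda>i. - int i) ` {1..m})"
      proof cases
        case 2
        then have "d = int (nat d)" "nat d \<in> {1..m}" using d by auto
        then show ?thesis by blast
      next
        case 3
        then have "d = - int (nat (- d))" "nat (- d) \<in> {1..m}" using d by auto
        then show ?thesis by blast
      qed auto
    qed
  qed (auto simp: q_def)
  also have "\<dots> = q 0 + ((\<Sum>d\<in>int ` {1..m}. q d) + (\<Sum>d\<in>(\<lambda>i. - int i) ` {1..m}. q d))"
    by (subst sum.union_disjoint, force, force, force, subst sum.union_disjoint) (auto)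
  also have "\<dots> = 1 + (\<Sum>d = 1..m. 1 / (real d)\<^sup>2) + (\<Sum>d = 1..m. 1 / (real d)\<^sup>2)"
    by (subst (1 2) sum.reindex) (auto simp: q_def inj_on_def intro!: sum.cong)
  also have "\<dots> \<le> 5"
    using sum_inverse_squares_le[of n] unfolding m_def by (smt (verit) divide_nonneg_nonneg of_nat_0_le_iff)
  finally show ?thesis .
qed

text \<open>A weight vanishing at the endpoints makes the off-diagonal terms decay quadratically in the gap.\<close>

lemma large_sieve:
  fixes J :: "int set" and w :: "int \<Rightarrow> real" and c :: "int \<Rightarrow> complex"
  assumes fin: "finite J" and g: "0 < g"
    and sep: "\<And>k l. k \<in> J \<Longrightarrow> l \<in> J \<Longrightarrow> g * \<bar>real_of_int (k - l)\<bar> \<le> \<bar>w k - w l\<bar>"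
    and h: "0 \<le> h" "h \<le> 1 / g"
  shows "integral {b..b + h} (\<lambda>t. (norm (\<Sum>k\<in>J. c k * cis (w k * t)))\<^sup>2) \<le> 54 / g * (\<Sum>k\<in>J. (norm (c k))\<^sup>2)"
proof -
  \<comment> \<open>The window \<open>{b..b + h}\<close> lies in the middle half of
    \<open>{a..a + L}\<close>, where the parabola is at least \<open>3 * L\<^sup>2 / 16\<close>. The
    length 2 / g is just enough for every frequency gap w \<ge> g to satisfy 2 \<le> w * L, and it
    turns 4 * L / (g * d)^2 into L^3 / d^2.\<close>
  define L where "L = 2 / g"
  define a where "a = b - 1 / (2 * g)"
  define wt where "wt = (\<lambda>t. (t - a) * (a + L - t))"
  define S where "S = (\<lambda>t. \<Sum>k\<in>J. c k * cis (w k * t))"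
  have L0: "0 < L" using g by (simp add: L_def)
  have contS: "continuous_on X S" for X
    unfolding S_def by (intro continuous_intros)
  have contw: "continuous_on X wt" for X
    unfolding wt_def by (intro continuous_intros)
  have half: "1 / (2 * g) = 1 / g / 2" by simp
  have sub: "{b..b + h} \<subseteq> {a..a + L}"
    using g h by (auto simp: a_def L_def field_simps)
  have wt_nonneg: "0 \<le> wt t" if "t \<in> {a..a + L}" for t
    using that by (auto simp: wt_def)
  have wt_low: "3 * L\<^sup>2 / 16 \<le> wt t" if "t \<in> {b..b + h}" for t
  proof -
    have 1: "L / 4 \<le> t - a" "t - a \<le> 3 * L / 4"
      using that g h half by (auto simp: a_def L_def)
    have "0 \<le> (t - a - L / 4) * (3 * L / 4 - (t - a))" using 1 by simp
    also have "\<dots> = wt t - 3 * L\<^sup>2 / 16"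
      by (simp add: wt_def power2_eq_square field_simps)
    finally show ?thesis by simp
  qed
  define Q where "Q = integral {a..a + L} (\<lambda>t. wt t * (norm (S t))\<^sup>2)"
  have low: "3 * L\<^sup>2 / 16 * integral {b..b + h} (\<lambda>t. (norm (S t))\<^sup>2) \<le> Q"
  proof -
    have "3 * L\<^sup>2 / 16 * integral {b..b + h} (\<lambda>t. (norm (S t))\<^sup>2)
        = integral {b..b + h} (\<lambda>t. 3 * L\<^sup>2 / 16 * (norm (S t))\<^sup>2)" by simp
    also have "\<dots> \<le> integral {b..b + h} (\<lambda>t. wt t * (norm (S t))\<^sup>2)"
      by (intro integral_le integrable_continuous_real continuous_intros contS contw)
         (intro mult_right_mono wt_low, auto)
    also have "\<dots> \<le> Q"
      unfolding Q_def
      by (intro integral_subset_le sub integrable_continuous_real continuous_intros contS contw)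
         (auto simp: wt_nonneg)
    finally show ?thesis .
  qed
  define I where "I = (\<lambda>k l. integral {a..a + L} (\<lambda>t. complex_of_real (wt t) * cis ((w k - w l) * t)))"
  have Ibound: "norm (I k l) \<le> L ^ 3 * (if k = l then 1 else 1 / (real_of_int (k - l))\<^sup>2)" if "k \<in> J" "l \<in> J" for k l
  proof (cases "k = l")
    case True
    have "norm (I k l) \<le> integral {a..a + L} wt"
      unfolding I_def
      by (rule integral_norm_bound_integral)
         (auto intro!: integrable_continuous_real continuous_intros contw simp: norm_mult wt_nonneg)
    also have "\<dots> \<le> L ^ 3"
      unfolding wt_def by (rule integral_parabola_le[OF L0])
    finally show ?thesis using True by simp
  next
    case False
    then have kl: "1 \<le> \<bar>real_of_int (k - l)\<bar>" by linarith
    have gap: "g * \<bar>real_of_int (k - l)\<bar> \<le> \<bar>w k - w l\<bar>" by (rule sep[OF that])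
    have "g * 1 \<le> g * \<bar>real_of_int (k - l)\<bar>" using g kl by (intro mult_left_mono) auto
    then have "g \<le> \<bar>w k - w l\<bar>" using gap by linarith
    then have "2 \<le> \<bar>w k - w l\<bar> * L" using g by (simp add: L_def field_simps)
    then have "norm (I k l) \<le> 4 * L / (w k - w l)\<^sup>2"
      unfolding I_def wt_def by (rule norm_integral_parabola_cis_le[OF L0])
    also have "\<dots> \<le> 4 * L / (g * \<bar>real_of_int (k - l)\<bar>)\<^sup>2"
    proof (rule divide_left_mono)
      show "(g * \<bar>real_of_int (k - l)\<bar>)\<^sup>2 \<le> (w k - w l)\<^sup>2"
        using power_mono[OF gap, of 2] g by simp
    qed (use L0 g kl \<open>g \<le> \<bar>w k - w l\<bar>\<close> in auto)
    also have "\<dots> = L ^ 3 * (1 / (real_of_int (k - l))\<^sup>2)"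
      using g kl by (simp add: L_def power3_eq_cube power2_eq_square field_simps)
    finally show ?thesis using False by simp
  qed
  have expand: "complex_of_real (wt t * (norm (S t))\<^sup>2)
      = (\<Sum>k\<in>J. \<Sum>l\<in>J. c k * cnj (c l) * (complex_of_real (wt t) * cis ((w k - w l) * t)))" for t
  proof -
    have "complex_of_real ((norm (S t))\<^sup>2) = S t * cnj (S t)"
      by (rule complex_norm_square)
    also have "\<dots> = (\<Sum>k\<in>J. \<Sum>l\<in>J. (c k * cis (w k * t)) * cnj (c l * cis (w l * t)))"
      by (simp add: S_def sum_product)
    also have "\<dots> = (\<Sum>k\<in>J. \<Sum>l\<in>J. c k * cnj (c l) * cis ((w k - w l) * t))"
    proof (intro sum.cong refl)
      fix k l
      have "cis (w k * t) * cis (- (w l * t)) = cis ((w k - w l) * t)"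
        by (simp add: cis_mult algebra_simps)
      then show "(c k * cis (w k * t)) * cnj (c l * cis (w l * t)) = c k * cnj (c l) * cis ((w k - w l) * t)"
        by (simp add: cis_cnj mult_ac)
    qed
    finally show ?thesis by (simp add: sum_distrib_left mult_ac)
  qed
  have "complex_of_real Q = integral {a..a + L} (\<lambda>t. complex_of_real (wt t * (norm (S t))\<^sup>2))"
    unfolding Q_def
    by (intro integral_unique[symmetric] has_integral_of_real integrable_integral
        integrable_continuous_real continuous_intros contS contw)
  also have "\<dots> = (\<Sum>k\<in>J. \<Sum>l\<in>J. c k * cnj (c l) * I k l)"
    unfolding expand I_def using fin
    by (simp add: integral_sum integrable_sum integrable_continuous_real continuous_intros contw)
  finally have "norm (complex_of_real Q) \<le> (\<Sum>k\<in>J. norm (\<Sum>l\<in>J. c k * cnj (c l) * I k l))"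
    by (simp only:) (rule norm_sum)
  also have "\<dots> \<le> (\<Sum>k\<in>J. \<Sum>l\<in>J. norm (c k * cnj (c l) * I k l))"
    by (intro sum_mono norm_sum)
  also have "\<dots> \<le> (\<Sum>k\<in>J. \<Sum>l\<in>J. ((norm (c k))\<^sup>2 / 2 + (norm (c l))\<^sup>2 / 2)
      * (L ^ 3 * (if k = l then 1 else 1 / (real_of_int (k - l))\<^sup>2)))"
  proof (intro sum_mono)
    fix k l assume "k \<in> J" "l \<in> J"
    have "norm (c k) * norm (c l) \<le> (norm (c k))\<^sup>2 / 2 + (norm (c l))\<^sup>2 / 2"
      using sum_squares_bound[of "norm (c k)" "norm (c l)"] by simp
    then show "norm (c k * cnj (c l) * I k l) \<le> ((norm (c k))\<^sup>2 / 2 + (norm (c l))\<^sup>2 / 2)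
      * (L ^ 3 * (if k = l then 1 else 1 / (real_of_int (k - l))\<^sup>2))"
      using Ibound[OF \<open>k \<in> J\<close> \<open>l \<in> J\<close>] unfolding norm_mult complex_mod_cnj
      by (intro mult_mono) auto
  qed
  \<comment> \<open>Schur's test: the kernel is symmetric in k and l, so the two halves coming from
    the arithmetic-geometric inequality have equal sums and merge into one.\<close>
  also have "\<dots> = (\<Sum>k\<in>J. \<Sum>l\<in>J. (norm (c k))\<^sup>2 * (L ^ 3 * (if k = l then 1 else 1 / (real_of_int (k - l))\<^sup>2)))"
  proof -
    let ?r = "\<lambda>k l. L ^ 3 * (if k = l then 1 else 1 / (real_of_int (k - l))\<^sup>2)"
    let ?u = "\<lambda>k l. (norm (c k))\<^sup>2 / 2 * ?r k l"
    have "(\<Sum>k\<in>J. \<Sum>l\<in>J. (norm (c l))\<^sup>2 / 2 * ?r k l) = (\<Sum>l\<in>J. \<Sum>k\<in>J. (norm (c l))\<^sup>2 / 2 * ?r k l)"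
      by (rule sum.swap)
    also have "\<dots> = (\<Sum>k\<in>J. \<Sum>l\<in>J. ?u k l)"
      by (intro sum.cong refl) (auto simp: power2_commute)
    finally have "(\<Sum>k\<in>J. \<Sum>l\<in>J. (norm (c l))\<^sup>2 / 2 * ?r k l) = (\<Sum>k\<in>J. \<Sum>l\<in>J. ?u k l)" .
    then have "(\<Sum>k\<in>J. \<Sum>l\<in>J. ((norm (c k))\<^sup>2 / 2 + (norm (c l))\<^sup>2 / 2) * ?r k l)
        = (\<Sum>k\<in>J. \<Sum>l\<in>J. ?u k l) + (\<Sum>k\<in>J. \<Sum>l\<in>J. ?u k l)"
      by (simp add: distrib_right sum.distrib)
    also have "\<dots> = (\<Sum>k\<in>J. \<Sum>l\<in>J. ?u k l + ?u k l)" by (simp only: sum.distrib)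
    also have "\<dots> = (\<Sum>k\<in>J. \<Sum>l\<in>J. (norm (c k))\<^sup>2 * ?r k l)"
      by (intro sum.cong refl) (simp add: field_simps)
    finally show ?thesis .
  qed
  also have "\<dots> = (\<Sum>k\<in>J. (norm (c k))\<^sup>2 * L ^ 3 * (\<Sum>l\<in>J. if k = l then 1 else 1 / (real_of_int (k - l))\<^sup>2))"
    by (simp only: sum_distrib_left mult.assoc)
  also have "\<dots> \<le> (\<Sum>k\<in>J. (norm (c k))\<^sup>2 * L ^ 3 * 5)"
    by (intro sum_mono mult_left_mono sum_off_diagonal_le[OF fin]) (use L0 in auto)
  also have "\<dots> = 5 * L ^ 3 * (\<Sum>k\<in>J. (norm (c k))\<^sup>2)"
    by (simp add: sum_distrib_left mult_ac)
  finally have "Q \<le> 5 * L ^ 3 * (\<Sum>k\<in>J. (norm (c k))\<^sup>2)" by simp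
  with low have "3 * L\<^sup>2 / 16 * integral {b..b + h} (\<lambda>t. (norm (S t))\<^sup>2) \<le> 5 * L ^ 3 * (\<Sum>k\<in>J. (norm (c k))\<^sup>2)"
    by linarith
  \<comment> \<open>Dividing 5 * L^3 by 3 * L^2 / 16 gives 80 * L / 3 = 160 / (3 * g), rounded up to
    54 / g below.\<close>
  then have "integral {b..b + h} (\<lambda>t. (norm (S t))\<^sup>2) \<le> 80 / 3 * L * (\<Sum>k\<in>J. (norm (c k))\<^sup>2)"
    using L0 by (simp add: field_simps power2_eq_square power3_eq_cube)
  also have "\<dots> \<le> 54 / g * (\<Sum>k\<in>J. (norm (c k))\<^sup>2)"
    using g by (intro mult_right_mono) (auto simp: L_def field_simps sum_nonneg)
  finally show ?thesis by (simp add: S_def)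
qed

section \<open>Primitives of bounded measurable functions\<close>

text \<open>A Lipschitz function x with a chosen bounded representative x' of its derivative. The
  integral identity replaces differentiability, which may fail at individual times when the forcing
  is only measurable. The bound on x' is required at every point, so that later suprema over time
  need no exceptional null sets.\<close>

definition bounded_primitive :: "real \<Rightarrow> real \<Rightarrow> (real \<Rightarrow> complex) \<Rightarrow> (real \<Rightarrow> complex) \<Rightarrow> bool" where
  "bounded_primitive a b x x' \<longleftrightarrow>
     x' \<in> borel_measurable (lebesgue_on {a..b}) \<and> (\<exists>B. \<forall>t\<in>{a..b}. norm (x' t) \<le> B) \<and>
     (\<forall>s t. a \<le> s \<longrightarrow> s \<le> t \<longrightarrow> t \<le> b \<longrightarrow> x t - x s = integral {s..t} x')"

lemma bounded_integrable_lebesgue_on: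
  fixes f :: "real \<Rightarrow> 'a::euclidean_space"
  assumes "f \<in> borel_measurable (lebesgue_on {a..b})" "\<And>t. t \<in> {a..b} \<Longrightarrow> norm (f t) \<le> B"
  shows "integrable (lebesgue_on {a..b}) f"
proof -
  have "finite_measure (lebesgue_on {a..b})"
    by (rule finite_measure_lebesgue_on) auto
  then show ?thesis
    by (rule finite_measure.integrable_const_bound[where B = B]) (use assms in auto)
qed

lemma bounded_integrable_on:
  fixes f :: "real \<Rightarrow> 'a::euclidean_space"
  assumes "f \<in> borel_measurable (lebesgue_on {a..b})" "\<And>t. t \<in> {a..b} \<Longrightarrow> norm (f t) \<le> B"
  shows "f integrable_on {a..b}"
  using bounded_integrable_lebesgue_on[OF assms] by (rule integrable_on_lebesgue_on) auto

lemma continuous_on_measurable_lebesgue_on: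
  fixes f :: "real \<Rightarrow> 'a::euclidean_space"
  assumes "continuous_on {a..b} f"
  shows "f \<in> borel_measurable (lebesgue_on {a..b})"
  using assms by (rule continuous_imp_measurable_on_sets_lebesgue) auto

lemma bounded_primitive_subset:
  assumes "bounded_primitive a b x x'" "a \<le> c" "d \<le> b"
  shows "bounded_primitive c d x x'"
proof -
  have sub: "{c..d} \<subseteq> {a..b}" using assms by auto
  have "x' \<in> borel_measurable (lebesgue_on {c..d})"
    using assms(1) by (intro measurable_restrict_mono[OF _ sub]) (simp add: bounded_primitive_def)
  moreover have "\<exists>B. \<forall>t\<in>{c..d}. norm (x' t) \<le> B"
    using assms(1) sub unfolding bounded_primitive_def by (meson subsetD)
  moreover have "x t - x s = integral {s..t} x'" if "c \<le> s" "s \<le> t" "t \<le> d" for s t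
    using assms that unfolding bounded_primitive_def by auto
  ultimately show ?thesis
    unfolding bounded_primitive_def by blast
qed

lemma bounded_primitive_integrable:
  assumes "bounded_primitive a b x x'"
  shows "x' integrable_on {a..b}"
proof -
  obtain B where "x' \<in> borel_measurable (lebesgue_on {a..b})" "\<forall>t\<in>{a..b}. norm (x' t) \<le> B"
    using assms unfolding bounded_primitive_def by blast
  then show ?thesis by (intro bounded_integrable_on[where B = B]) auto
qed

lemma bounded_primitive_bound:
  assumes "bounded_primitive a b x x'"
  obtains B where "0 \<le> B" "\<And>t. t \<in> {a..b} \<Longrightarrow> norm (x' t) \<le> B"
    "\<And>s t. a \<le> s \<Longrightarrow> s \<le> t \<Longrightarrow> t \<le> b \<Longrightarrow> norm (x t - x s) \<le> B * (t - s)"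
proof -
  obtain B where B: "\<forall>t\<in>{a..b}. norm (x' t) \<le> B" using assms unfolding bounded_primitive_def by blast
  have B': "norm (x' t) \<le> max B 0" if "t \<in> {a..b}" for t using B that by force
  show ?thesis
  proof (rule that)
    fix s t assume st: "a \<le> s" "s \<le> t" "t \<le> b"
    have "norm (integral {s..t} x') \<le> integral {s..t} (\<lambda>_. max B 0)"
      by (rule integral_norm_bound_integral)
        (use st B' bounded_primitive_integrable[OF bounded_primitive_subset[OF assms]] in auto)
    then show "norm (x t - x s) \<le> max B 0 * (t - s)"
      using assms st unfolding bounded_primitive_def by (simp add: mult.commute)
  qed (use B' in auto)
qed

lemma bounded_primitive_continuous:
  assumes "bounded_primitive a b x x'"
  shows "continuous_on {a..b} x"
proof -
  obtain B where B: "0 \<le> B" "\<And>s t. a \<le> s \<Longrightarrow> s \<le> t \<Longrightarrow> t \<le> b \<Longrightarrow> norm (x t - x s) \<le> B * (t - s)"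
    using bounded_primitive_bound[OF assms] by metis
  have "B-lipschitz_on {a..b} x"
  proof (rule lipschitz_onI)
    fix s t assume st: "s \<in> {a..b}" "t \<in> {a..b}"
    show "dist (x s) (x t) \<le> B * dist s t"
      using B(2)[of s t] B(2)[of t s] st
      by (cases "s \<le> t") (auto simp: dist_norm norm_minus_commute)
  qed (rule B)
  then show ?thesis by (rule lipschitz_on_continuous_on)
qed

lemma bounded_primitive_sum:
  assumes "\<And>k. k \<in> J \<Longrightarrow> bounded_primitive a b (x k) (x' k)"
  shows "bounded_primitive a b (\<lambda>t. \<Sum>k\<in>J. x k t) (\<lambda>t. \<Sum>k\<in>J. x' k t)"
proof (cases "finite J")
  case True
  have "\<forall>k\<in>J. \<exists>B. \<forall>t\<in>{a..b}. norm (x' k t) \<le> B" using assms unfolding bounded_primitive_def by blast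
  then obtain B where B: "\<forall>k\<in>J. \<forall>t\<in>{a..b}. norm (x' k t) \<le> B k" by metis
  then have "\<forall>t\<in>{a..b}. norm (\<Sum>k\<in>J. x' k t) \<le> (\<Sum>k\<in>J. B k)"
    by (auto intro!: sum_norm_le)
  moreover have "(\<Sum>k\<in>J. x k t) - (\<Sum>k\<in>J. x k s) = integral {s..t} (\<lambda>t. \<Sum>k\<in>J. x' k t)"
    if "a \<le> s" "s \<le> t" "t \<le> b" for s t
  proof -
    have "integral {s..t} (\<lambda>t. \<Sum>k\<in>J. x' k t) = (\<Sum>k\<in>J. integral {s..t} (x' k))"
      by (rule integral_sum[OF True]) (use that bounded_primitive_integrable[OF bounded_primitive_subset[OF assms]] in auto)
    also have "\<dots> = (\<Sum>k\<in>J. x k t - x k s)"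
      using assms that unfolding bounded_primitive_def by (intro sum.cong) auto
    finally show ?thesis by (simp add: sum_subtractf)
  qed
  ultimately show ?thesis
    using assms unfolding bounded_primitive_def by (auto intro!: borel_measurable_sum)
next
  case False
  then show ?thesis by (auto simp: bounded_primitive_def)
qed

text \<open>The product rule without differentiation almost everywhere. Subtracting the integral of
  the expected derivative from the product leaves a function whose increments are quadratic in the
  time step. Its derivative is therefore zero at every point, and it is constant.\<close>

lemma bounded_primitive_mult:
  assumes x: "bounded_primitive a b x x'" and y: "bounded_primitive a b y y'"
  shows "bounded_primitive a b (\<lambda>t. x t * y t) (\<lambda>t. x' t * y t + x t * y' t)"
proof -
  obtain Bx where Bx: "0 \<le> Bx" "\<And>t. t \<in> {a..b} \<Longrightarrow> norm (x' t) \<le> Bx"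
    "\<And>s t. a \<le> s \<Longrightarrow> s \<le> t \<Longrightarrow> t \<le> b \<Longrightarrow> norm (x t - x s) \<le> Bx * (t - s)"
    using bounded_primitive_bound[OF x] by metis
  obtain By where By: "0 \<le> By" "\<And>t. t \<in> {a..b} \<Longrightarrow> norm (y' t) \<le> By"
    "\<And>s t. a \<le> s \<Longrightarrow> s \<le> t \<Longrightarrow> t \<le> b \<Longrightarrow> norm (y t - y s) \<le> By * (t - s)"
    using bounded_primitive_bound[OF y] by metis
  note cx = bounded_primitive_continuous[OF x] and cy = bounded_primitive_continuous[OF y]
  have mx: "x \<in> borel_measurable (lebesgue_on {a..b})" "x' \<in> borel_measurable (lebesgue_on {a..b})"
    and my: "y \<in> borel_measurable (lebesgue_on {a..b})" "y' \<in> borel_measurable (lebesgue_on {a..b})"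
    using continuous_on_measurable_lebesgue_on[OF cx] continuous_on_measurable_lebesgue_on[OF cy] x y
    by (auto simp: bounded_primitive_def)
  obtain Cx where Cx: "\<And>t. t \<in> {a..b} \<Longrightarrow> norm (x t) \<le> Cx"
    using compact_imp_bounded[OF compact_continuous_image[OF cx compact_Icc]] unfolding bounded_iff by blast
  obtain Cy where Cy: "\<And>t. t \<in> {a..b} \<Longrightarrow> norm (y t) \<le> Cy"
    using compact_imp_bounded[OF compact_continuous_image[OF cy compact_Icc]] unfolding bounded_iff by blast
  define z where "z = (\<lambda>t. x' t * y t + x t * y' t)"
  have mz: "z \<in> borel_measurable (lebesgue_on {a..b})"
    unfolding z_def using mx my by measurable
  have bz: "norm (z t) \<le> Bx * Cy + Cx * By" if "t \<in> {a..b}" for t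
    unfolding z_def
  proof (intro norm_triangle_le add_mono)
    show "norm (x' t * y t) \<le> Bx * Cy"
      unfolding norm_mult using Bx(1) by (intro mult_mono Bx(2) Cy that) auto
    show "norm (x t * y' t) \<le> Cx * By"
      unfolding norm_mult using order_trans[OF norm_ge_zero Cx[OF that]] by (intro mult_mono By(2) Cx that) auto
  qed
  have iz: "z integrable_on {a..b}" by (rule bounded_integrable_on[OF mz bz])
  have izs: "z integrable_on {s..t}" if "a \<le> s" "t \<le> b" for s t
    by (rule integrable_on_subinterval[OF iz]) (use that in auto)
  define D where "D = (\<lambda>t. x t * y t - integral {a..t} z)"
  \<comment> \<open>Of the 3 * Bx * By, one unit comes from the product of the two increments and
    two from freezing x and y at time s under the integral.\<close>
  have Dinc: "norm (D t - D s) \<le> 3 * Bx * By * (t - s)\<^sup>2" if st: "a \<le> s" "s \<le> t" "t \<le> b" for s t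
  proof -
    have ix: "x' integrable_on {s..t}" and iy: "y' integrable_on {s..t}"
      using bounded_primitive_integrable[OF bounded_primitive_subset[OF x]] bounded_primitive_integrable[OF bounded_primitive_subset[OF y]] st by auto
    have "integral {a..t} z = integral {a..s} z + integral {s..t} z"
      using Henstock_Kurzweil_Integration.integral_combine[of a s t z] st izs by simp
    moreover have "x t - x s = integral {s..t} x'" "y t - y s = integral {s..t} y'"
      using x y st by (auto simp: bounded_primitive_def)
    moreover have "x t * y t - x s * y s = (x t - x s) * y s + x s * (y t - y s) + (x t - x s) * (y t - y s)"
      by (simp add: algebra_simps)
    ultimately have "D t - D s = (x t - x s) * (y t - y s)
        + (integral {s..t} (\<lambda>r. x' r * y s) + integral {s..t} (\<lambda>r. x s * y' r) - integral {s..t} z)"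
      using ix iy by (simp add: D_def)
    also have "integral {s..t} (\<lambda>r. x' r * y s) + integral {s..t} (\<lambda>r. x s * y' r) - integral {s..t} z
        = integral {s..t} (\<lambda>r. x' r * y s + x s * y' r - z r)"
      using ix iy izs st
      by (simp add: Henstock_Kurzweil_Integration.integral_diff Henstock_Kurzweil_Integration.integral_add
          integrable_on_mult_left integrable_on_mult_right integrable_add)
    finally have eq: "D t - D s = (x t - x s) * (y t - y s) + integral {s..t} (\<lambda>r. x' r * y s + x s * y' r - z r)" .
    have 1: "norm ((x t - x s) * (y t - y s)) \<le> (Bx * (t - s)) * (By * (t - s))"
      unfolding norm_mult using Bx By st by (intro mult_mono) auto
    have 2: "norm (integral {s..t} (\<lambda>r. x' r * y s + x s * y' r - z r)) \<le> integral {s..t} (\<lambda>_. 2 * Bx * By * (t - s))"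
    proof (rule integral_norm_bound_integral)
      show "(\<lambda>r. x' r * y s + x s * y' r - z r) integrable_on {s..t}"
        using ix iy izs st by (intro integrable_diff integrable_add integrable_on_mult_left integrable_on_mult_right) auto
      fix r assume r: "r \<in> {s..t}"
      have e: "x' r * y s + x s * y' r - z r = - (x' r * (y r - y s) + (x r - x s) * y' r)"
        by (simp add: z_def algebra_simps)
      have "norm (x' r * (y r - y s)) \<le> Bx * (By * (t - s))"
        unfolding norm_mult
      proof (intro mult_mono)
        have "By * (r - s) \<le> By * (t - s)" using By(1) r by (intro mult_left_mono) auto
        then show "norm (y r - y s) \<le> By * (t - s)" using By(3)[of s r] st r by auto
      qed (use Bx st r in auto)
      moreover have "norm ((x r - x s) * y' r) \<le> (Bx * (t - s)) * By"
        unfolding norm_mult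
      proof (intro mult_mono)
        have "Bx * (r - s) \<le> Bx * (t - s)" using Bx(1) r by (intro mult_left_mono) auto
        then show "norm (x r - x s) \<le> Bx * (t - s)" using Bx(3)[of s r] st r by auto
      qed (use Bx By st r in auto)
      ultimately show "norm (x' r * y s + x s * y' r - z r) \<le> 2 * Bx * By * (t - s)"
        unfolding e norm_minus_cancel by (intro norm_triangle_le) (simp add: algebra_simps)
    qed auto
    have "norm (D t - D s) \<le> (Bx * (t - s)) * (By * (t - s)) + integral {s..t} (\<lambda>_. 2 * Bx * By * (t - s))"
      unfolding eq using 1 2 by (intro norm_triangle_le) auto
    also have "\<dots> = 3 * Bx * By * (t - s)\<^sup>2"
      using st by (simp add: power2_eq_square algebra_simps)
    finally show ?thesis .
  qed
  have Dsym: "norm (D t - D s) \<le> 3 * Bx * By * (t - s)\<^sup>2" if "t \<in> {a..b}" "s \<in> {a..b}" for s t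
    using Dinc[of s t] Dinc[of t s] that by (cases "s \<le> t") (auto simp: norm_minus_commute power2_commute)
  have der: "(D has_derivative (\<lambda>_. 0)) (at s within {a..b})" if s: "s \<in> {a..b}" for s
    unfolding has_derivative_within_alt
  proof (intro conjI allI impI)
    fix e :: real assume e: "0 < e"
    define d where "d = e / (3 * Bx * By + 1)"
    have p: "0 < 3 * Bx * By + 1" using Bx(1) By(1) by (simp add: add_nonneg_pos)
    have d0: "0 < d" using e p by (simp add: d_def)
    have "norm (D t - D s - 0) \<le> e * norm (t - s)" if t: "t \<in> {a..b}" "norm (t - s) < d" for t
    proof -
      have "norm (D t - D s - 0) \<le> (3 * Bx * By + 1) * (t - s)\<^sup>2"
        using Dsym[OF t(1) s] zero_le_power2[of "t - s"] by (simp only: diff_zero distrib_right mult_1_left)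
      also have "\<dots> = ((3 * Bx * By + 1) * norm (t - s)) * norm (t - s)"
        by (simp add: power2_eq_square[symmetric])
      also have "\<dots> \<le> e * norm (t - s)"
        using t p by (intro mult_right_mono) (auto simp: d_def field_simps)
      finally show ?thesis .
    qed
    with d0 show "\<exists>d>0. \<forall>y\<in>{a..b}. norm (y - s) < d \<longrightarrow> norm (D y - D s - 0) \<le> e * norm (y - s)"
      by blast
  qed simp
  have const: "D t = D s" if "t \<in> {a..b}" "s \<in> {a..b}" for s t
    proof -
    obtain c where "\<And>t. t \<in> {a..b} \<Longrightarrow> D t = c"
      using has_derivative_zero_constant[OF _ der] by auto
    then show ?thesis using that by simp
  qed
  have "x t * y t - x s * y s = integral {s..t} z" if st: "a \<le> s" "s \<le> t" "t \<le> b" for s t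
  proof -
    have "integral {a..t} z = integral {a..s} z + integral {s..t} z"
      using Henstock_Kurzweil_Integration.integral_combine[of a s t z] st izs by simp
    then show ?thesis using const[of s t] st by (auto simp: D_def algebra_simps)
  qed
  then show ?thesis
    using mz bz unfolding bounded_primitive_def z_def by blast
qed

lemma bounded_primitive_C1:
  assumes "continuous_on {a..b} x'"
    and "\<And>t. t \<in> {a..b} \<Longrightarrow> (x has_vector_derivative x' t) (at t within {a..b})"
  shows "bounded_primitive a b x x'"
proof -
  have "\<exists>B. \<forall>t\<in>{a..b}. norm (x' t) \<le> B"
    using compact_imp_bounded[OF compact_continuous_image[OF assms(1) compact_Icc]] unfolding bounded_iff by blast
  moreover have "x t - x s = integral {s..t} x'" if st: "a \<le> s" "s \<le> t" "t \<le> b" for s t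
  proof -
    have "(x' has_integral (x t - x s)) {s..t}"
      by (rule fundamental_theorem_of_calculus)
        (use st in \<open>auto intro!: has_vector_derivative_within_subset[OF assms(2)]\<close>)
    then show ?thesis by (simp add: integral_unique)
  qed
  ultimately show ?thesis
    unfolding bounded_primitive_def using continuous_on_measurable_lebesgue_on[OF assms(1)] by auto
qed

lemma bounded_primitive_cmult:
  assumes "bounded_primitive a b x x'"
  shows "bounded_primitive a b (\<lambda>t. c * x t) (\<lambda>t. c * x' t)"
proof -
  have "bounded_primitive a b (\<lambda>_. c) (\<lambda>_. 0)"
    by (rule bounded_primitive_C1) auto
  from bounded_primitive_mult[OF this assms] show ?thesis by simp
qed

section \<open>The large sieve with moving coefficients\<close>

lemma integral_linear_combination:
  fixes f g :: "real \<Rightarrow> real"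
  assumes "f integrable_on S" "g integrable_on S"
  shows "integral S (\<lambda>s. c * f s + d * g s) = c * integral S f + d * integral S g"
  by (intro integral_unique has_integral_add has_integral_mult_right integrable_integral assms)

text \<open>Sobolev's inequality on an interval of length h. The value g t differs from any g s by
  at most the integral A of |g'|; Cauchy-Schwarz bounds A^2 by h times the integral of |g'|^2, and
  averaging over s gives the claim.\<close>

lemma norm_sq_le_integral:
  assumes g: "bounded_primitive b (b + h) g g'" and h: "0 < h" and t: "t \<in> {b..b + h}"
  shows "(norm (g t))\<^sup>2 \<le> integral {b..b + h} (\<lambda>s. 2 / h * (norm (g s))\<^sup>2 + 2 * h * (norm (g' s))\<^sup>2)"
proof -
  let ?I = "{b..b + h}"
  obtain B where B: "0 \<le> B" "\<And>t. t \<in> ?I \<Longrightarrow> norm (g' t) \<le> B"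
    using bounded_primitive_bound[OF g] by metis
  have m: "g' \<in> borel_measurable (lebesgue_on ?I)" using g by (simp add: bounded_primitive_def)
  have i1: "(\<lambda>s. norm (g' s)) integrable_on ?I"
    by (rule bounded_integrable_on[where B = B]) (use m B in auto)
  have i2: "(\<lambda>s. (norm (g' s))\<^sup>2) integrable_on ?I"
    by (rule bounded_integrable_on[where B = "B\<^sup>2"]) (use m B in \<open>auto intro!: power_mono\<close>)
  have i3: "(\<lambda>s. (norm (g s))\<^sup>2) integrable_on ?I"
    by (intro integrable_continuous_real continuous_intros bounded_primitive_continuous[OF g])
  define A where "A = integral ?I (\<lambda>s. norm (g' s))"
  define m where "m = A / h"
  have A0: "0 \<le> A" unfolding A_def by (rule integral_nonneg[OF i1]) auto
  \<comment> \<open>Cauchy-Schwarz, obtained by expanding the nonnegative integral of (|g'| - m)^2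
    with m the mean of |g'|.\<close>
  have Asq: "A\<^sup>2 \<le> h * integral ?I (\<lambda>s. (norm (g' s))\<^sup>2)"
  proof -
    have e: "(norm (g' s) - m)\<^sup>2 = (norm (g' s))\<^sup>2 + m\<^sup>2 - (2 * m) * norm (g' s)" for s
      by (simp add: power2_diff algebra_simps)
    have nn: "0 \<le> (norm (g' s))\<^sup>2 + m\<^sup>2 - (2 * m) * norm (g' s)" for s
      using zero_le_power2[of "norm (g' s) - m"] unfolding e .
    have "0 \<le> integral ?I (\<lambda>s. (norm (g' s))\<^sup>2 + m\<^sup>2 - (2 * m) * norm (g' s))"
      by (rule integral_nonneg[OF _ nn])
         (intro integrable_add integrable_diff integrable_on_mult_right integrable_const_ivl i1 i2)
    also have "integral ?I (\<lambda>s. (norm (g' s))\<^sup>2 + m\<^sup>2 - (2 * m) * norm (g' s)) = integral ?I (\<lambda>s. (norm (g' s))\<^sup>2) + h * m\<^sup>2 - 2 * m * A"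
    proof (rule integral_unique)
      have "((\<lambda>s. m\<^sup>2) has_integral h * m\<^sup>2) ?I"
        using has_integral_const_real[of "m\<^sup>2" b "b + h"] h by simp
      then show "((\<lambda>s. (norm (g' s))\<^sup>2 + m\<^sup>2 - (2 * m) * norm (g' s)) has_integral
          (integral ?I (\<lambda>s. (norm (g' s))\<^sup>2) + h * m\<^sup>2 - 2 * m * A)) ?I"
        unfolding A_def
        by (intro has_integral_diff has_integral_add has_integral_mult_right integrable_integral i1 i2)
    qed
    finally show ?thesis using h by (simp add: m_def power2_eq_square field_simps)
  qed
  have diff: "norm (g t - g s) \<le> A" if s: "s \<in> ?I" for s
  proof -
    have gen: "norm (g v - g u) \<le> A" if uv: "b \<le> u" "u \<le> v" "v \<le> b + h" for u v
    proof -
      have "norm (g v - g u) = norm (integral {u..v} g')" using g uv by (simp add: bounded_primitive_def)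
      also have "\<dots> \<le> integral {u..v} (\<lambda>s. norm (g' s))"
        by (rule integral_norm_bound_integral)
          (use uv i1 bounded_primitive_integrable[OF g] in \<open>auto intro: integrable_on_subinterval\<close>)
      also have "\<dots> \<le> A"
        unfolding A_def by (rule integral_subset_le) (use uv i1 in \<open>auto intro: integrable_on_subinterval\<close>)
      finally show ?thesis .
    qed
    show ?thesis using gen[of s t] gen[of t s] s t by (cases "s \<le> t") (auto simp: norm_minus_commute)
  qed
  have pt: "(norm (g t))\<^sup>2 \<le> 2 * (norm (g s))\<^sup>2 + 2 * A\<^sup>2" if s: "s \<in> ?I" for s
  proof -
    have "norm (g t) \<le> norm (g s) + A" using norm_triangle_sub[of "g t" "g s"] diff[OF s] by linarith
    then have "(norm (g t))\<^sup>2 \<le> (norm (g s) + A)\<^sup>2" by (intro power_mono) auto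
    also have "\<dots> \<le> 2 * (norm (g s))\<^sup>2 + 2 * A\<^sup>2"
      using sum_squares_bound[of "norm (g s)" A] by (simp add: power2_sum)
    finally show ?thesis .
  qed
  have "h * (norm (g t))\<^sup>2 = integral ?I (\<lambda>s. (norm (g t))\<^sup>2)" using h by simp
  also have "\<dots> \<le> integral ?I (\<lambda>s. 2 * (norm (g s))\<^sup>2 + 2 * A\<^sup>2)"
    by (rule integral_le) (use i3 pt in \<open>auto intro!: integrable_add integrable_on_mult_right\<close>)
  also have "\<dots> = 2 * integral ?I (\<lambda>s. (norm (g s))\<^sup>2) + 2 * h * A\<^sup>2"
    using integral_linear_combination[OF i3 integrable_const_ivl, of 2 1 "2 * A\<^sup>2"] h by simp
  also have "\<dots> \<le> 2 * integral ?I (\<lambda>s. (norm (g s))\<^sup>2) + 2 * h * (h * integral ?I (\<lambda>s. (norm (g' s))\<^sup>2))"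
    using Asq h by simp
  also have "\<dots> = h * (2 / h * integral ?I (\<lambda>s. (norm (g s))\<^sup>2) + 2 * h * integral ?I (\<lambda>s. (norm (g' s))\<^sup>2))"
    using h by (simp add: field_simps)
  also have "2 / h * integral ?I (\<lambda>s. (norm (g s))\<^sup>2) + 2 * h * integral ?I (\<lambda>s. (norm (g' s))\<^sup>2)
     = integral ?I (\<lambda>s. 2 / h * (norm (g s))\<^sup>2 + 2 * h * (norm (g' s))\<^sup>2)"
    by (rule integral_linear_combination[OF i3 i2, symmetric])
  finally show ?thesis using h by simp
qed


text \<open>The time in the coefficients is decoupled from the time in the phases:
  \<open>S s t\<close> takes coefficients at s and phases at t. On the diagonal, Sobolev in s with t
  frozen bounds the square of \<open>S t t\<close> by an integral over s. After exchanging the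
  integrals it is s that is frozen; the coefficients are then constants and
  \<open>large_sieve\<close> applies in t, to c and to c' alike.\<close>

lemma large_sieve_moving:
  fixes J :: "int set" and w :: "int \<Rightarrow> real" and c c' :: "int \<Rightarrow> real \<Rightarrow> complex"
  assumes fin: "finite J" and g: "0 < g"
    and sep: "\<And>k l. k \<in> J \<Longrightarrow> l \<in> J \<Longrightarrow> g * \<bar>real_of_int (k - l)\<bar> \<le> \<bar>w k - w l\<bar>"
    and h: "0 < h" "h \<le> 1 / g"
    and c: "\<And>k. k \<in> J \<Longrightarrow> bounded_primitive b (b + h) (c k) (c' k)"
  shows "integral {b..b + h} (\<lambda>t. (norm (\<Sum>k\<in>J. c k t * cis (w k * t)))\<^sup>2)
    \<le> 54 / g * integral {b..b + h} (\<lambda>s. \<Sum>k\<in>J. 2 / h * (norm (c k s))\<^sup>2 + 2 * h * (norm (c' k s))\<^sup>2)"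
proof -
  let ?I = "{b..b + h}"
  define M where "M = lebesgue_on ?I"
  define S where "S = (\<lambda>s t. \<Sum>k\<in>J. c k s * cis (w k * t))"
  define S' where "S' = (\<lambda>s t. \<Sum>k\<in>J. c' k s * cis (w k * t))"
  define E where "E = (\<lambda>s t. 2 / h * (norm (S s t))\<^sup>2 + 2 * h * (norm (S' s t))\<^sup>2)"
  define R where "R = (\<lambda>s. \<Sum>k\<in>J. 2 / h * (norm (c k s))\<^sup>2 + 2 * h * (norm (c' k s))\<^sup>2)"
  have contc: "continuous_on ?I (c k)" if "k \<in> J" for k
    by (rule bounded_primitive_continuous[OF c[OF that]])
  have mc[measurable]: "c k \<in> borel_measurable M" if "k \<in> J" for k
    unfolding M_def by (rule continuous_on_measurable_lebesgue_on[OF contc[OF that]])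
  have mc'[measurable]: "c' k \<in> borel_measurable M" if "k \<in> J" for k
    using c[OF that] by (simp add: M_def bounded_primitive_def)
  have mcis[measurable]: "(\<lambda>t. cis (v * t)) \<in> borel_measurable M" for v
    unfolding M_def by (intro continuous_on_measurable_lebesgue_on continuous_intros)
  have "\<exists>B. \<forall>s\<in>?I. norm (c k s) \<le> B \<and> norm (c' k s) \<le> B" if k: "k \<in> J" for k
  proof -
    obtain B where B: "\<And>t. t \<in> ?I \<Longrightarrow> norm (c' k t) \<le> B"
      using bounded_primitive_bound[OF c[OF k]] by metis
    obtain C where C: "\<And>t. t \<in> ?I \<Longrightarrow> norm (c k t) \<le> C"
      using compact_imp_bounded[OF compact_continuous_image[OF contc[OF k] compact_Icc]]
      unfolding bounded_iff by blast
    show ?thesis by (rule exI[of _ "max B C"]) (use B C in force)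
  qed
  then obtain B where B: "\<And>k s. k \<in> J \<Longrightarrow> s \<in> ?I \<Longrightarrow> norm (c k s) \<le> B k \<and> norm (c' k s) \<le> B k"
    by metis
  define C where "C = (\<Sum>k\<in>J. B k)"
  have SC: "norm (S s t) \<le> C" "norm (S' s t) \<le> C" if "s \<in> ?I" for s t
    unfolding S_def S'_def C_def using B that by (auto intro!: sum_norm_le simp: norm_mult)
  have mE: "(\<lambda>p. E (fst p) (snd p)) \<in> borel_measurable (M \<Otimes>\<^sub>M M)"
    unfolding E_def S_def S'_def by measurable
  have E0: "0 \<le> E s t" for s t
    unfolding E_def using h by simp
  have EC: "E s t \<le> 2 / h * C\<^sup>2 + 2 * h * C\<^sup>2" if "s \<in> ?I" for s t
    unfolding E_def using h SC[OF that] by (intro add_mono mult_left_mono power_mono) auto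
  have finM: "finite_measure M"
    unfolding M_def by (rule finite_measure_lebesgue_on) auto
  interpret M: finite_measure M by (rule finM)
  interpret P: pair_sigma_finite M M by standard
  interpret PF: finite_measure "M \<Otimes>\<^sub>M M"
    by (rule finite_measure_pair_measure[OF finM finM])
  have spM: "space M = ?I" by (simp add: M_def)
  have iE: "integrable (M \<Otimes>\<^sub>M M) (\<lambda>(s, t). E s t)"
    by (rule PF.integrable_const_bound[where B = "2 / h * C\<^sup>2 + 2 * h * C\<^sup>2"])
      (use mE E0 EC in \<open>auto simp: space_pair_measure spM case_prod_beta\<close>)
  have iE1: "integrable M (\<lambda>t. E s t)" if "s \<in> ?I" for s
    by (rule M.integrable_const_bound[where B = "2 / h * C\<^sup>2 + 2 * h * C\<^sup>2"])
      (use E0 EC that in \<open>auto simp: spM E_def S_def S'_def\<close>)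
  have iE2: "integrable M (\<lambda>s. E s t)" for t
    by (rule M.integrable_const_bound[where B = "2 / h * C\<^sup>2 + 2 * h * C\<^sup>2"])
      (use E0 EC in \<open>auto simp: spM E_def S_def S'_def\<close>)
  have swap: "(LINT t|M. LINT s|M. E s t) = (LINT s|M. LINT t|M. E s t)"
    by (rule P.Fubini_integral[OF iE])
  have int_outer: "integrable M (\<lambda>t. LINT s|M. E s t)" "integrable M (\<lambda>s. LINT t|M. E s t)"
    using P.integrable_snd[OF iE] P.integrable_fst[OF iE] by auto
  have toHK: "integral\<^sup>L M f = integral ?I f" if "integrable M f" for f :: "real \<Rightarrow> real"
    using that unfolding M_def by (rule lebesgue_integral_eq_integral) auto
  have pt: "(norm (S t t))\<^sup>2 \<le> (LINT s|M. E s t)" if t: "t \<in> ?I" for t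
  proof -
    have "bounded_primitive b (b + h) (\<lambda>s. S s t) (\<lambda>s. S' s t)"
      unfolding S_def S'_def mult.commute[of _ "cis _"]
      by (intro bounded_primitive_sum bounded_primitive_cmult c)
    from norm_sq_le_integral[OF this h(1) t] show ?thesis
      unfolding toHK[OF iE2] by (simp add: E_def)
  qed
  have contS: "continuous_on ?I (\<lambda>t. S t t)"
    unfolding S_def by (intro continuous_intros contc)
  have iS: "integrable M (\<lambda>t. (norm (S t t))\<^sup>2)"
    by (rule M.integrable_const_bound[where B = "C\<^sup>2"])
      (use SC contS in \<open>auto simp: spM M_def intro!: power_mono continuous_on_measurable_lebesgue_on continuous_intros\<close>)
  have inner: "(LINT t|M. E s t) \<le> 54 / g * R s" if s: "s \<in> ?I" for s
  proof -
    have i1: "(\<lambda>t. (norm (S s t))\<^sup>2) integrable_on ?I" "(\<lambda>t. (norm (S' s t))\<^sup>2) integrable_on ?I"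
      unfolding S_def S'_def by (intro integrable_continuous_real continuous_intros)+
    have "(LINT t|M. E s t) = 2 / h * integral ?I (\<lambda>t. (norm (S s t))\<^sup>2) + 2 * h * integral ?I (\<lambda>t. (norm (S' s t))\<^sup>2)"
      unfolding toHK[OF iE1[OF s]] unfolding E_def by (rule integral_linear_combination[OF i1])
    also have "\<dots> \<le> 2 / h * (54 / g * (\<Sum>k\<in>J. (norm (c k s))\<^sup>2)) + 2 * h * (54 / g * (\<Sum>k\<in>J. (norm (c' k s))\<^sup>2))"
      unfolding S_def S'_def using h
      by (intro add_mono mult_left_mono large_sieve[OF fin g sep]) auto
    also have "\<dots> = 54 / g * R s"
      unfolding R_def by (simp add: sum.distrib sum_distrib_left algebra_simps)
    finally show ?thesis .
  qed
  have iR: "integrable M R"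
  proof (rule M.integrable_const_bound[where B = "\<Sum>k\<in>J. 2 / h * (B k)\<^sup>2 + 2 * h * (B k)\<^sup>2"])
    have "norm (R s) \<le> (\<Sum>k\<in>J. 2 / h * (B k)\<^sup>2 + 2 * h * (B k)\<^sup>2)" if s: "s \<in> ?I" for s
      unfolding R_def
    proof (rule sum_norm_le)
      fix k assume "k \<in> J"
      then show "norm (2 / h * (norm (c k s))\<^sup>2 + 2 * h * (norm (c' k s))\<^sup>2) \<le> 2 / h * (B k)\<^sup>2 + 2 * h * (B k)\<^sup>2"
        unfolding real_norm_def using h B[OF _ s]
        by (subst abs_of_nonneg) (auto intro!: add_nonneg_nonneg add_mono mult_left_mono power_mono divide_right_mono)
    qed
    then show "AE s in M. norm (R s) \<le> (\<Sum>k\<in>J. 2 / h * (B k)\<^sup>2 + 2 * h * (B k)\<^sup>2)"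
      by (intro AE_I2) (simp add: spM)
    show "R \<in> borel_measurable M" unfolding R_def by measurable
  qed
  have "integral ?I (\<lambda>t. (norm (S t t))\<^sup>2) = (LINT t|M. (norm (S t t))\<^sup>2)"
    by (rule toHK[OF iS, symmetric])
  also have "\<dots> \<le> (LINT t|M. LINT s|M. E s t)"
    by (intro integral_mono iS int_outer) (use pt in \<open>auto simp: spM\<close>)
  also have "\<dots> = (LINT s|M. LINT t|M. E s t)" by (rule swap)
  also have "\<dots> \<le> (LINT s|M. 54 / g * R s)"
    by (intro integral_mono integrable_mult_right iR int_outer) (use inner in \<open>auto simp: spM\<close>)
  also have "\<dots> = 54 / g * integral ?I R"
    by (simp add: toHK[OF iR])
  finally show ?thesis by (simp add: S_def R_def)
qed

lemma integral_le_partition: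
  fixes f r :: "real \<Rightarrow> real"
  assumes h: "0 \<le> h" and f: "f integrable_on {0..real n * h}" and r: "r integrable_on {0..real n * h}"
    and le: "\<And>j. j < n \<Longrightarrow> integral {real j * h..real j * h + h} f \<le> C * integral {real j * h..real j * h + h} r"
  shows "integral {0..real n * h} f \<le> C * integral {0..real n * h} r"
  using f r le
proof (induction n)
  case (Suc n)
  have e: "real (Suc n) * h = real n * h + h" by (simp add: algebra_simps)
  have sub: "{0..real n * h} \<subseteq> {0..real (Suc n) * h}" using h unfolding e by auto
  have "integral {0..real n * h} f \<le> C * integral {0..real n * h} r"
    by (intro Suc.IH integrable_on_subinterval[OF Suc.prems(1) sub] integrable_on_subinterval[OF Suc.prems(2) sub] Suc.prems(3)) simp
  moreover have "integral {real n * h..real n * h + h} f \<le> C * integral {real n * h..real n * h + h} r"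
    using Suc.prems(3) by simp
  moreover have "integral {0..real (Suc n) * h} f = integral {0..real n * h} f + integral {real n * h..real n * h + h} f"
    using Henstock_Kurzweil_Integration.integral_combine[of 0 "real n * h" "real (Suc n) * h" f] Suc.prems(1) h unfolding e by simp
  moreover have "integral {0..real (Suc n) * h} r = integral {0..real n * h} r + integral {real n * h..real n * h + h} r"
    using Henstock_Kurzweil_Integration.integral_combine[of 0 "real n * h" "real (Suc n) * h" r] Suc.prems(2) h unfolding e by simp
  ultimately show ?case by (simp add: distrib_left)
qed simp

lemma bounded_primitive_norm_sq_integrable:
  assumes "bounded_primitive a b x x'"
  shows "(\<lambda>s. (norm (x' s))\<^sup>2) integrable_on {a..b}"
proof -
  obtain B where B: "0 \<le> B" "\<And>t. t \<in> {a..b} \<Longrightarrow> norm (x' t) \<le> B"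
    using bounded_primitive_bound[OF assms] by metis
  show ?thesis
    by (rule bounded_integrable_on[where B = "B\<^sup>2"])
      (use assms B in \<open>auto simp: bounded_primitive_def intro!: power_mono\<close>)
qed

text \<open>Summation over n windows of length T / n. The factor 2 of the Sobolev inequality is
  moved into the constant, 108 = 2 * 54, so that the weights become n / T and T / n.\<close>

lemma large_sieve_global:
  fixes J :: "int set" and w :: "int \<Rightarrow> real" and c c' :: "int \<Rightarrow> real \<Rightarrow> complex"
  assumes fin: "finite J" and g: "0 < g" and n: "0 < n"
    and sep: "\<And>k l. k \<in> J \<Longrightarrow> l \<in> J \<Longrightarrow> g * \<bar>real_of_int (k - l)\<bar> \<le> \<bar>w k - w l\<bar>"
    and T: "0 < T" "T / real n \<le> 1 / g"
    and c: "\<And>k. k \<in> J \<Longrightarrow> bounded_primitive 0 T (c k) (c' k)"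
  shows "integral {0..T} (\<lambda>t. (norm (\<Sum>k\<in>J. c k t * cis (w k * t)))\<^sup>2)
    \<le> 108 / g * integral {0..T} (\<lambda>s. \<Sum>k\<in>J. real n / T * (norm (c k s))\<^sup>2 + T / real n * (norm (c' k s))\<^sup>2)"
proof -
  define h where "h = T / real n"
  have h0: "0 < h" and nh: "real n * h = T" using T n by (auto simp: h_def)
  have contc: "continuous_on {0..T} (c k)" if "k \<in> J" for k
    by (rule bounded_primitive_continuous[OF c[OF that]])
  define r where "r = (\<lambda>s. \<Sum>k\<in>J. 2 / h * (norm (c k s))\<^sup>2 + 2 * h * (norm (c' k s))\<^sup>2)"
  have ic': "(\<lambda>s. (norm (c' k s))\<^sup>2) integrable_on {0..T}" if "k \<in> J" for k
    by (rule bounded_primitive_norm_sq_integrable[OF c[OF that]])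
  have ir: "r integrable_on {0..T}"
    unfolding r_def using contc ic' fin
    by (intro integrable_sum integrable_add integrable_on_mult_right)
       (auto intro!: integrable_continuous_real continuous_intros)
  have "integral {0..real n * h} (\<lambda>t. (norm (\<Sum>k\<in>J. c k t * cis (w k * t)))\<^sup>2)
    \<le> 54 / g * integral {0..real n * h} r"
  proof (rule integral_le_partition)
    fix j assume j: "j < n"
    have "real j * h + h \<le> real n * h"
      using j h0 mult_right_mono[of "real j + 1" "real n" h] by (simp add: algebra_simps)
    then have "bounded_primitive (real j * h) (real j * h + h) (c k) (c' k)" if "k \<in> J" for k
      by (intro bounded_primitive_subset[OF c[OF that]]) (use h0 nh in auto)
    then show "integral {real j * h..real j * h + h} (\<lambda>t. (norm (\<Sum>k\<in>J. c k t * cis (w k * t)))\<^sup>2)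
      \<le> 54 / g * integral {real j * h..real j * h + h} r"
      unfolding r_def by (intro large_sieve_moving[OF fin g sep h0]) (use T in \<open>auto simp: h_def\<close>)
  qed (use h0 ir in \<open>auto simp: nh intro!: integrable_continuous_real continuous_intros contc\<close>)
  also have "54 / g * integral {0..real n * h} r = 108 / g * integral {0..T} (\<lambda>s. r s / 2)"
    by (simp add: nh)
  also have "(\<lambda>s. r s / 2) = (\<lambda>s. \<Sum>k\<in>J. real n / T * (norm (c k s))\<^sup>2 + T / real n * (norm (c' k s))\<^sup>2)"
    unfolding r_def sum_divide_distrib h_def by (simp add: add_divide_distrib)
  finally show ?thesis by (simp add: nh)
qed

section \<open>Bilinear sums with separated phases\<close>

text \<open>For a given output \<xi> the first frequency k determines the second, \<xi> - k, so
  grouping pairs by their sum counts each pair exactly once. Sums of products of squares over all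
  outputs therefore factorise without loss.\<close>

lemma sum_over_outputs:
  fixes K\<^sub>1 K\<^sub>2 :: "int set" and f :: "int \<Rightarrow> int \<Rightarrow> 'a::comm_monoid_add"
  assumes "finite K\<^sub>1" "finite K\<^sub>2"
  shows "(\<Sum>\<xi>\<in>(\<lambda>(k, m). k + m) ` (K\<^sub>1 \<times> K\<^sub>2). \<Sum>k\<in>{k\<in>K\<^sub>1. \<xi> - k \<in> K\<^sub>2}. f k (\<xi> - k)) = (\<Sum>k\<in>K\<^sub>1. \<Sum>m\<in>K\<^sub>2. f k m)"
proof -
  let ?X = "(\<lambda>(k, m). k + m) ` (K\<^sub>1 \<times> K\<^sub>2)"
  have "(\<Sum>\<xi>\<in>?X. \<Sum>k\<in>{k\<in>K\<^sub>1. \<xi> - k \<in> K\<^sub>2}. f k (\<xi> - k))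
      = (\<Sum>(\<xi>, k)\<in>Sigma ?X (\<lambda>\<xi>. {k\<in>K\<^sub>1. \<xi> - k \<in> K\<^sub>2}). f k (\<xi> - k))"
    by (rule sum.Sigma) (use assms in auto)
  also have "\<dots> = (\<Sum>(k, m)\<in>K\<^sub>1 \<times> K\<^sub>2. f k m)"
    by (rule sum.reindex_bij_witness[of _ "\<lambda>(k, m). (k + m, k)" "\<lambda>(\<xi>, k). (k, \<xi> - k)"])
       (force simp: image_iff)+
  also have "\<dots> = (\<Sum>k\<in>K\<^sub>1. \<Sum>m\<in>K\<^sub>2. f k m)"
    by (rule sum.Sigma[symmetric]) (use assms in auto)
  finally show ?thesis .
qed

text \<open>For each output frequency the sieve is applied to products of one coefficient from each
  family, whose derivatives come from the product rule. Summing over outputs separates the families: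
  the y-sums are replaced by their bounds Y and Y', uniform in time, and the x-sums stay under the
  integral.\<close>

lemma bilinear_estimate_phases:
  fixes K\<^sub>1 K\<^sub>2 :: "int set" and w :: "int \<Rightarrow> real" and a :: "int \<Rightarrow> int \<Rightarrow> complex"
    and x x' y y' :: "int \<Rightarrow> real \<Rightarrow> complex"
  assumes fin: "finite K\<^sub>1" "finite K\<^sub>2" and a: "\<And>k m. norm (a k m) \<le> A"
    and g: "0 < g" and n: "0 < n" and T: "0 < T" "T / real n \<le> 1 / g"
    and sep: "\<And>\<xi> k l. k \<in> K\<^sub>1 \<Longrightarrow> l \<in> K\<^sub>1 \<Longrightarrow> \<xi> - k \<in> K\<^sub>2 \<Longrightarrow> \<xi> - l \<in> K\<^sub>2 \<Longrightarrow>
        g * \<bar>real_of_int (k - l)\<bar> \<le> \<bar>(w k + w (\<xi> - k)) - (w l + w (\<xi> - l))\<bar>"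
    and x: "\<And>k. k \<in> K\<^sub>1 \<Longrightarrow> bounded_primitive 0 T (x k) (x' k)"
    and y: "\<And>m. m \<in> K\<^sub>2 \<Longrightarrow> bounded_primitive 0 T (y m) (y' m)"
    and Y: "\<And>t. t \<in> {0..T} \<Longrightarrow> (\<Sum>m\<in>K\<^sub>2. (norm (y m t))\<^sup>2) \<le> Y"
    and Y': "\<And>t. t \<in> {0..T} \<Longrightarrow> (\<Sum>m\<in>K\<^sub>2. (norm (y' m t))\<^sup>2) \<le> Y'"
  shows "integral {0..T} (\<lambda>t. \<Sum>\<xi>\<in>(\<lambda>(k, m). k + m) ` (K\<^sub>1 \<times> K\<^sub>2).
      (norm (\<Sum>k\<in>{k\<in>K\<^sub>1. \<xi> - k \<in> K\<^sub>2}. a k (\<xi> - k) * (x k t * y (\<xi> - k) t) * cis ((w k + w (\<xi> - k)) * t)))\<^sup>2)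
    \<le> 108 * A\<^sup>2 / g * integral {0..T} (\<lambda>t.
        (real n / T * Y + 2 * T / real n * Y') * (\<Sum>k\<in>K\<^sub>1. (norm (x k t))\<^sup>2)
        + 2 * T / real n * Y * (\<Sum>k\<in>K\<^sub>1. (norm (x' k t))\<^sup>2))"
proof -
  define X where "X = (\<lambda>(k, m). k + m) ` (K\<^sub>1 \<times> K\<^sub>2)"
  define J where "J = (\<lambda>\<xi>. {k\<in>K\<^sub>1. \<xi> - k \<in> K\<^sub>2})"
  define c where "c = (\<lambda>\<xi> k t. a k (\<xi> - k) * (x k t * y (\<xi> - k) t))"
  define c' where "c' = (\<lambda>\<xi> k t. a k (\<xi> - k) * (x' k t * y (\<xi> - k) t + x k t * y' (\<xi> - k) t))"
  have finX: "finite X" and finJ: "finite (J \<xi>)" for \<xi> using fin by (auto simp: X_def J_def)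
  have c: "bounded_primitive 0 T (c \<xi> k) (c' \<xi> k)" if "k \<in> J \<xi>" for \<xi> k
    unfolding c_def c'_def using that
    by (intro bounded_primitive_cmult bounded_primitive_mult x y) (auto simp: J_def)
  have contc: "continuous_on {0..T} (c \<xi> k)" if "k \<in> J \<xi>" for \<xi> k
    by (rule bounded_primitive_continuous[OF c[OF that]])
  define R where "R = (\<lambda>\<xi> s. \<Sum>k\<in>J \<xi>. real n / T * (norm (c \<xi> k s))\<^sup>2 + T / real n * (norm (c' \<xi> k s))\<^sup>2)"
  have iR: "R \<xi> integrable_on {0..T}" for \<xi>
    unfolding R_def
    by (intro integrable_sum integrable_add integrable_on_mult_right finJ
        bounded_primitive_norm_sq_integrable[OF c] integrable_continuous_real continuous_intros contc)
  define S where "S = (\<lambda>\<xi> t. (norm (\<Sum>k\<in>J \<xi>. c \<xi> k t * cis ((w k + w (\<xi> - k)) * t)))\<^sup>2)"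
  have iS: "S \<xi> integrable_on {0..T}" for \<xi>
    unfolding S_def using contc by (intro integrable_continuous_real continuous_intros) auto
  have SR: "integral {0..T} (S \<xi>) \<le> 108 / g * integral {0..T} (R \<xi>)" for \<xi>
    unfolding S_def R_def
    by (rule large_sieve_global[OF finJ g n]) (use sep T c in \<open>auto simp: J_def\<close>)
  define Q where "Q = (\<lambda>t. (real n / T * Y + 2 * T / real n * Y') * (\<Sum>k\<in>K\<^sub>1. (norm (x k t))\<^sup>2)
        + 2 * T / real n * Y * (\<Sum>k\<in>K\<^sub>1. (norm (x' k t))\<^sup>2))"
  have iQ: "Q integrable_on {0..T}"
    unfolding Q_def
    by (intro integrable_add integrable_on_mult_right integrable_sum fin
        bounded_primitive_norm_sq_integrable[OF x] integrable_continuous_real continuous_intros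
        bounded_primitive_continuous[OF x])
  have A0: "norm (a k m) ^ 2 \<le> A\<^sup>2" for k m using a by (intro power_mono) auto
  have RQ: "(\<Sum>\<xi>\<in>X. R \<xi> t) \<le> A\<^sup>2 * Q t" if t: "t \<in> {0..T}" for t
  proof -
    define F where "F = (\<lambda>k m. A\<^sup>2 * (real n / T * ((norm (x k t))\<^sup>2 * (norm (y m t))\<^sup>2)
      + 2 * T / real n * ((norm (x' k t))\<^sup>2 * (norm (y m t))\<^sup>2 + (norm (x k t))\<^sup>2 * (norm (y' m t))\<^sup>2)))"
    have le: "real n / T * (norm (c \<xi> k t))\<^sup>2 + T / real n * (norm (c' \<xi> k t))\<^sup>2 \<le> F k (\<xi> - k)" for \<xi> k
    proof -
      let ?m = "\<xi> - k"
      have 1: "(norm (c \<xi> k t))\<^sup>2 \<le> A\<^sup>2 * ((norm (x k t))\<^sup>2 * (norm (y ?m t))\<^sup>2)"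
        unfolding c_def norm_mult power_mult_distrib by (intro mult_right_mono A0) auto
      \<comment> \<open>Squaring the two terms of the product rule is the origin of the 2 in
        \<open>2 * T / real n\<close>.\<close>
      have 2: "(norm (x' k t * y ?m t + x k t * y' ?m t))\<^sup>2
          \<le> 2 * ((norm (x' k t))\<^sup>2 * (norm (y ?m t))\<^sup>2 + (norm (x k t))\<^sup>2 * (norm (y' ?m t))\<^sup>2)"
      proof -
        let ?p = "norm (x' k t) * norm (y ?m t)" and ?q = "norm (x k t) * norm (y' ?m t)"
        have "norm (x' k t * y ?m t + x k t * y' ?m t) \<le> ?p + ?q"
          using norm_triangle_ineq[of "x' k t * y ?m t" "x k t * y' ?m t"] by (simp add: norm_mult)
        then have "(norm (x' k t * y ?m t + x k t * y' ?m t))\<^sup>2 \<le> (?p + ?q)\<^sup>2" by (intro power_mono) auto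
        also have "\<dots> \<le> 2 * (?p\<^sup>2 + ?q\<^sup>2)" using sum_squares_bound[of ?p ?q] by (simp add: power2_sum)
        finally show ?thesis by (simp add: power_mult_distrib)
      qed
      have 3: "(norm (c' \<xi> k t))\<^sup>2 \<le> A\<^sup>2 * (2 * ((norm (x' k t))\<^sup>2 * (norm (y ?m t))\<^sup>2 + (norm (x k t))\<^sup>2 * (norm (y' ?m t))\<^sup>2))"
        unfolding c'_def norm_mult[of "a k ?m"] power_mult_distrib[of "norm (a k ?m)"] by (intro mult_mono A0 2) auto
      have "real n / T * (norm (c \<xi> k t))\<^sup>2 + T / real n * (norm (c' \<xi> k t))\<^sup>2
        \<le> real n / T * (A\<^sup>2 * ((norm (x k t))\<^sup>2 * (norm (y ?m t))\<^sup>2))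
         + T / real n * (A\<^sup>2 * (2 * ((norm (x' k t))\<^sup>2 * (norm (y ?m t))\<^sup>2 + (norm (x k t))\<^sup>2 * (norm (y' ?m t))\<^sup>2)))"
        using T by (intro add_mono mult_left_mono 1 3) auto
      also have "\<dots> = F k ?m" by (simp add: F_def algebra_simps)
      finally show ?thesis .
    qed
    have "(\<Sum>\<xi>\<in>X. R \<xi> t) \<le> (\<Sum>\<xi>\<in>X. \<Sum>k\<in>J \<xi>. F k (\<xi> - k))"
      unfolding R_def by (intro sum_mono le)
    also have "\<dots> = (\<Sum>k\<in>K\<^sub>1. \<Sum>m\<in>K\<^sub>2. F k m)"
      unfolding X_def J_def by (rule sum_over_outputs[OF fin])
    also have "\<dots> \<le> (\<Sum>k\<in>K\<^sub>1. A\<^sup>2 * (real n / T * ((norm (x k t))\<^sup>2 * Y)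
      + 2 * T / real n * ((norm (x' k t))\<^sup>2 * Y + (norm (x k t))\<^sup>2 * Y')))"
    proof (intro sum_mono)
      fix k
      have "(\<Sum>m\<in>K\<^sub>2. F k m) = A\<^sup>2 * (real n / T * ((norm (x k t))\<^sup>2 * (\<Sum>m\<in>K\<^sub>2. (norm (y m t))\<^sup>2))
        + 2 * T / real n * ((norm (x' k t))\<^sup>2 * (\<Sum>m\<in>K\<^sub>2. (norm (y m t))\<^sup>2) + (norm (x k t))\<^sup>2 * (\<Sum>m\<in>K\<^sub>2. (norm (y' m t))\<^sup>2)))"
      proof -
        have "(\<Sum>m\<in>K\<^sub>2. e * (p * (u * f m) + q * (v * f m + u * h m)))
            = e * (p * (u * sum f K\<^sub>2) + q * (v * sum f K\<^sub>2 + u * sum h K\<^sub>2))" for e p q u v :: real and f h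
          by (simp only: sum_distrib_left[symmetric] sum.distrib)
        then show ?thesis unfolding F_def .
      qed
      also have "\<dots> \<le> A\<^sup>2 * (real n / T * ((norm (x k t))\<^sup>2 * Y)
        + 2 * T / real n * ((norm (x' k t))\<^sup>2 * Y + (norm (x k t))\<^sup>2 * Y'))"
        using T Y[OF t] Y'[OF t] by (intro mult_left_mono add_mono) auto
      finally show "(\<Sum>m\<in>K\<^sub>2. F k m) \<le> \<dots>" .
    qed
    also have "\<dots> = A\<^sup>2 * Q t"
      by (simp add: Q_def sum.distrib sum_distrib_left algebra_simps)
    finally show ?thesis .
  qed
  have "integral {0..T} (\<lambda>t. \<Sum>\<xi>\<in>X. S \<xi> t) = (\<Sum>\<xi>\<in>X. integral {0..T} (S \<xi>))"
    by (rule integral_sum[OF finX]) (rule iS)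
  also have "\<dots> \<le> (\<Sum>\<xi>\<in>X. 108 / g * integral {0..T} (R \<xi>))"
    by (intro sum_mono SR)
  also have "\<dots> = 108 / g * integral {0..T} (\<lambda>t. \<Sum>\<xi>\<in>X. R \<xi> t)"
    by (subst integral_sum[OF finX iR]) (simp add: sum_distrib_left)
  also have "\<dots> \<le> 108 / g * integral {0..T} (\<lambda>t. A\<^sup>2 * Q t)"
    using g by (intro mult_left_mono integral_le integrable_sum finX iR integrable_on_mult_right iQ RQ) auto
  finally show ?thesis by (simp add: S_def X_def J_def c_def Q_def)
qed

section \<open>Separation of the phases\<close>

lemma dispersion_hyp_derivative:
  assumes "dispersion_hyp \<alpha> p"
  shows "(p has_real_derivative deriv p x) (at x)" "continuous_on UNIV (deriv p)" "p (- x) = - p x"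
proof -
  have "p C1_differentiable_on UNIV" using assms by (simp add: dispersion_hyp_def)
  then have d: "\<And>x. p differentiable (at x)" and c: "continuous_on UNIV (\<lambda>x. vector_derivative p (at x))"
    by (auto simp: C1_differentiable_on_eq)
  show D: "(p has_real_derivative deriv p x) (at x)" for x
    using d[of x] by (simp add: DERIV_deriv_iff_real_differentiable)
  have "vector_derivative p (at x) = deriv p x" for x
    using D[of x] by (simp add: has_real_derivative_iff_has_vector_derivative vector_derivative_at)
  then show "continuous_on UNIV (deriv p)" using c by simp
  show "p (- x) = - p x" using assms by (simp add: dispersion_hyp_def)
qed

lemma dispersion_derivative_even:
  assumes "dispersion_hyp \<alpha> p"
  shows "deriv p (- x) = deriv p x"
proof -
  have "((\<lambda>x. - p (- x)) has_real_derivative deriv p (- x)) (at x)"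
    by (auto intro!: derivative_eq_intros DERIV_chain2[OF dispersion_hyp_derivative(1)[OF assms]])
  then have "(p has_real_derivative deriv p (- x)) (at x)"
    by (simp add: dispersion_hyp_derivative(3)[OF assms])
  then show ?thesis using DERIV_unique dispersion_hyp_derivative(1)[OF assms] by blast
qed

text \<open>The growth hypothesis concerns large positive frequencies only. Evenness of the
  derivative covers the negative ones, and on the compact middle part continuity gives a bound B
  \<le> B * M^\<alpha> for M \<ge> 1; hence a single constant D works on all of [-M, M].\<close>

lemma dispersion_bounds:
  assumes hyp: "dispersion_hyp \<alpha> p" and al: "1 \<le> \<alpha>"
  obtains \<xi>\<^sub>0 c D where "0 < \<xi>\<^sub>0" "0 < c" "0 \<le> D"
    "\<And>x. \<xi>\<^sub>0 \<le> x \<Longrightarrow> c * x powr \<alpha> \<le> deriv p x"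
    "\<And>x M. \<bar>x\<bar> \<le> M \<Longrightarrow> 1 \<le> M \<Longrightarrow> \<bar>deriv p x\<bar> \<le> D * M powr \<alpha>"
proof -
  obtain \<xi>\<^sub>0 c C where b: "0 < \<xi>\<^sub>0" "0 < c" "0 < C" "\<And>x. \<xi>\<^sub>0 \<le> x \<Longrightarrow> c * x powr \<alpha> \<le> deriv p x"
    "\<And>x. \<xi>\<^sub>0 \<le> x \<Longrightarrow> deriv p x \<le> C * x powr \<alpha>"
    using hyp unfolding dispersion_hyp_def by blast
  have "continuous_on {-\<xi>\<^sub>0..\<xi>\<^sub>0} (deriv p)"
    using dispersion_hyp_derivative(2)[OF hyp] continuous_on_subset by blast
  then have "bounded (deriv p ` {-\<xi>\<^sub>0..\<xi>\<^sub>0})"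
    by (intro compact_imp_bounded compact_continuous_image compact_Icc)
  then obtain B where B: "\<And>x. x \<in> {-\<xi>\<^sub>0..\<xi>\<^sub>0} \<Longrightarrow> \<bar>deriv p x\<bar> \<le> B"
    unfolding bounded_iff real_norm_def by blast
  have B0: "0 \<le> B" using B[of 0] b(1) by (smt (verit) atLeastAtMost_iff)
  have "\<bar>deriv p x\<bar> \<le> (B + C) * M powr \<alpha>" if xM: "\<bar>x\<bar> \<le> M" "1 \<le> M" for x M
  proof (cases "\<bar>x\<bar> \<le> \<xi>\<^sub>0")
    case True
    then have "\<bar>deriv p x\<bar> \<le> B" using B[of x] by (simp add: abs_le_iff)
    also have "\<dots> \<le> B * M powr \<alpha>"
      using mult_left_mono[OF ge_one_powr_ge_zero[OF xM(2), of \<alpha>] B0] al by simp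
    also have "\<dots> \<le> (B + C) * M powr \<alpha>" using b(3) by (intro mult_right_mono) auto
    finally show ?thesis .
  next
    case False
    have "deriv p x = deriv p \<bar>x\<bar>" using dispersion_derivative_even[OF hyp, of x] by (cases "x \<ge> 0") auto
    moreover have "0 \<le> c * \<bar>x\<bar> powr \<alpha>" using b by simp
    ultimately have "\<bar>deriv p x\<bar> \<le> C * \<bar>x\<bar> powr \<alpha>"
      using b(4)[of "\<bar>x\<bar>"] b(5)[of "\<bar>x\<bar>"] False by linarith
    also have "\<dots> \<le> C * M powr \<alpha>"
      using xM b al by (intro mult_left_mono powr_mono2) auto
    also have "\<dots> \<le> (B + C) * M powr \<alpha>" using B0 by (intro mult_right_mono) auto
    finally show ?thesis .
  qed
  then show ?thesis using that[of \<xi>\<^sub>0 c "B + C"] b B0 by auto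
qed

text \<open>From k + k' = l + l' the high and the low increments have the same length |k - l|. By
  the mean value theorem p changes by at least c (N / 2)^\<alpha> |k - l| on the high pair and at
  most D (2 M)^\<alpha> |k - l| on the low pair. For N / M large the second is at most half of the
  first, and \<alpha> \<ge> 1 with N / 2 \<ge> 1 reduces the power of N to one.\<close>

lemma phase_separation_aux:
  assumes hyp: "dispersion_hyp \<alpha> p" and al: "1 \<le> \<alpha>"
  obtains C\<^sub>0 c where "0 < C\<^sub>0" "0 < c"
    "\<And>N M k l k' l'. 1 \<le> M \<Longrightarrow> C\<^sub>0 * M \<le> N \<Longrightarrow> N / 2 \<le> \<bar>k\<bar> \<Longrightarrow> N / 2 \<le> \<bar>l\<bar> \<Longrightarrow>
      \<bar>k'\<bar> \<le> 2 * M \<Longrightarrow> \<bar>l'\<bar> \<le> 2 * M \<Longrightarrow> k + k' = l + l' \<Longrightarrow> c * N * \<bar>k - l\<bar> \<le> \<bar>(p k + p k') - (p l + p l')\<bar>"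
proof -
  obtain \<xi>\<^sub>0 c D where b: "0 < \<xi>\<^sub>0" "0 < c" "0 \<le> D"
    and lo: "\<And>x. \<xi>\<^sub>0 \<le> x \<Longrightarrow> c * x powr \<alpha> \<le> deriv p x"
    and up: "\<And>x M. \<bar>x\<bar> \<le> M \<Longrightarrow> 1 \<le> M \<Longrightarrow> \<bar>deriv p x\<bar> \<le> D * M powr \<alpha>"
    using dispersion_bounds[OF hyp al] by metis
  note der = dispersion_hyp_derivative(1)[OF hyp] and odd = dispersion_hyp_derivative(3)[OF hyp]
  \<comment> \<open>The 8 keeps k and l on the same side of the origin,
    \<open>2 * \<xi>\<^sub>0\<close> puts N / 2 in the range of the growth hypothesis, and the first
    summand makes (N / (4 M))^\<alpha> at least 2 D / c, so that the low increment costs at most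
    half of the high one.\<close>
  define C\<^sub>0 where "C\<^sub>0 = 4 * (1 + 2 * D / c) + 2 * \<xi>\<^sub>0 + 8"
  have C0: "8 \<le> C\<^sub>0" "2 * \<xi>\<^sub>0 \<le> C\<^sub>0" "4 * (1 + 2 * D / c) \<le> C\<^sub>0" using b by (auto simp: C\<^sub>0_def)
  have main: "c / 4 * N * \<bar>k - l\<bar> \<le> \<bar>(p k + p k') - (p l + p l')\<bar>"
    if M: "1 \<le> M" "C\<^sub>0 * M \<le> N" and k: "N / 2 \<le> \<bar>k\<bar>" and l: "N / 2 \<le> \<bar>l\<bar>"
      and k': "\<bar>k'\<bar> \<le> 2 * M" and l': "\<bar>l'\<bar> \<le> 2 * M" and eq: "k + k' = l + l'" for N M k l k' l'
  proof -
    have "C\<^sub>0 * 1 \<le> C\<^sub>0 * M" using M C0 by (intro mult_left_mono) auto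
    then have N: "8 \<le> N" "2 * \<xi>\<^sub>0 \<le> N" using M(2) C0(1,2) by linarith+
    have "8 * M \<le> C\<^sub>0 * M" using M C0 by (intro mult_right_mono) auto
    then have NM: "8 * M \<le> N" using M(2) by linarith
    have pos: "c * (N / 2) powr \<alpha> * (y - x) \<le> p y - p x" if xy: "N / 2 \<le> x" "x \<le> y" for x y
    proof (cases "x = y")
      case False
      then have "x < y" using xy by simp
      then obtain z where z: "x < z" "z < y" "p y - p x = (y - x) * deriv p z"
        using MVT2[of x y p "deriv p"] der by blast
      have "c * (N / 2) powr \<alpha> \<le> c * z powr \<alpha>"
        using b z xy N al by (intro mult_left_mono powr_mono2) auto
      also have "\<dots> \<le> deriv p z" using lo[of z] N z xy by auto
      finally show ?thesis using z xy by (simp add: mult.commute mult_left_mono)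
    qed simp
    have same: "c * (N / 2) powr \<alpha> * \<bar>k - l\<bar> \<le> \<bar>p k - p l\<bar>"
    proof -
      \<comment> \<open>Here |k - l| = |k' - l'| \<le> 4 M < N, whereas high frequencies of opposite
        sign are at least N apart. So k and l lie on one branch, where p is monotone.\<close>
      have "\<bar>k - l\<bar> < N" using eq k' l' NM N M by linarith
      then have "(0 \<le> k \<and> 0 \<le> l) \<or> (k \<le> 0 \<and> l \<le> 0)" using k l by linarith
      then show ?thesis
      proof
        assume "0 \<le> k \<and> 0 \<le> l"
        then show ?thesis using pos[of k l] pos[of l k] k l by (cases "k \<le> l") auto
      next
        assume "k \<le> 0 \<and> l \<le> 0"
        then show ?thesis using pos[of "- k" "- l"] pos[of "- l" "- k"] k l odd by (cases "k \<le> l") auto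
      qed
    qed
    have low: "\<bar>p k' - p l'\<bar> \<le> D * (2 * M) powr \<alpha> * \<bar>k' - l'\<bar>"
    proof -
      have u: "\<bar>p y - p x\<bar> \<le> D * (2 * M) powr \<alpha> * (y - x)" if xy: "- 2 * M \<le> x" "x \<le> y" "y \<le> 2 * M" for x y
      proof (cases "x = y")
        case False
        then have "x < y" using xy by simp
        then obtain z where z: "x < z" "z < y" "p y - p x = (y - x) * deriv p z"
          using MVT2[of x y p "deriv p"] der by blast
        have "\<bar>deriv p z\<bar> \<le> D * (2 * M) powr \<alpha>" using z xy M by (intro up) auto
        then have "(y - x) * \<bar>deriv p z\<bar> \<le> (y - x) * (D * (2 * M) powr \<alpha>)" using xy by (intro mult_left_mono) auto
        then show ?thesis unfolding z(3) abs_mult using xy by (simp add: mult_ac)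
      qed simp
      show ?thesis using u[of k' l'] u[of l' k'] k' l' by (cases "k' \<le> l'") (auto simp: abs_minus_commute)
    qed
    have "1 + 2 * D / c \<le> N / (4 * M)"
    proof -
      have "4 * (1 + 2 * D / c) * M \<le> C\<^sub>0 * M" using M(1) by (intro mult_right_mono C0(3)) simp
      then have "4 * (1 + 2 * D / c) * M \<le> N" using M(2) by linarith
      then show ?thesis using M by (simp add: pos_le_divide_eq mult_ac)
    qed
    moreover have "0 \<le> 2 * D / c" using b by simp
    ultimately have "2 * D / c \<le> (N / (4 * M)) powr 1" "1 \<le> N / (4 * M)" using N M NM by auto
    then have "2 * D / c \<le> (N / (4 * M)) powr \<alpha>"
      using powr_mono[OF al, of "N / (4 * M)"] by linarith
    also have "\<dots> = ((N / 2) / (2 * M)) powr \<alpha>" by simp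
    also have "\<dots> = (N / 2) powr \<alpha> / (2 * M) powr \<alpha>" using N M by (intro powr_divide)
    finally have "2 * D * (2 * M) powr \<alpha> \<le> c * (N / 2) powr \<alpha>"
      using M b by (simp add: field_simps)
    then have "D * (2 * M) powr \<alpha> \<le> c / 2 * (N / 2) powr \<alpha>" by simp
    moreover have "\<bar>k' - l'\<bar> = \<bar>k - l\<bar>" using eq by linarith
    ultimately have "D * (2 * M) powr \<alpha> * \<bar>k' - l'\<bar> \<le> c / 2 * (N / 2) powr \<alpha> * \<bar>k - l\<bar>"
      by (simp only:) (intro mult_right_mono, auto)
    moreover have "c * (N / 2) powr \<alpha> * \<bar>k - l\<bar> = 2 * (c / 2 * (N / 2) powr \<alpha> * \<bar>k - l\<bar>)" by simp
    ultimately have "c / 2 * (N / 2) powr \<alpha> * \<bar>k - l\<bar> \<le> \<bar>(p k + p k') - (p l + p l')\<bar>"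
      using same low by linarith
    moreover have "c / 4 * N * \<bar>k - l\<bar> \<le> c / 2 * (N / 2) powr \<alpha> * \<bar>k - l\<bar>"
    proof (intro mult_right_mono)
      have "(N / 2) powr 1 \<le> (N / 2) powr \<alpha>" using N al by (intro powr_mono) auto
      then have "c / 2 * (N / 2) \<le> c / 2 * (N / 2) powr \<alpha>" using b N by (intro mult_left_mono) auto
      then show "c / 4 * N \<le> c / 2 * (N / 2) powr \<alpha>" by simp
    qed auto
    ultimately show ?thesis by linarith
  qed
  show ?thesis by (rule that[of C\<^sub>0 "c / 4"]) (use C0 b main in auto)
qed

text \<open>Contains every integer frequency at which \<open>freq_block chi N\<close> can be
  nonzero. It is described by N alone, so the phase separation does not have to mention the
  cutoff.\<close>

definition dyadic_shell :: "real \<Rightarrow> int set" where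
  "dyadic_shell N = {k. N / 2 \<le> \<bar>real_of_int k\<bar> \<and> \<bar>real_of_int k\<bar> \<le> 2 * N}"

text \<open>The high frequency may sit in either factor. Both cases reduce to the same estimate by
  exchanging k with \<xi> - k and l with \<xi> - l, because the two differences agree in absolute
  value.\<close>

lemma phase_separation:
  assumes hyp: "dispersion_hyp \<alpha> p" and al: "1 \<le> \<alpha>"
  obtains C\<^sub>0 c where "0 < C\<^sub>0" "0 < c"
    "\<And>N\<^sub>1 N\<^sub>2 \<xi> k l. 1 \<le> N\<^sub>1 \<Longrightarrow> 1 \<le> N\<^sub>2 \<Longrightarrow> C\<^sub>0 * min N\<^sub>1 N\<^sub>2 \<le> max N\<^sub>1 N\<^sub>2 \<Longrightarrow>
      k \<in> dyadic_shell N\<^sub>1 \<Longrightarrow> l \<in> dyadic_shell N\<^sub>1 \<Longrightarrow>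
      \<xi> - k \<in> dyadic_shell N\<^sub>2 \<Longrightarrow> \<xi> - l \<in> dyadic_shell N\<^sub>2 \<Longrightarrow>
      c * max N\<^sub>1 N\<^sub>2 * \<bar>real_of_int (k - l)\<bar>
        \<le> \<bar>(p (of_int k) + p (of_int (\<xi> - k))) - (p (of_int l) + p (of_int (\<xi> - l)))\<bar>"
proof -
  obtain C\<^sub>0 c where C: "0 < C\<^sub>0" "0 < c" and main:
    "\<And>N M k l k' l'. 1 \<le> M \<Longrightarrow> C\<^sub>0 * M \<le> N \<Longrightarrow> N / 2 \<le> \<bar>k\<bar> \<Longrightarrow> N / 2 \<le> \<bar>l\<bar> \<Longrightarrow>
      \<bar>k'\<bar> \<le> 2 * M \<Longrightarrow> \<bar>l'\<bar> \<le> 2 * M \<Longrightarrow> k + k' = l + l' \<Longrightarrow> c * N * \<bar>k - l\<bar> \<le> \<bar>(p k + p k') - (p l + p l')\<bar>"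
    using phase_separation_aux[OF hyp al] by metis
  show ?thesis
  proof (rule that[OF C])
    fix N\<^sub>1 N\<^sub>2 :: real and \<xi> k l :: int
    assume N: "1 \<le> N\<^sub>1" "1 \<le> N\<^sub>2" "C\<^sub>0 * min N\<^sub>1 N\<^sub>2 \<le> max N\<^sub>1 N\<^sub>2"
      and kl: "k \<in> dyadic_shell N\<^sub>1" "l \<in> dyadic_shell N\<^sub>1" "\<xi> - k \<in> dyadic_shell N\<^sub>2" "\<xi> - l \<in> dyadic_shell N\<^sub>2"
    show "c * max N\<^sub>1 N\<^sub>2 * \<bar>real_of_int (k - l)\<bar>
        \<le> \<bar>(p (of_int k) + p (of_int (\<xi> - k))) - (p (of_int l) + p (of_int (\<xi> - l)))\<bar>"
    proof (cases "N\<^sub>2 \<le> N\<^sub>1")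
      case True
      then show ?thesis
        using main[of N\<^sub>2 N\<^sub>1 "real_of_int k" "real_of_int l" "real_of_int (\<xi> - k)" "real_of_int (\<xi> - l)"] N kl
        by (simp add: dyadic_shell_def)
    next
      case False
      then show ?thesis
        using main[of N\<^sub>1 N\<^sub>2 "real_of_int (\<xi> - k)" "real_of_int (\<xi> - l)" "real_of_int k" "real_of_int l"] N kl
        by (simp add: dyadic_shell_def abs_minus_commute add.commute)
    qed
  qed
qed

section \<open>Fourier coefficients on the torus\<close>

lemma finite_measure_torus: "finite_measure torus"
  by (rule finite_measure_lebesgue_on) auto

lemma measure_torus: "measure torus (space torus) = 2 * pi"
  by (simp add: measure_restrict_space)

lemma L2_torus_integrable_norm:
  assumes "g \<in> L2_torus"
  shows "integrable torus (\<lambda>x. norm (g x))"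
proof -
  have m: "g \<in> borel_measurable torus" and i: "integrable torus (\<lambda>x. (cmod (g x))\<^sup>2)"
    using assms by (auto simp: L2_torus_def)
  have "integrable torus (\<lambda>x. 1 + (cmod (g x))\<^sup>2)"
    by (rule Bochner_Integration.integrable_add[OF finite_measure.integrable_const[OF finite_measure_torus] i])
  then show ?thesis
  proof (rule Bochner_Integration.integrable_bound)
    show "AE x in torus. norm (norm (g x)) \<le> norm (1 + (cmod (g x))\<^sup>2)"
    proof (rule AE_I2)
      fix x
      have "0 \<le> (norm (g x) - 1)\<^sup>2" by simp
      then have "norm (g x) \<le> 1 + (norm (g x))\<^sup>2"
        by (simp add: power2_diff) (smt (verit) norm_ge_zero)
      then show "norm (norm (g x)) \<le> norm (1 + (cmod (g x))\<^sup>2)" by simp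
    qed
  qed (use m in measurable)
qed

lemma measurable_torus_cis: "(\<lambda>x. cis (v * x)) \<in> borel_measurable torus"
  by (intro continuous_imp_measurable_on_sets_lebesgue continuous_intros) auto

lemma L2_torus_integrable_cis:
  assumes "g \<in> L2_torus"
  shows "integrable torus (\<lambda>x. g x * cis (v * x))"
proof (rule Bochner_Integration.integrable_bound[OF L2_torus_integrable_norm[OF assms]])
  show "(\<lambda>x. g x * cis (v * x)) \<in> borel_measurable torus"
    using assms measurable_torus_cis[of v] by (auto simp: L2_torus_def)
qed (simp add: norm_mult)

text \<open>Cauchy-Schwarz on a space of measure 2 pi, read off from the nonnegative integral of
  (|g| - m)^2 with m the mean of |g|.\<close>

lemma integral_norm_le_L2_norm:
  assumes "g \<in> L2_torus"
  shows "(LINT x|torus. norm (g x)) \<le> sqrt (2 * pi) * L2_norm g"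
proof -
  define I where "I = (LINT x|torus. norm (g x))"
  define m where "m = I / (2 * pi)"
  note i1 = L2_torus_integrable_norm[OF assms]
  have i2: "integrable torus (\<lambda>x. (cmod (g x))\<^sup>2)" using assms by (auto simp: L2_torus_def)
  have I0: "0 \<le> I" unfolding I_def by simp
  have ic: "integrable torus (\<lambda>x. m\<^sup>2)"
    by (rule finite_measure.integrable_const[OF finite_measure_torus])
  have "0 \<le> (LINT x|torus. (norm (g x) - m)\<^sup>2)" by simp
  also have "\<dots> = (LINT x|torus. (norm (g x))\<^sup>2 - 2 * m * norm (g x) + m\<^sup>2)"
    by (simp add: power2_diff algebra_simps)
  also have "\<dots> = (LINT x|torus. (norm (g x))\<^sup>2) - 2 * m * I + m\<^sup>2 * (2 * pi)"
    unfolding I_def using i1 i2 ic measure_torus by simp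
  finally have "I\<^sup>2 \<le> (2 * pi) * (LINT x|torus. (norm (g x))\<^sup>2)"
    unfolding m_def by (simp add: field_simps power2_eq_square)
  then have "sqrt (I\<^sup>2) \<le> sqrt ((2 * pi) * (LINT x|torus. (norm (g x))\<^sup>2))" by (rule real_sqrt_le_mono)
  then show ?thesis using I0 by (simp add: I_def L2_norm_def real_sqrt_mult)
qed

text \<open>Serves to transfer continuity, limits and boundedness from L^2 to single coefficients.
  For that purpose the constant 1 suffices in place of 1 / sqrt (2 pi).\<close>

lemma norm_fourier_le:
  assumes "g \<in> L2_torus"
  shows "norm (fourier g k) \<le> L2_norm g"
proof -
  have "norm (LINT x|torus. g x * cis (- (of_int k * x))) \<le> (LINT x|torus. norm (g x * cis (- (of_int k * x))))"
    by (rule integral_norm_bound)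
  also have "\<dots> \<le> sqrt (2 * pi) * L2_norm g"
    using integral_norm_le_L2_norm[OF assms] by (simp add: norm_mult)
  finally have "norm (fourier g k) \<le> 1 / (2 * pi) * (sqrt (2 * pi) * L2_norm g)"
    unfolding fourier_def norm_mult norm_of_real by (intro mult_mono) auto
  also have "\<dots> \<le> 1 * L2_norm g"
  proof -
    have "sqrt (2 * pi) \<le> 2 * pi" using pi_gt3 by (intro real_le_lsqrt) (auto simp: power2_eq_square)
    then have "1 / (2 * pi) * sqrt (2 * pi) \<le> 1" by simp
    then have "(1 / (2 * pi) * sqrt (2 * pi)) * L2_norm g \<le> 1 * L2_norm g"
      by (rule mult_right_mono) (simp add: L2_norm_def)
    then show ?thesis by (simp only: mult.assoc)
  qed
  finally show ?thesis by simp
qed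

lemma L2_torus_diff:
  assumes "g \<in> L2_torus" "h \<in> L2_torus"
  shows "(\<lambda>x. g x - h x) \<in> L2_torus"
proof -
  have m: "g \<in> borel_measurable torus" "h \<in> borel_measurable torus"
    and i: "integrable torus (\<lambda>x. (cmod (g x))\<^sup>2)" "integrable torus (\<lambda>x. (cmod (h x))\<^sup>2)"
    using assms by (auto simp: L2_torus_def)
  have "integrable torus (\<lambda>x. 2 * (cmod (g x))\<^sup>2 + 2 * (cmod (h x))\<^sup>2)" using i by simp
  then have "integrable torus (\<lambda>x. (cmod (g x - h x))\<^sup>2)"
  proof (rule Bochner_Integration.integrable_bound)
    show "AE x in torus. norm ((cmod (g x - h x))\<^sup>2) \<le> norm (2 * (cmod (g x))\<^sup>2 + 2 * (cmod (h x))\<^sup>2)"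
    proof (rule AE_I2)
      fix x
      have "(cmod (g x - h x))\<^sup>2 \<le> (cmod (g x) + cmod (h x))\<^sup>2"
        by (intro power_mono norm_triangle_ineq4) auto
      also have "\<dots> \<le> 2 * (cmod (g x))\<^sup>2 + 2 * (cmod (h x))\<^sup>2"
        using sum_squares_bound[of "cmod (g x)" "cmod (h x)"] by (simp add: power2_sum)
      finally show "norm ((cmod (g x - h x))\<^sup>2) \<le> norm (2 * (cmod (g x))\<^sup>2 + 2 * (cmod (h x))\<^sup>2)" by simp
    qed
  qed (use m in measurable)
  then show ?thesis using m by (auto simp: L2_torus_def)
qed

lemma fourier_diff:
  assumes "g \<in> L2_torus" "h \<in> L2_torus"
  shows "fourier (\<lambda>x. g x - h x) k = fourier g k - fourier h k"
  using L2_torus_integrable_cis[OF assms(1), of "- of_int k"] L2_torus_integrable_cis[OF assms(2), of "- of_int k"]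
  unfolding fourier_def by (simp add: left_diff_distrib right_diff_distrib)

lemma fourier_series_eq_sum:
  assumes "finite S" "\<And>k. k \<notin> S \<Longrightarrow> c k = 0"
  shows "fourier_series c x = (\<Sum>k\<in>S. c k * cis (of_int k * x))"
proof -
  have "fourier_series c x = (\<Sum>\<^sub>\<infinity>k\<in>S. c k * cis (of_int k * x))"
    unfolding fourier_series_def by (rule infsum_cong_neutral) (use assms in auto)
  then show ?thesis using assms by simp
qed

text \<open>Parseval for trigonometric polynomials. The factor 2 pi reflects the two normalisations:
  \<open>fourier\<close> averages over the period, \<open>L2_norm\<close> does not.\<close>

lemma L2_norm_fourier_series:
  assumes S: "finite S" "\<And>k. k \<notin> S \<Longrightarrow> c k = 0"
  shows "(L2_norm (fourier_series c))\<^sup>2 = 2 * pi * (\<Sum>k\<in>S. (norm (c k))\<^sup>2)"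
proof -
  have expand: "complex_of_real ((norm (fourier_series c x))\<^sup>2)
      = (\<Sum>k\<in>S. \<Sum>l\<in>S. c k * cnj (c l) * cis (of_int (k - l) * x))" for x
  proof -
    have "complex_of_real ((norm (fourier_series c x))\<^sup>2)
        = (\<Sum>k\<in>S. \<Sum>l\<in>S. (c k * cis (of_int k * x)) * cnj (c l * cis (of_int l * x)))"
    proof -
      have e: "fourier_series c x = (\<Sum>k\<in>S. c k * cis (of_int k * x))"
        by (rule fourier_series_eq_sum[OF S])
      show ?thesis
        by (simp only: complex_norm_square e cnj_sum sum_product)
    qed
    also have "\<dots> = (\<Sum>k\<in>S. \<Sum>l\<in>S. c k * cnj (c l) * cis (of_int (k - l) * x))"
    proof (intro sum.cong refl)
      fix k l
      have "cis (of_int k * x) * cis (- (of_int l * x)) = cis (of_int (k - l) * x)"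
        by (simp add: cis_mult algebra_simps)
      then show "(c k * cis (of_int k * x)) * cnj (c l * cis (of_int l * x)) = c k * cnj (c l) * cis (of_int (k - l) * x)"
        by (simp add: cis_cnj mult_ac del: of_int_diff)
    qed
    finally show ?thesis .
  qed
  have int: "integrable torus (\<lambda>x. c k * cnj (c l) * cis (of_int (k - l) * x))" for k l
    by (intro integrable_mult_right continuous_imp_integrable_real continuous_intros)
  have "complex_of_real ((L2_norm (fourier_series c))\<^sup>2) = complex_of_real (LINT x|torus. (norm (fourier_series c x))\<^sup>2)"
    by (simp add: L2_norm_def)
  also have "\<dots> = (LINT x|torus. complex_of_real ((norm (fourier_series c x))\<^sup>2))"
    by (rule integral_complex_of_real[symmetric])
  also have "\<dots> = (\<Sum>k\<in>S. \<Sum>l\<in>S. c k * cnj (c l) * (if k = l then complex_of_real (2 * pi) else 0))"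
    unfolding expand using int
    by (subst Bochner_Integration.integral_sum, simp del: of_int_diff)
       (intro sum.cong refl, subst Bochner_Integration.integral_sum, auto simp: integral_torus_cis simp del: of_int_diff intro!: sum.cong)
  also have "\<dots> = (\<Sum>k\<in>S. c k * cnj (c k) * complex_of_real (2 * pi))"
    using S(1) by (intro sum.cong refl) (simp add: if_distrib sum.delta' cong: if_cong)
  also have "\<dots> = complex_of_real (2 * pi * (\<Sum>k\<in>S. (norm (c k))\<^sup>2))"
    by (simp add: complex_norm_square[symmetric] sum_distrib_left mult.commute del: of_real_power)
  finally show ?thesis by (simp only: of_real_eq_iff)
qed

section \<open>From weak solutions to Fourier coefficients\<close>

text \<open>The cutoff at hand supplies the smooth function: its right half, continued by 1 to the
  left, descends from 1 to 0 between 1 and 2. The family K lists the step and all its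
  derivatives.\<close>

lemma smooth_step_exists:
  assumes "freq_cutoff chi"
  obtains K :: "nat \<Rightarrow> real \<Rightarrow> real" where
    "\<And>j r. (K j has_real_derivative K (Suc j) r) (at r)"
    "\<And>r. r \<le> 1 \<Longrightarrow> K 0 r = 1" "\<And>r. 2 \<le> r \<Longrightarrow> K 0 r = 0" "\<And>r. 0 \<le> K 0 r \<and> K 0 r \<le> 1"
    "\<And>r. r \<notin> {1..2} \<Longrightarrow> K 1 r = 0"
proof -
  have der: "((deriv ^^ n) chi has_real_derivative (deriv ^^ Suc n) chi x) (at x)" for n x
    using assms by (simp add: freq_cutoff_def field_differentiable_derivI)
  have one: "chi x = 1" if "x \<in> {-1..1}" for x using assms that by (auto simp: freq_cutoff_def)
  have supp: "chi x = 0" if "\<not> x \<in> {-2..2}" for x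
    using assms that closure_subset[of "{x. chi x \<noteq> 0}"] by (auto simp: freq_cutoff_def)
  have rng: "0 \<le> chi x \<and> chi x \<le> 1" for x using assms by (simp add: freq_cutoff_def)
  have zero: "(deriv ^^ Suc n) chi x = 0" if "x \<in> {-1<..<1}" for n x
    using that
  proof (induction n arbitrary: x)
    case 0
    have "(chi has_real_derivative 0) (at x)"
      by (rule has_field_derivative_transform_within_open[of "\<lambda>_. 1" _ _ "{-1<..<1}"]) (use 0 one in auto)
    then show ?case by (simp add: DERIV_imp_deriv)
  next
    case (Suc n)
    have "((deriv ^^ Suc n) chi has_real_derivative 0) (at x)"
      by (rule has_field_derivative_transform_within_open[of "\<lambda>_. 0" _ _ "{-1<..<1}"]) (use Suc in auto)
    then show ?case by (simp add: DERIV_imp_deriv)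
  qed
  \<comment> \<open>The two pieces meet at 0, inside the interval where chi is constantly 1, so all
    derivatives match.\<close>
  define K where "K = (\<lambda>j r. if r \<le> 0 then (if j = 0 then 1 else 0) else (deriv ^^ j) chi r)"
  have Kneg: "K j r = (if j = 0 then 1 else 0)" if "r < 1" for j r
    using that one[of r] zero[of r] by (cases j) (auto simp: K_def)
  have KD: "(K j has_real_derivative K (Suc j) r) (at r)" for j r
  proof (cases "r < 1")
    case True
    have "(K j has_real_derivative 0) (at r)"
      by (rule has_field_derivative_transform_within_open[of "\<lambda>_. if j = 0 then 1 else 0" _ _ "{..<1}"])
        (use True Kneg in auto)
    then show ?thesis using Kneg[OF True, of "Suc j"] by simp
  next
    case False
    have "(K j has_real_derivative (deriv ^^ Suc j) chi r) (at r)"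
      by (rule has_field_derivative_transform_within_open[OF der, where S = "{0<..}"])
        (use False in \<open>auto simp: K_def\<close>)
    then show ?thesis using False by (simp add: K_def)
  qed
  have K1: "K 0 r = 1" if "r \<le> 1" for r using that one[of r] by (auto simp: K_def)
  have K2: "K 0 r = 0" if "2 < r" for r using that supp[of r] by (auto simp: K_def)
  \<comment> \<open>The support condition gives zero only beyond 2; the value at 2 itself follows by
    continuity.\<close>
  have K2': "K 0 r = 0" if "2 \<le> r" for r
  proof (cases "r = 2")
    case True
    have "isCont (K 0) 2" using KD by (rule DERIV_isCont)
    then have "(K 0 \<longlongrightarrow> K 0 2) (at_right 2)" by (simp add: continuous_within filterlim_at_split isCont_def)
    moreover have "(K 0 \<longlongrightarrow> 0) (at_right 2)"
      by (rule tendsto_eventually) (auto simp: eventually_at_filter K2)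
    ultimately have "K 0 2 = 0" using tendsto_unique trivial_limit_at_right_real by blast
    then show ?thesis using True by simp
  qed (use that K2 in auto)
  have K3: "K 1 r = 0" if "r \<notin> {1..2}" for r
  proof (cases "r < 1")
    case True
    then show ?thesis using Kneg[of r 1] by simp
  next
    case False
    have "(K 0 has_real_derivative 0) (at r)"
      by (rule has_field_derivative_transform_within_open[of "\<lambda>_. 0" _ _ "{2<..}"])
        (use that False K2 in auto)
    then show ?thesis using KD[of 0 r] DERIV_unique by force
  qed
  show ?thesis
    by (rule that[of K]) (use KD K1 K2' K3 rng in \<open>auto simp: K_def\<close>)
qed

lemma integral_superset_vanish:
  fixes f :: "real \<Rightarrow> 'a::euclidean_space"
  assumes "{c..d} \<subseteq> {a..b}" "\<And>r. r \<in> {a..b} \<Longrightarrow> r \<notin> {c..d} \<Longrightarrow> f r = 0" "f integrable_on {c..d}"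
  shows "integral {a..b} f = integral {c..d} f" "f integrable_on {a..b}"
proof -
  have "((\<lambda>r. if r \<in> {a..b} then f r else 0) has_integral integral {c..d} f) {c..d}"
    by (rule has_integral_eq[OF _ integrable_integral[OF assms(3)]]) (use assms(1) in auto)
  then have "((\<lambda>r. if r \<in> {a..b} then f r else 0) has_integral integral {c..d} f) {a..b}"
    by (rule has_integral_on_superset[OF _ _ assms(1)]) (use assms(2) in auto)
  then have "(f has_integral integral {c..d} f) {a..b}"
    by (rule has_integral_eq[rotated]) auto
  then show "integral {a..b} f = integral {c..d} f" "f integrable_on {a..b}"
    by (auto simp: integral_unique)
qed

text \<open>Testing against a smooth step of width \<open>\<epsilon>\<close> evaluates a continuous function at the jump.\<close>

lemma step_derivative_average:
  fixes v :: "real \<Rightarrow> complex" and K0 K1 :: "real \<Rightarrow> real"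
  assumes K: "\<And>r. (K0 has_real_derivative K1 r) (at r)" "K0 1 = 1" "K0 2 = 0" "\<And>r. r \<notin> {1..2} \<Longrightarrow> K1 r = 0"
    and cK: "continuous_on UNIV K1" and M: "\<And>r. \<bar>K1 r\<bar> \<le> M"
    and v: "continuous_on {0..T} v" and e: "0 < e" and I: "{\<sigma> + e..\<sigma> + 2 * e} \<subseteq> {0..T}"
    and w: "\<And>r. r \<in> {\<sigma> + e..\<sigma> + 2 * e} \<Longrightarrow> norm (v r - L) \<le> w"
  shows "(\<lambda>r. v r * complex_of_real (K1 ((r - \<sigma>) / e) / e)) integrable_on {0..T}"
    "norm (integral {0..T} (\<lambda>r. v r * complex_of_real (K1 ((r - \<sigma>) / e) / e)) + L) \<le> M * w"
proof -
  let ?I = "{\<sigma> + e..\<sigma> + 2 * e}" and ?k = "\<lambda>r. complex_of_real (K1 ((r - \<sigma>) / e) / e)"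
  have ck: "continuous_on ?I ?k"
    using e by (intro continuous_intros continuous_on_compose2[OF cK]) auto
  have cv: "continuous_on ?I v" using v I continuous_on_subset by blast
  have van: "v r * ?k r = 0" if "r \<notin> ?I" for r
  proof -
    have "(r - \<sigma>) / e \<notin> {1..2}" using that e by (auto simp: field_simps)
    then show ?thesis using K(4) by simp
  qed
  have int: "(\<lambda>r. v r * ?k r) integrable_on ?I"
    by (intro integrable_continuous_real continuous_intros cv ck)
  note sup = integral_superset_vanish[OF I _ int]
  show "(\<lambda>r. v r * ?k r) integrable_on {0..T}" by (rule sup(2)) (use van in auto)
  have D: "((\<lambda>r. complex_of_real (K0 ((r - \<sigma>) / e))) has_vector_derivative ?k r) (at r within ?I)" for r
  proof -
    have "((\<lambda>r. K0 ((r - \<sigma>) / e)) has_real_derivative K1 ((r - \<sigma>) / e) * (1 / e)) (at r)"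
      by (rule DERIV_chain2[OF K(1)]) (use e in \<open>auto intro!: derivative_eq_intros\<close>)
    then have "((\<lambda>r. K0 ((r - \<sigma>) / e)) has_real_derivative K1 ((r - \<sigma>) / e) * (1 / e)) (at r within ?I)"
      by (rule has_field_derivative_at_within)
    then show ?thesis using has_vector_derivative_of_real by fastforce
  qed
  have "(?k has_integral (complex_of_real (K0 ((\<sigma> + 2 * e - \<sigma>) / e)) - complex_of_real (K0 ((\<sigma> + e - \<sigma>) / e)))) ?I"
    by (rule fundamental_theorem_of_calculus) (use e D in auto)
  \<comment> \<open>The rescaled derivative has total mass \<open>K0 2 - K0 1\<close>, that is -1.
    This is why L enters the second conclusion with a plus sign.\<close>
  then have k: "(?k has_integral (- 1)) ?I" using e K by simp
  have h: "((\<lambda>r. (v r - L) * ?k r) has_integral (integral ?I (\<lambda>r. v r * ?k r) - L * (- 1))) ?I"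
    unfolding left_diff_distrib by (intro has_integral_diff has_integral_mult_right k integrable_integral int)
  have eq: "integral ?I (\<lambda>r. v r * ?k r) + L = integral ?I (\<lambda>r. (v r - L) * ?k r)"
    using integral_unique[OF h] by (simp only: mult_minus_right mult_1_right diff_minus_eq_add)
  have "norm (integral ?I (\<lambda>r. (v r - L) * ?k r)) \<le> integral ?I (\<lambda>r. w * (M / e))"
  proof (rule integral_norm_bound_integral[OF has_integral_integrable[OF h]])
    fix r assume r: "r \<in> ?I"
    have "0 \<le> w" using w[OF r] norm_ge_zero order_trans by blast
    then show "norm ((v r - L) * ?k r) \<le> w * (M / e)"
      unfolding norm_mult norm_of_real abs_divide using e by (intro mult_mono w[OF r] divide_right_mono) (auto intro: M divide_right_mono)
  qed auto
  also have "\<dots> = M * w" using e by simp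
  finally have le: "norm (integral ?I (\<lambda>r. (v r - L) * ?k r)) \<le> M * w" .
  have sup_eq: "integral {0..T} (\<lambda>r. v r * ?k r) = integral ?I (\<lambda>r. v r * ?k r)"
    by (rule sup(1)) (use van in auto)
  show "norm (integral {0..T} (\<lambda>r. v r * ?k r) + L) \<le> M * w"
    unfolding sup_eq eq by (rule le)
qed

text \<open>The test functions are smooth plateaus over [s, t], differences of two steps. The rising
  and the falling edge average v near s and near t, and the plateau leaves G unchanged except near
  the two ends. Continuity of v and boundedness of G make every error proportional to d.\<close>

lemma weak_derivative_bounded_primitive:
  fixes v G :: "real \<Rightarrow> complex"
  assumes chi: "freq_cutoff chi" and v: "continuous_on {0..T} v"
    and G: "G \<in> borel_measurable (lebesgue_on {0..T})" "\<And>t. t \<in> {0..T} \<Longrightarrow> norm (G t) \<le> B"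
    and weak: "\<And>E t\<^sub>0 t\<^sub>1. (\<And>j r. (E j has_real_derivative E (Suc j) r) (at r)) \<Longrightarrow> 0 < t\<^sub>0 \<Longrightarrow> t\<^sub>1 < T \<Longrightarrow>
      (\<And>r. r \<notin> {t\<^sub>0..t\<^sub>1} \<Longrightarrow> E 0 r = 0) \<Longrightarrow>
      integral {0..T} (\<lambda>r. v r * complex_of_real (E 1 r) + G r * complex_of_real (E 0 r)) = 0"
  shows "bounded_primitive 0 T v G"
proof -
  obtain K :: "nat \<Rightarrow> real \<Rightarrow> real" where K: "\<And>j r. (K j has_real_derivative K (Suc j) r) (at r)"
    "\<And>r. r \<le> 1 \<Longrightarrow> K 0 r = 1" "\<And>r. 2 \<le> r \<Longrightarrow> K 0 r = 0" "\<And>r. 0 \<le> K 0 r \<and> K 0 r \<le> 1"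
    "\<And>r. r \<notin> {1..2} \<Longrightarrow> K 1 r = 0"
    using smooth_step_exists[OF chi] by metis
  have cK: "continuous_on S (K j)" for S j
    using K(1) by (intro continuous_at_imp_continuous_on ballI DERIV_isCont) blast
  have "bounded (K 1 ` {1..2})" by (intro compact_imp_bounded compact_continuous_image compact_Icc cK)
  then obtain M' where M': "\<And>r. r \<in> {1..2} \<Longrightarrow> \<bar>K 1 r\<bar> \<le> M'" unfolding bounded_iff real_norm_def by blast
  define M where "M = max M' 0"
  have M: "\<bar>K 1 r\<bar> \<le> M" for r using M'[of r] K(5)[of r] by (cases "r \<in> {1..2}") (auto simp: M_def)
  have M0: "0 \<le> M" by (simp add: M_def)
  have intG: "G integrable_on {0..T}" by (rule bounded_integrable_on[OF G])
  have "v t - v s = integral {s..t} G" if st: "0 \<le> s" "s \<le> t" "t \<le> T" for s t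
  proof (cases "s = t")
    case False
    then have lt: "s < t" using st by simp
    define X where "X = v s - v t + integral {s..t} G"
    have B0: "0 \<le> B" using G(2)[of 0] st norm_ge_zero order_trans by (metis atLeastAtMost_iff order_refl)
    have Xle: "norm X \<le> (2 * M + 4 * B) * d" if d: "0 < d" for d
    proof -
      obtain d1 where d1: "0 < d1" "\<And>r. r \<in> {0..T} \<Longrightarrow> dist r s < d1 \<Longrightarrow> dist (v r) (v s) < d"
        using v st d unfolding continuous_on_iff by (metis atLeastAtMost_iff order_trans)
      obtain d2 where d2: "0 < d2" "\<And>r. r \<in> {0..T} \<Longrightarrow> dist r t < d2 \<Longrightarrow> dist (v r) (v t) < d"
        using v st d unfolding continuous_on_iff by (metis atLeastAtMost_iff order_trans)
      \<comment> \<open>Each edge must be so short that v varies there by less than d, that the two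
        edges do not meet, and that the error in the integral of G is of order d.\<close>
      define e where "e = min (min (d1 / 4) (d2 / 4)) (min d ((t - s) / 4))"
      have e: "0 < e" "e \<le> d" "4 * e \<le> t - s" "4 * e \<le> d1" "4 * e \<le> d2"
        using d d1(1) d2(1) lt by (auto simp: e_def min_def)
      \<comment> \<open>With this shift the plateau falls on [t - 2 e, t - e], mirroring its rise on
        [s + e, s + 2 e]. Its support is thus inside the open interval ]0, T[ even for s = 0 and t =
        T.\<close>
      define \<tau> where "\<tau> = t - 3 * e"
      define E where "E = (\<lambda>j r. (K j ((r - \<tau>) / e) - K j ((r - s) / e)) * (1 / e) ^ j)"
      have ED: "(E j has_real_derivative E (Suc j) r) (at r)" for j r
      proof -
        have "((\<lambda>r. K j ((r - q) / e)) has_real_derivative K (Suc j) ((r - q) / e) * (1 / e)) (at r)" for q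
          by (rule DERIV_chain2[OF K(1)]) (use e in \<open>auto intro!: derivative_eq_intros\<close>)
        from DERIV_cmult_right[OF DERIV_diff[OF this[of \<tau>] this[of s]], of "(1 / e) ^ j"]
        show ?thesis unfolding E_def by (simp add: left_diff_distrib diff_divide_distrib)
      qed
      have Eout: "E 0 r = 0" if "r \<notin> {s + e..t - e}" for r
      proof (cases "r < s + e")
        case True
        then have "(r - s) / e \<le> 1" "(r - \<tau>) / e \<le> 1" using e by (auto simp: \<tau>_def field_simps)
        then show ?thesis by (simp add: E_def K)
      next
        case False
        then have "2 \<le> (r - s) / e" "2 \<le> (r - \<tau>) / e" using that e by (auto simp: \<tau>_def field_simps)
        then show ?thesis by (simp add: E_def K)
      qed
      have Emid: "E 0 r = 1" if "r \<in> {s + 2 * e..t - 2 * e}" for r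
      proof -
        have "2 \<le> (r - s) / e" "(r - \<tau>) / e \<le> 1" using that e by (auto simp: \<tau>_def field_simps)
        then show ?thesis by (simp add: E_def K)
      qed
      have Ebd: "\<bar>E 0 r - 1\<bar> \<le> 1" for r
      proof (cases "r \<le> t - 2 * e")
        case True
        then have "(r - \<tau>) / e \<le> 1" using e by (auto simp: \<tau>_def field_simps)
        then show ?thesis using K(4)[of "(r - s) / e"] by (simp add: E_def K)
      next
        case False
        then have "2 \<le> (r - s) / e" using e by (auto simp: field_simps)
        then show ?thesis using K(4)[of "(r - \<tau>) / e"] by (simp add: E_def K abs_le_iff)
      qed
      have cE: "continuous_on S (E j)" for S j
        using ED by (intro continuous_at_imp_continuous_on ballI DERIV_isCont) blast
      have mE: "(\<lambda>r. complex_of_real (E 0 r)) \<in> borel_measurable (lebesgue_on {0..T})"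
        by (intro continuous_on_measurable_lebesgue_on continuous_intros cE)
      have Ele: "\<bar>E 0 r\<bar> \<le> 2" for r using Ebd[of r] by linarith
      have intGE: "(\<lambda>r. G r * complex_of_real (E 0 r)) integrable_on {0..T}"
      proof (rule bounded_integrable_on[where B = "B * 2"])
        show "norm (G r * complex_of_real (E 0 r)) \<le> B * 2" if "r \<in> {0..T}" for r
          unfolding norm_mult norm_of_real using B0 by (intro mult_mono G(2)[OF that] Ele) auto
      qed (use G(1) mE in measurable)
      have zero: "integral {0..T} (\<lambda>r. v r * complex_of_real (E 1 r) + G r * complex_of_real (E 0 r)) = 0"
        by (rule weak[of E "s + e" "t - e", OF ED]) (use st e Eout in auto)
      have a1: "(\<lambda>r. v r * complex_of_real (K 1 ((r - s) / e) / e)) integrable_on {0..T}"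
        "norm (integral {0..T} (\<lambda>r. v r * complex_of_real (K 1 ((r - s) / e) / e)) + v s) \<le> M * d"
      proof -
        have "norm (v r - v s) \<le> d" if "r \<in> {s + e..s + 2 * e}" for r
          using d1(2)[of r] that e st by (auto simp: dist_norm less_imp_le)
        note A = step_derivative_average[of "K 0" "K 1" M T v e s, OF K(1)[of 0, folded One_nat_def] _ _ K(5) cK M v e(1) _ this]
        show "(\<lambda>r. v r * complex_of_real (K 1 ((r - s) / e) / e)) integrable_on {0..T}"
          "norm (integral {0..T} (\<lambda>r. v r * complex_of_real (K 1 ((r - s) / e) / e)) + v s) \<le> M * d"
          by (rule A; use K e st in force)+
      qed
      have a2: "(\<lambda>r. v r * complex_of_real (K 1 ((r - \<tau>) / e) / e)) integrable_on {0..T}"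
        "norm (integral {0..T} (\<lambda>r. v r * complex_of_real (K 1 ((r - \<tau>) / e) / e)) + v t) \<le> M * d"
      proof -
        have "norm (v r - v t) \<le> d" if "r \<in> {\<tau> + e..\<tau> + 2 * e}" for r
          using d2(2)[of r] that e st by (auto simp: dist_norm less_imp_le \<tau>_def)
        note A = step_derivative_average[of "K 0" "K 1" M T v e \<tau>, OF K(1)[of 0, folded One_nat_def] _ _ K(5) cK M v e(1) _ this]
        show "(\<lambda>r. v r * complex_of_real (K 1 ((r - \<tau>) / e) / e)) integrable_on {0..T}"
          "norm (integral {0..T} (\<lambda>r. v r * complex_of_real (K 1 ((r - \<tau>) / e) / e)) + v t) \<le> M * d"
          by (rule A; use K e st in \<open>force simp: \<tau>_def\<close>)+
      qed
      define I1 where "I1 = integral {0..T} (\<lambda>r. v r * complex_of_real (K 1 ((r - s) / e) / e))"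
      define I2 where "I2 = integral {0..T} (\<lambda>r. v r * complex_of_real (K 1 ((r - \<tau>) / e) / e))"
      define I3 where "I3 = integral {0..T} (\<lambda>r. G r * complex_of_real (E 0 r))"
      have "((\<lambda>r. v r * complex_of_real (K 1 ((r - \<tau>) / e) / e) - v r * complex_of_real (K 1 ((r - s) / e) / e)
          + G r * complex_of_real (E 0 r)) has_integral (I2 - I1 + I3)) {0..T}"
        unfolding I1_def I2_def I3_def by (intro has_integral_add has_integral_diff integrable_integral a1 a2 intGE)
      then have sum0: "I2 - I1 + I3 = 0"
        using zero by (simp add: E_def integral_unique right_diff_distrib diff_divide_distrib)
      \<comment> \<open>The plateau differs from 1 by at most 1, and inside [s, t] only on two
        pieces of length 2 e, where G is bounded by B.\<close>
      have I3: "norm (I3 - integral {s..t} G) \<le> 4 * B * e"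
      proof -
        have sub: "{s..t} \<subseteq> {0..T}" using st by auto
        have iGE: "(\<lambda>r. G r * complex_of_real (E 0 r)) integrable_on {s..t}" and iG: "G integrable_on {s..t}"
          using integrable_on_subinterval[OF intGE sub] integrable_on_subinterval[OF intG sub] by auto
        have "I3 = integral {s..t} (\<lambda>r. G r * complex_of_real (E 0 r))"
          unfolding I3_def
        proof (rule integral_superset_vanish(1)[OF sub _ iGE])
          fix r assume "r \<notin> {s..t}"
          then have "r \<notin> {s + e..t - e}" using e by auto
          then show "G r * complex_of_real (E 0 r) = 0" using Eout by simp
        qed
        then have d: "I3 - integral {s..t} G = integral {s..t} (\<lambda>r. G r * complex_of_real (E 0 r) - G r)"
          using iGE iG by (simp add: Henstock_Kurzweil_Integration.integral_diff)
        let ?h = "\<lambda>r. G r * complex_of_real (E 0 r) - G r"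
        have ih: "?h integrable_on {s..t}" using iGE iG by (rule integrable_diff)
        have ihs: "?h integrable_on {c..d}" if "s \<le> c" "d \<le> t" for c d
          by (rule integrable_on_subinterval[OF ih]) (use that in auto)
        have edge: "norm (integral {c..d} ?h) \<le> B * (d - c)" if "s \<le> c" "c \<le> d" "d \<le> t" for c d
        proof -
          have "norm (integral {c..d} ?h) \<le> integral {c..d} (\<lambda>_. B * 1)"
          proof (rule integral_norm_bound_integral[OF ihs])
            fix r assume r: "r \<in> {c..d}"
            have "?h r = G r * complex_of_real (E 0 r - 1)" by (simp add: right_diff_distrib)
            then show "norm (?h r) \<le> B * 1"
              unfolding norm_mult norm_of_real
              using r that st B0 by (simp only: norm_mult norm_of_real) (intro mult_mono G(2) Ebd, auto)
          qed (use that in auto)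
          then show ?thesis using that by (simp add: mult.commute)
        qed
        have mid: "integral {s + 2 * e..t - 2 * e} ?h = 0"
          using Henstock_Kurzweil_Integration.integral_cong[of "{s + 2 * e..t - 2 * e}" ?h "\<lambda>_. 0"] Emid by simp
        have c1: "integral {s..t} ?h = integral {s..s + 2 * e} ?h + integral {s + 2 * e..t} ?h"
          using Henstock_Kurzweil_Integration.integral_combine[of s "s + 2 * e" t ?h] ih e by simp
        have c2: "integral {s + 2 * e..t} ?h = integral {s + 2 * e..t - 2 * e} ?h + integral {t - 2 * e..t} ?h"
          using Henstock_Kurzweil_Integration.integral_combine[of "s + 2 * e" "t - 2 * e" t ?h] ihs[of "s + 2 * e" t] e by simp
        have "norm (integral {s..t} ?h) \<le> norm (integral {s..s + 2 * e} ?h) + norm (integral {t - 2 * e..t} ?h)"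
          unfolding c1 c2 mid using norm_triangle_ineq by simp
        also have "\<dots> \<le> B * (2 * e) + B * (2 * e)"
          using edge[of s "s + 2 * e"] edge[of "t - 2 * e" t] e by simp
        finally show ?thesis unfolding d by simp
      qed
      have "X = (I1 + v s) - (I2 + v t) - (I3 - integral {s..t} G)"
        using sum0 by (simp add: X_def algebra_simps)
      then have "norm X \<le> norm (I1 + v s) + norm (I2 + v t) + norm (I3 - integral {s..t} G)"
        using norm_triangle_ineq4[of "(I1 + v s) - (I2 + v t)" "I3 - integral {s..t} G"]
          norm_triangle_ineq4[of "I1 + v s" "I2 + v t"] by simp
      also have "\<dots> \<le> M * d + M * d + 4 * B * e"
        using a1(2) a2(2) I3 unfolding I1_def I2_def by (intro add_mono)
      also have "\<dots> \<le> M * d + M * d + 4 * B * d"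
        using e(2) B0 by (intro add_left_mono mult_left_mono) auto
      finally show ?thesis by (simp add: algebra_simps)
    qed
    have "norm X \<le> 0"
    proof (rule field_le_epsilon)
      fix q :: real assume q: "0 < q"
      define C where "C = 2 * M + 4 * B + 1"
      have C: "0 < C" using M0 B0 by (simp add: C_def)
      have "norm X \<le> (2 * M + 4 * B) * (q / C)" using q C by (intro Xle) simp
      also have "\<dots> \<le> C * (q / C)" using q C by (intro mult_right_mono) (auto simp: C_def)
      finally show "norm X \<le> 0 + q" using C by simp
    qed
    then show ?thesis by (simp add: X_def algebra_simps)
  qed simp
  then show ?thesis
    unfolding bounded_primitive_def using G by blast
qed

section \<open>Measurability in time of single Fourier coefficients\<close>

lemma complete_measure_lebesgue_on:
  assumes "S \<in> sets lebesgue"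
  shows "complete_measure (lebesgue_on S)"
proof
  fix A B assume B: "B \<subseteq> A" and "A \<in> null_sets (lebesgue_on S)"
  then have A: "A \<subseteq> S" "A \<in> null_sets lebesgue" using assms by (auto simp: null_sets_restrict_space)
  have "B \<in> sets lebesgue" by (rule completion.complete[OF B A(2)])
  then show "B \<in> sets (lebesgue_on S)" using A B assms by (simp add: sets_restrict_space_iff)
qed

lemma (in complete_measure) measurable_AE_eq:
  assumes f: "f \<in> measurable M N" and ae: "AE x in M. f x = g x" and g: "\<And>x. x \<in> space M \<Longrightarrow> g x \<in> space N"
  shows "g \<in> measurable M N"
proof (rule measurableI[OF g])
  fix A assume A: "A \<in> sets N"
  have "AE x in M. x \<in> f -` A \<inter> space M \<longleftrightarrow> x \<in> g -` A \<inter> space M"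
    using ae by eventually_elim auto
  then show "g -` A \<inter> space M \<in> sets M"
    by (rule in_sets_AE) (use measurable_sets[OF f A] in auto)
qed

text \<open>All functions are set to zero on the null set where convergence fails, which makes the
  limit pointwise. Completeness then allows the return from this modification to g. It is needed
  because strong measurability provides convergence only almost everywhere.\<close>

lemma (in complete_measure) measurable_AE_limit:
  fixes h :: "nat \<Rightarrow> 'a \<Rightarrow> 'b::{real_normed_vector, second_countable_topology}"
  assumes m: "\<And>n. h n \<in> borel_measurable M" and lim: "AE x in M. (\<lambda>n. h n x) \<longlonglongrightarrow> g x"
  shows "g \<in> borel_measurable M"
proof -
  define N where "N = {x \<in> space M. \<not> (\<lambda>n. h n x) \<longlonglongrightarrow> g x}"
  have N: "N \<in> null_sets M" using lim unfolding N_def AE_iff_null_sets .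
  have "(\<lambda>x. if x \<in> N then 0 else g x) \<in> borel_measurable M"
  proof (rule borel_measurable_LIMSEQ_metric)
    show "(\<lambda>x. if x \<in> N then 0 else h n x) \<in> borel_measurable M" for n
      using m N by (intro measurable_If_set) auto
    show "(\<lambda>n. if x \<in> N then 0 else h n x) \<longlonglongrightarrow> (if x \<in> N then 0 else g x)" if "x \<in> space M" for x
      using that by (auto simp: N_def)
  qed
  then show ?thesis
    by (rule measurable_AE_eq) (use AE_not_in[OF N] in auto)
qed

lemma simple_L2_fourier_measurable:
  assumes "simple_L2 T s"
  shows "(\<lambda>t. fourier (s t) k) \<in> borel_measurable (lebesgue_on {0<..<T})"
proof -
  let ?M = "lebesgue_on {0<..<T}"
  have fin: "finite (s ` {0<..<T})" and lev: "\<And>g. {t \<in> {0<..<T}. s t = g} \<in> sets lebesgue"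
    using assms by (auto simp: simple_L2_def)
  have lev': "{t \<in> {0<..<T}. s t = g} \<in> sets ?M" for g
    using lev[of g] by (subst sets_restrict_space_iff) auto
  have "(\<lambda>t. \<Sum>g\<in>s ` {0<..<T}. indicator {t \<in> {0<..<T}. s t = g} t * fourier g k) \<in> borel_measurable ?M"
    using lev' by (intro borel_measurable_sum borel_measurable_times borel_measurable_indicator) auto
  moreover have "(\<Sum>g\<in>s ` {0<..<T}. indicator {t \<in> {0<..<T}. s t = g} t * fourier g k) = fourier (s t) k"
    if "t \<in> {0<..<T}" for t
  proof -
    have "(\<Sum>g\<in>s ` {0<..<T}. indicator {t \<in> {0<..<T}. s t = g} t * fourier g k)
        = (\<Sum>g\<in>s ` {0<..<T}. if s t = g then fourier g k else 0)"
      using that by (intro sum.cong) (auto simp: indicator_def)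
    also have "\<dots> = fourier (s t) k" using fin that by (simp add: sum.delta')
    finally show ?thesis .
  qed
  ultimately show ?thesis
    by (subst measurable_cong[of ?M _ "\<lambda>t. \<Sum>g\<in>s ` {0<..<T}. indicator {t \<in> {0<..<T}. s t = g} t * fourier g k"]) auto
qed

text \<open>Taking one coefficient is a Lipschitz map on L^2, so the approximating simple functions
  yield measurable scalar functions that converge almost everywhere.\<close>

lemma Linf_L2_fourier_measurable:
  assumes "Linf_L2 T f"
  shows "(\<lambda>t. fourier (f t) k) \<in> borel_measurable (lebesgue_on {0<..<T})"
proof -
  obtain s where s: "\<And>n::nat. simple_L2 T (s n)"
    and lim: "AE t in lebesgue_on {0<..<T}. (\<lambda>n. L2_norm (\<lambda>x. s n t x - f t x)) \<longlonglongrightarrow> 0"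
    and f: "\<And>t. t \<in> {0<..<T} \<Longrightarrow> f t \<in> L2_torus"
    using assms unfolding Linf_L2_def by blast
  interpret complete_measure "lebesgue_on {0<..<T}" by (rule complete_measure_lebesgue_on) simp
  show ?thesis
  proof (rule measurable_AE_limit)
    show "(\<lambda>t. fourier (s n t) k) \<in> borel_measurable (lebesgue_on {0<..<T})" for n
      by (rule simple_L2_fourier_measurable[OF s])
    show "AE t in lebesgue_on {0<..<T}. (\<lambda>n. fourier (s n t) k) \<longlonglongrightarrow> fourier (f t) k"
      using lim AE_space
    proof eventually_elim
      case (elim t)
      then have t: "t \<in> {0<..<T}" by simp
      have sn: "s n t \<in> L2_torus" for n using s[of n] t by (auto simp: simple_L2_def)
      have "norm (fourier (s n t) k - fourier (f t) k) \<le> L2_norm (\<lambda>x. s n t x - f t x)" for n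
        using norm_fourier_le[OF L2_torus_diff[OF sn f[OF t]], of n k] fourier_diff[OF sn f[OF t]] by simp
      then have "(\<lambda>n. fourier (s n t) k - fourier (f t) k) \<longlonglongrightarrow> 0"
        by (intro Lim_null_comparison[OF _ elim(1)]) (auto intro: always_eventually)
      then show ?case by (simp add: LIM_zero_iff)
    qed
  qed
qed

lemma continuous_L2_fourier:
  assumes "continuous_L2 T u"
  shows "continuous_on {0..T} (\<lambda>t. fourier (u t) k)"
  unfolding continuous_on_def
proof
  fix t assume t: "t \<in> {0..T}"
  have u: "u s \<in> L2_torus" if "s \<in> {0..T}" for s using assms that by (simp add: continuous_L2_def)
  have lim: "((\<lambda>s. L2_norm (\<lambda>x. u s x - u t x)) \<longlongrightarrow> 0) (at t within {0..T})"
    using assms t by (simp add: continuous_L2_def)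
  have "((\<lambda>s. fourier (u s) k - fourier (u t) k) \<longlongrightarrow> 0) (at t within {0..T})"
  proof (rule Lim_null_comparison[OF _ lim])
    have "norm (fourier (u s) k - fourier (u t) k) \<le> L2_norm (\<lambda>x. u s x - u t x)" if "s \<in> {0..T}" for s
      using norm_fourier_le[OF L2_torus_diff[OF u[OF that] u[OF t]], of k] fourier_diff[OF u[OF that] u[OF t]] by simp
    then show "\<forall>\<^sub>F s in at t within {0..T}. norm (fourier (u s) k - fourier (u t) k) \<le> L2_norm (\<lambda>x. u s x - u t x)"
      by (auto simp: eventually_at_filter)
  qed
  then show "((\<lambda>t. fourier (u t) k) \<longlongrightarrow> fourier (u t) k) (at t within {0..T})"
    by (simp add: LIM_zero_iff)
qed

section \<open>Testing the equation with a single Fourier mode\<close>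

lemma fourier_mode:
  "fourier (\<lambda>x. z * cis (- (of_int k * x))) \<xi> = (if \<xi> = - k then z else 0)"
proof -
  have "- (of_int k * x) + - (of_int \<xi> * x) = of_int (- k - \<xi>) * x" for x :: real
    by (simp add: algebra_simps)
  then have "z * cis (- (of_int k * x)) * cis (- (of_int \<xi> * x)) = z * cis (of_int (- k - \<xi>) * x)" for x
    by (simp only: mult.assoc cis_mult)
  then have "fourier (\<lambda>x. z * cis (- (of_int k * x))) \<xi> = complex_of_real (1 / (2 * pi)) * (LINT x|torus. z * cis (of_int (- k - \<xi>) * x))"
    by (simp only: fourier_def)
  also have "\<dots> = complex_of_real (1 / (2 * pi)) * (z * (LINT x|torus. cis (of_int (- k - \<xi>) * x)))"
    by simp
  also have "\<dots> = (if \<xi> = - k then z else 0)"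
    by (subst integral_torus_cis) auto
  finally show ?thesis .
qed

text \<open>The mode sits at frequency -k. For the transposed symbol of the weak formulation, which
  already reflects \<xi>, the value obtained is therefore the one of p at k.\<close>

lemma fourier_multiplier_mode:
  "fourier_multiplier m (\<lambda>x. z * cis (- (of_int k * x))) x = m (- of_int k) * z * cis (- (of_int k * x))"
  unfolding fourier_multiplier_def fourier_mode
  by (subst fourier_series_eq_sum[of "{- k}"]) auto

lemma mode_test_function:
  fixes E :: "nat \<Rightarrow> real \<Rightarrow> real"
  assumes E: "\<And>j r. (E j has_real_derivative E (Suc j) r) (at r)"
    and supp: "0 < t\<^sub>0" "t\<^sub>1 < T" "\<And>r. r \<notin> {t\<^sub>0..t\<^sub>1} \<Longrightarrow> E 0 r = 0"
  shows "test_function T (\<lambda>t x. complex_of_real (E 0 t) * cis (- (of_int k * x)))"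
    and "((\<lambda>s. complex_of_real (E 0 s) * cis (- (of_int k * x))) has_vector_derivative
      complex_of_real (E 1 t) * cis (- (of_int k * x))) (at t)"
    and "((\<lambda>y. complex_of_real (E 0 t) * cis (- (of_int k * y))) has_vector_derivative
      complex_of_real (E 0 t) * (- \<i> * of_int k) * cis (- (of_int k * x))) (at x)"
proof -
  \<comment> \<open>The table of mixed partial derivatives demanded by \<open>smooth2\<close>: time
    derivatives move along the family E, and each derivative in x multiplies by - i k.\<close>
  define D where "D = (\<lambda>(j::nat) (l::nat) t x. complex_of_real (E j t) * (- \<i> * of_int k) ^ l * cis (- (of_int k * x)))"
  have Dt: "((\<lambda>s. D j l s x) has_vector_derivative D (Suc j) l t x) (at t)" for j l t x
  proof -
    have "((\<lambda>s. complex_of_real (E j s)) has_vector_derivative complex_of_real (E (Suc j) t)) (at t)"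
      by (rule has_vector_derivative_of_real[OF E])
    from has_vector_derivative_mult_left[OF has_vector_derivative_mult_left[OF this]]
    show ?thesis unfolding D_def .
  qed
  have c: "((\<lambda>y. cis (- (of_int k * y))) has_vector_derivative (- \<i> * of_int k) * cis (- (of_int k * x))) (at x)" for x
  proof -
    have "((\<lambda>y. cis (- (of_int k * y))) has_vector_derivative (- of_int k) *\<^sub>R (\<i> * cis (- (of_int k * x)))) (at x)"
      unfolding has_vector_derivative_def
      by (auto intro!: derivative_eq_intros simp: algebra_simps scaleR_conv_of_real)
    then show ?thesis by (simp add: scaleR_conv_of_real mult_ac)
  qed
  have Dx: "((\<lambda>y. D j l t y) has_vector_derivative D j (Suc l) t x) (at x)" for j l t x
    using has_vector_derivative_mult_right[OF c[of x], of "complex_of_real (E j t) * (- \<i> * of_int k) ^ l"]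
    unfolding D_def by (simp add: mult_ac)
  have cE: "continuous_on UNIV (E j)" for j
    using E by (intro continuous_at_imp_continuous_on ballI DERIV_isCont) blast
  have Dc: "continuous_on UNIV (\<lambda>(t, x). D j l t x)" for j l
    unfolding D_def case_prod_beta
    by (intro continuous_intros continuous_on_compose2[OF cE]) auto
  have D0: "D 0 0 = (\<lambda>t x. complex_of_real (E 0 t) * cis (- (of_int k * x)))" by (simp add: D_def)
  have per: "cis (- (of_int k * (x + 2 * pi))) = cis (- (of_int k * x))" for x
  proof -
    have "cis (- (of_int k * (x + 2 * pi))) = cis (- (of_int k * x)) * cis (2 * pi * of_int (- k))"
      by (simp add: cis_mult algebra_simps)
    also have "cis (2 * pi * of_int (- k)) = 1" by (rule cis_multiple_2pi) simp
    finally show ?thesis by simp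
  qed
  show "test_function T (\<lambda>t x. complex_of_real (E 0 t) * cis (- (of_int k * x)))"
    unfolding test_function_def smooth2_def
  proof (intro conjI)
    show "\<exists>D. D 0 0 = (\<lambda>t x. complex_of_real (E 0 t) * cis (- (of_int k * x))) \<and>
      (\<forall>j k. continuous_on UNIV (\<lambda>(t, x). D j k t x)) \<and>
      (\<forall>j k t x. ((\<lambda>s. D j k s x) has_vector_derivative D (Suc j) k t x) (at t) \<and>
        ((\<lambda>y. D j k t y) has_vector_derivative D j (Suc k) t x) (at x))"
      using D0 Dc Dt Dx by (intro exI[of _ D]) auto
    show "\<exists>t\<^sub>0 t\<^sub>1. 0 < t\<^sub>0 \<and> t\<^sub>1 < T \<and> (\<forall>t x. t \<notin> {t\<^sub>0..t\<^sub>1} \<longrightarrow> complex_of_real (E 0 t) * cis (- (of_int k * x)) = 0)"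
      using supp by (intro exI[of _ t\<^sub>0] exI[of _ t\<^sub>1]) auto
  qed (simp add: per)
  show "((\<lambda>s. complex_of_real (E 0 s) * cis (- (of_int k * x))) has_vector_derivative
      complex_of_real (E 1 t) * cis (- (of_int k * x))) (at t)"
    using Dt[of 0 0 x t] by (simp add: D_def)
  show "((\<lambda>y. complex_of_real (E 0 t) * cis (- (of_int k * y))) has_vector_derivative
      complex_of_real (E 0 t) * (- \<i> * of_int k) * cis (- (of_int k * x))) (at x)"
    using Dx[of 0 0 t x] by (simp add: D_def)
qed

text \<open>Pairing with E times the mode of frequency -k extracts the k-th coefficients, up to the
  factor - 2 pi. What remains is the weak form of v' = i p(k) v - i k g, where v and g are the k-th
  coefficients of u and f.\<close>

lemma weak_solution_mode:
  fixes E :: "nat \<Rightarrow> real \<Rightarrow> real"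
  assumes weak: "weak_solution T p u f"
    and u: "\<And>t. t \<in> {0<..<T} \<Longrightarrow> u t \<in> L2_torus" and f: "\<And>t. t \<in> {0<..<T} \<Longrightarrow> f t \<in> L2_torus"
    and E: "\<And>j r. (E j has_real_derivative E (Suc j) r) (at r)"
    and supp: "0 < t\<^sub>0" "t\<^sub>1 < T" "\<And>r. r \<notin> {t\<^sub>0..t\<^sub>1} \<Longrightarrow> E 0 r = 0"
  shows "(LINT t|lebesgue_on {0<..<T}. fourier (u t) k * complex_of_real (E 1 t)
    + (\<i> * complex_of_real (p (of_int k)) * fourier (u t) k - \<i> * of_int k * fourier (f t) k) * complex_of_real (E 0 t)) = 0"
proof -
  let ?M = "lebesgue_on {0<..<T}"
  define \<psi> where "\<psi> = (\<lambda>t x. complex_of_real (E 0 t) * cis (- (of_int k * x)))"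
  let ?in = "\<lambda>t. LINT x|torus.
        u t x * (- vector_derivative (\<lambda>s. \<psi> s x) (at t)
                 + fourier_multiplier (\<lambda>\<xi>. - \<i> * complex_of_real (p (- \<xi>))) (\<psi> t) x)
        - f t x * vector_derivative (\<lambda>y. \<psi> t y) (at x)"
  let ?h = "\<lambda>t. fourier (u t) k * complex_of_real (E 1 t)
    + (\<i> * complex_of_real (p (of_int k)) * fourier (u t) k - \<i> * of_int k * fourier (f t) k) * complex_of_real (E 0 t)"
  note tf = mode_test_function[of E, OF E supp]
  have "test_function T \<psi>" unfolding \<psi>_def by (rule tf(1))
  then have zero: "(LINT t|?M. ?in t) = 0"
    using weak unfolding weak_solution_def by blast
  have inner: "?in t = - complex_of_real (2 * pi) * ?h t" if t: "t \<in> {0<..<T}" for t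
  proof -
    let ?e = "\<lambda>x. cis (- of_int k * x)"
    have 1: "vector_derivative (\<lambda>s. \<psi> s x) (at t) = complex_of_real (E 1 t) * ?e x" for x
      unfolding \<psi>_def using vector_derivative_at[OF tf(2)] by simp
    have 2: "vector_derivative (\<lambda>y. \<psi> t y) (at x) = complex_of_real (E 0 t) * (- \<i> * of_int k) * ?e x" for x
      unfolding \<psi>_def using vector_derivative_at[OF tf(3)] by simp
    have 3: "fourier_multiplier (\<lambda>\<xi>. - \<i> * complex_of_real (p (- \<xi>))) (\<psi> t) x
        = - \<i> * complex_of_real (p (of_int k)) * complex_of_real (E 0 t) * ?e x" for x
      unfolding \<psi>_def fourier_multiplier_mode by simp
    define q where "q = - complex_of_real (E 1 t) - \<i> * complex_of_real (p (of_int k)) * complex_of_real (E 0 t)"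
    define r where "r = complex_of_real (E 0 t) * (\<i> * of_int k)"
    note iu = L2_torus_integrable_cis[OF u[OF t], of "- of_int k"]
      and if' = L2_torus_integrable_cis[OF f[OF t], of "- of_int k"]
    have "?in t = (LINT x|torus. q * (u t x * ?e x) + r * (f t x * ?e x))"
      unfolding 1 2 3 by (intro Bochner_Integration.integral_cong refl) (simp add: q_def r_def algebra_simps)
    also have "\<dots> = q * (LINT x|torus. u t x * ?e x) + r * (LINT x|torus. f t x * ?e x)"
      using iu if' by (simp add: Bochner_Integration.integral_add)
    also have "\<dots> = q * (complex_of_real (2 * pi) * fourier (u t) k) + r * (complex_of_real (2 * pi) * fourier (f t) k)"
      unfolding fourier_def by simp
    also have "\<dots> = - complex_of_real (2 * pi) * ?h t"
      by (simp add: q_def r_def algebra_simps)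
    finally show ?thesis .
  qed
  have "(LINT t|?M. ?in t) = (LINT t|?M. - complex_of_real (2 * pi) * ?h t)"
    by (intro Bochner_Integration.integral_cong refl inner) simp
  then have "- complex_of_real (2 * pi) * (LINT t|?M. ?h t) = 0"
    using zero by (simp only: integral_mult_right_zero)
  then show ?thesis by (simp del: of_real_mult)
qed

text \<open>The bridge between the two integrals in use: the time norms and the equation are
  Lebesgue integrals over the open interval, the sieve estimates are gauge integrals over the closed
  one.\<close>

lemma bounded_integral_open_interval:
  fixes h :: "real \<Rightarrow> 'a::euclidean_space"
  assumes h: "h \<in> borel_measurable (lebesgue_on {a..b})" "\<And>t. t \<in> {a..b} \<Longrightarrow> norm (h t) \<le> B"
  shows "(LINT t|lebesgue_on {a<..<b}. h t) = integral {a..b} h"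
proof -
  have sub: "{a<..<b} \<subseteq> {a..b}" by auto
  have fin: "finite_measure (lebesgue_on {a<..<b})"
    by (rule finite_measure_lebesgue_on) auto
  have "integrable (lebesgue_on {a<..<b}) h"
    by (rule finite_measure.integrable_const_bound[OF fin, of _ B])
      (use h sub measurable_restrict_mono[OF h(1) sub] in auto)
  then have "(LINT t|lebesgue_on {a<..<b}. h t) = integral {a<..<b} h"
    by (rule lebesgue_integral_eq_integral) simp
  then show ?thesis by (simp add: integral_open_interval_real)
qed

text \<open>With v the k-th coefficient of u, the integrating factor
  \<open>cis (- (p (of_int k) * t))\<close> removes the linear term from v' = i p(k) v - i k G. Here
  G stands for a representative of the coefficient of f that is bounded at every time of the closed
  interval, as \<open>bounded_primitive\<close> demands, whereas f is controlled only almost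
  everywhere.\<close>

lemma solution_mode_primitive:
  assumes chi: "freq_cutoff chi" and T: "0 < T" and u: "continuous_L2 T u" and f: "Linf_L2 T f"
    and weak: "weak_solution T p u f"
    and G: "G \<in> borel_measurable (lebesgue_on {0..T})" "\<And>t. t \<in> {0..T} \<Longrightarrow> norm (G t) \<le> B"
    and ae: "AE t in lebesgue_on {0<..<T}. G t = fourier (f t) k"
  shows "bounded_primitive 0 T (\<lambda>t. cis (- (p (of_int k) * t)) * fourier (u t) k)
    (\<lambda>t. cis (- (p (of_int k) * t)) * (- \<i> * of_int k * G t))"
proof -
  let ?p = "p (of_int k)"
  define v where "v = (\<lambda>t. fourier (u t) k)"
  define H where "H = (\<lambda>t. \<i> * complex_of_real ?p * v t - \<i> * of_int k * G t)"
  have cv: "continuous_on {0..T} v"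
    unfolding v_def by (rule continuous_L2_fourier[OF u])
  have mv: "v \<in> borel_measurable (lebesgue_on {0..T})"
    by (rule continuous_on_measurable_lebesgue_on[OF cv])
  have "bounded (v ` {0..T})" by (intro compact_imp_bounded compact_continuous_image compact_Icc cv)
  then obtain V where V: "\<And>t. t \<in> {0..T} \<Longrightarrow> norm (v t) \<le> V" unfolding bounded_iff by blast
  have sub: "{0<..<T} \<subseteq> {0..T}" by auto
  have mH: "H \<in> borel_measurable (lebesgue_on {0..T})"
    unfolding H_def using mv G(1) by measurable
  have bH: "norm (H t) \<le> \<bar>?p\<bar> * V + \<bar>of_int k\<bar> * B" if "t \<in> {0..T}" for t
  proof -
    have "norm (H t) \<le> norm (\<i> * complex_of_real ?p * v t) + norm (\<i> * of_int k * G t)"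
      unfolding H_def by (rule norm_triangle_ineq4)
    also have "\<dots> = \<bar>?p\<bar> * norm (v t) + \<bar>of_int k\<bar> * norm (G t)"
      by (simp add: norm_mult)
    also have "\<dots> \<le> \<bar>?p\<bar> * V + \<bar>of_int k\<bar> * B"
      using V[OF that] G(2)[OF that] by (intro add_mono mult_left_mono) auto
    finally show ?thesis .
  qed
  have vH: "bounded_primitive 0 T v H"
  proof (rule weak_derivative_bounded_primitive[OF chi cv mH bH])
    fix E :: "nat \<Rightarrow> real \<Rightarrow> real" and t\<^sub>0 t\<^sub>1
    assume E: "\<And>j r. (E j has_real_derivative E (Suc j) r) (at r)" and supp: "0 < t\<^sub>0" "t\<^sub>1 < T"
      "\<And>r. r \<notin> {t\<^sub>0..t\<^sub>1} \<Longrightarrow> E 0 r = 0"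
    let ?h = "\<lambda>t. v t * complex_of_real (E 1 t) + H t * complex_of_real (E 0 t)"
    have cE: "continuous_on S (E j)" for S j
      using E by (intro continuous_at_imp_continuous_on ballI DERIV_isCont) blast
    have mE: "(\<lambda>t. complex_of_real (E j t)) \<in> borel_measurable (lebesgue_on {0..T})" for j
      by (intro continuous_on_measurable_lebesgue_on continuous_intros cE)
    have mh: "?h \<in> borel_measurable (lebesgue_on {0..T})"
      using mv mH mE[of 0] mE[of 1] by measurable
    have "\<exists>C. \<forall>t\<in>{0..T}. \<bar>E j t\<bar> \<le> C" for j
    proof -
      have "bounded (E j ` {0..T})" by (intro compact_imp_bounded compact_continuous_image compact_Icc cE)
      then show ?thesis unfolding bounded_iff real_norm_def by blast
    qed
    then obtain C where C: "\<And>j t. t \<in> {0..T} \<Longrightarrow> \<bar>E j t\<bar> \<le> C j" by metis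
    let ?H = "\<bar>?p\<bar> * V + \<bar>of_int k\<bar> * B"
    have bh: "norm (?h t) \<le> V * C 1 + ?H * C 0" if t: "t \<in> {0..T}" for t
    proof -
      have "norm (?h t) \<le> norm (v t) * \<bar>E 1 t\<bar> + norm (H t) * \<bar>E 0 t\<bar>"
        using norm_triangle_ineq[of "v t * complex_of_real (E 1 t)" "H t * complex_of_real (E 0 t)"]
        by (simp add: norm_mult)
      also have "\<dots> \<le> V * C 1 + ?H * C 0"
        using V[OF t] bH[OF t] C[OF t] order_trans[OF norm_ge_zero V[OF t]] order_trans[OF norm_ge_zero bH[OF t]]
        by (intro add_mono mult_mono) auto
      finally show ?thesis .
    qed
    let ?M = "lebesgue_on {0<..<T}"
    let ?g = "\<lambda>t. fourier (u t) k * complex_of_real (E 1 t)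
      + (\<i> * complex_of_real ?p * fourier (u t) k - \<i> * of_int k * fourier (f t) k) * complex_of_real (E 0 t)"
    have rest: "w \<in> borel_measurable ?M" if "w \<in> borel_measurable (lebesgue_on {0..T})" for w :: "real \<Rightarrow> complex"
      by (rule measurable_restrict_mono[OF that sub])
    have "integral {0..T} ?h = (LINT t|?M. ?h t)"
      by (rule bounded_integral_open_interval[OF mh bh, symmetric])
    also have "\<dots> = (LINT t|?M. ?g t)"
    proof (rule integral_cong_AE)
      show "?h \<in> borel_measurable ?M" by (rule rest[OF mh])
      show "?g \<in> borel_measurable ?M"
        using rest[OF mv] rest[OF mE[of 0]] rest[OF mE[of 1]] Linf_L2_fourier_measurable[OF f, of k]
        unfolding v_def by measurable
      show "AE t in ?M. ?h t = ?g t"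
        using ae by eventually_elim (simp add: H_def v_def)
    qed
    also have "\<dots> = 0"
      by (rule weak_solution_mode[OF weak _ _ E supp])
        (use u f in \<open>auto simp: continuous_L2_def Linf_L2_def\<close>)
    finally show "integral {0..T} ?h = 0" .
  qed
  have cc: "bounded_primitive 0 T (\<lambda>t. cis (- (?p * t))) (\<lambda>t. - \<i> * complex_of_real ?p * cis (- (?p * t)))"
  proof (rule bounded_primitive_C1)
    show "((\<lambda>t. cis (- (?p * t))) has_vector_derivative - \<i> * complex_of_real ?p * cis (- (?p * t))) (at t within {0..T})" for t
    proof -
      have "((\<lambda>t. cis (- (?p * t))) has_vector_derivative (- ?p) *\<^sub>R (\<i> * cis (- (?p * t)))) (at t within {0..T})"
        unfolding has_vector_derivative_def
        by (auto intro!: derivative_eq_intros simp: algebra_simps scaleR_conv_of_real)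
      then show ?thesis by (simp add: scaleR_conv_of_real mult_ac)
    qed
  qed (intro continuous_intros)
  have "(\<lambda>t. - \<i> * complex_of_real ?p * cis (- (?p * t)) * v t + cis (- (?p * t)) * H t)
      = (\<lambda>t. cis (- (?p * t)) * (- \<i> * of_int k * G t))"
    by (simp add: H_def algebra_simps)
  with bounded_primitive_mult[OF cc vH] show ?thesis
    by (simp add: v_def)
qed

section \<open>Frequency-localised solutions\<close>

text \<open>The set where the bound fails is open by continuity and null by hypothesis, hence empty;
  the endpoints follow by closure. Thus the essential supremum of a continuous solution bounds it at
  every time.\<close>

lemma continuous_AE_le:
  fixes h :: "real \<Rightarrow> real"
  assumes T: "0 < T" and h: "continuous_on {0..T} h" and ae: "AE t in lebesgue_on {0<..<T}. h t \<le> L"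
    and t: "t \<in> {0..T}"
  shows "h t \<le> L"
proof -
  let ?S = "{0<..<T} \<inter> h -` {L<..}"
  have "continuous_on {0<..<T} h" using h by (rule continuous_on_subset) auto
  then have op: "open ?S" by (rule continuous_open_preimage) auto
  have "AE t in lebesgue. t \<in> {0<..<T} \<longrightarrow> h t \<le> L"
    using ae by (subst (asm) AE_restrict_space_iff) auto
  then have "{t \<in> space lebesgue. \<not> (t \<in> {0<..<T} \<longrightarrow> h t \<le> L)} \<in> null_sets lebesgue"
    by (simp only: completion.AE_iff_null_sets)
  also have "{t \<in> space lebesgue. \<not> (t \<in> {0<..<T} \<longrightarrow> h t \<le> L)} = ?S" by auto
  finally have neg: "negligible ?S" by (simp add: negligible_iff_null_sets)
  have "?S = {}"
  proof (rule ccontr)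
    assume "?S \<noteq> {}"
    then obtain s where "s \<in> ?S" by blast
    then obtain e where e: "0 < e" "ball s e \<subseteq> ?S" using op openE by blast
    have "negligible (box (s - e) (s + e))"
      using negligible_subset[OF neg e(2)] by (simp add: ball_eq_greaterThanLessThan)
    then have "box (s - e) (s + e) = {}" by (simp only: negligible_interval)
    then show False using e(1) by simp
  qed
  then have "h s \<le> L" if "s \<in> {0<..<T}" for s using that by force
  then show ?thesis
    using continuous_le_on_closure[of "{0<..<T}" h t L] T t h by simp
qed

text \<open>\<open>real_of_ereal\<close> would send an infinite essential supremum to 0. The bound B
  rules out the value \<infinity>, and the positive measure of ]0, T[ rules out negative
  values.\<close>

lemma Linf_time_norm_bound:
  assumes T: "0 < T" and m: "(\<lambda>t. L2_norm (w t)) \<in> borel_measurable (lebesgue_on {0<..<T})"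
    and B: "AE t in lebesgue_on {0<..<T}. L2_norm (w t) \<le> B"
  shows "AE t in lebesgue_on {0<..<T}. L2_norm (w t) \<le> Linf_time_norm T w" "0 \<le> Linf_time_norm T w"
proof -
  let ?M = "lebesgue_on {0<..<T}" and ?f = "\<lambda>t. ereal (L2_norm (w t))"
  have mf: "?f \<in> borel_measurable ?M" using m by measurable
  have up: "esssup ?M ?f \<le> ereal B" by (rule esssup_I[OF mf]) (use B in simp)
  have "emeasure ?M (space ?M) \<noteq> 0" using T by (simp add: emeasure_restrict_space)
  then have "0 = esssup ?M (\<lambda>_. 0 :: ereal)" by (simp add: esssup_const)
  also have "\<dots> \<le> esssup ?M ?f" by (rule esssup_mono) (auto simp: L2_norm_def)
  finally have lo: "0 \<le> esssup ?M ?f" .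
  obtain r where r: "esssup ?M ?f = ereal r" using up lo by (cases "esssup ?M ?f") auto
  then have e: "Linf_time_norm T w = r" by (simp add: Linf_time_norm_def)
  show "0 \<le> Linf_time_norm T w" using lo r e by simp
  show "AE t in ?M. L2_norm (w t) \<le> Linf_time_norm T w"
    using esssup_AE[of ?f ?M] unfolding e r by simp
qed

section \<open>Frequency blocks and their Parseval identities\<close>

lemma dyadic_shell_finite:
  assumes "N \<in> dyadic"
  shows "finite (dyadic_shell N)" "real (card (dyadic_shell N)) \<le> 5 * N" "1 \<le> N"
proof -
  obtain l :: nat where N: "N = 2 ^ l" using assms by (auto simp: dyadic_def)
  let ?n = "2 ^ l :: int"
  have sub: "dyadic_shell N \<subseteq> {- 2 * ?n..2 * ?n}"
  proof
    fix k assume "k \<in> dyadic_shell N"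
    then have "\<bar>real_of_int k\<bar> \<le> real_of_int (2 * ?n)" by (simp add: dyadic_shell_def N)
    then have "\<bar>k\<bar> \<le> 2 * ?n" by linarith
    then show "k \<in> {- 2 * ?n..2 * ?n}" by auto
  qed
  show "finite (dyadic_shell N)" using sub finite_subset by blast
  show N1: "1 \<le> N" by (simp add: N)
  have "card (dyadic_shell N) \<le> card {- 2 * ?n..2 * ?n}" by (rule card_mono[OF _ sub]) simp
  also have "\<dots> = nat (4 * ?n + 1)" by simp
  finally have "real (card (dyadic_shell N)) \<le> real (nat (4 * ?n + 1))" by (rule of_nat_mono)
  also have "\<dots> = 4 * N + 1" by (simp add: N)
  finally show "real (card (dyadic_shell N)) \<le> 5 * N" using N1 by linarith
qed

text \<open>Below N / 2 both cutoffs equal 1 and cancel; above 2 N both vanish.\<close>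

lemma freq_block_support:
  assumes chi: "freq_cutoff chi" and N: "0 < N" and k: "k \<notin> dyadic_shell N"
  shows "freq_block chi N (of_int k) = 0"
proof -
  define y where "y = real_of_int k / N"
  have one: "chi x = 1" if "\<bar>x\<bar> \<le> 1" for x
    using chi that by (auto simp: freq_cutoff_def abs_le_iff)
  have supp: "chi x = 0" if "2 < \<bar>x\<bar>" for x
  proof (rule ccontr)
    assume "chi x \<noteq> 0"
    then have "x \<in> {-2..2}" using chi closure_subset[of "{x. chi x \<noteq> 0}"] by (auto simp: freq_cutoff_def)
    then show False using that by auto
  qed
  have y: "\<bar>y\<bar> = \<bar>real_of_int k\<bar> / N" using N by (simp add: y_def)
  have "\<bar>real_of_int k\<bar> < N / 2 \<or> 2 * N < \<bar>real_of_int k\<bar>"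
    using k by (auto simp: dyadic_shell_def)
  then have "\<bar>y\<bar> \<le> 1 / 2 \<or> 2 < \<bar>y\<bar>"
    unfolding y using N by (auto simp: field_simps)
  then consider "\<bar>y\<bar> \<le> 1 / 2" | "2 < \<bar>y\<bar>" by blast
  then show ?thesis
  proof cases
    case 1
    then show ?thesis using one[of y] one[of "2 * y"] by (simp add: freq_block_def y_def[symmetric] abs_mult)
  next
    case 2
    then show ?thesis using supp[of y] supp[of "2 * y"] by (simp add: freq_block_def y_def[symmetric] abs_mult)
  qed
qed

lemma fourier_freq_proj:
  assumes chi: "freq_cutoff chi" and N: "N \<in> dyadic"
  shows "fourier (freq_proj chi N g) k = complex_of_real (freq_block chi N (of_int k)) * fourier g k"
proof -
  have "{k. complex_of_real (freq_block chi N (of_int k)) * fourier g k \<noteq> 0} \<subseteq> dyadic_shell N"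
    using freq_block_support[OF chi, of N] dyadic_shell_finite(3)[OF N] by force
  then show ?thesis
    unfolding freq_proj_def fourier_multiplier_def
    by (intro fourier_fourier_series finite_subset[OF _ dyadic_shell_finite(1)[OF N]])
qed

lemma L2_norm_freq_proj:
  assumes chi: "freq_cutoff chi" and N: "N \<in> dyadic"
  shows "(L2_norm (freq_proj chi N g))\<^sup>2 = 2 * pi * (\<Sum>k\<in>dyadic_shell N. (norm (fourier (freq_proj chi N g) k))\<^sup>2)"
  unfolding fourier_freq_proj[OF chi N]
  unfolding freq_proj_def fourier_multiplier_def
  by (rule L2_norm_fourier_series[OF dyadic_shell_finite(1)[OF N]])
     (use freq_block_support[OF chi, of N] dyadic_shell_finite(3)[OF N] in force)

text \<open>Each factor has only finitely many nonzero coefficients, so the convolution sum reduces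
  to pairs from the two finite sets, and Parseval applies over the finite set of outputs.\<close>

lemma L2_norm_bilinear_mult:
  assumes fin: "finite K\<^sub>1" "finite K\<^sub>2"
    and u: "\<And>k. k \<notin> K\<^sub>1 \<Longrightarrow> fourier u k = 0" and v: "\<And>k. k \<notin> K\<^sub>2 \<Longrightarrow> fourier v k = 0"
  shows "(L2_norm (bilinear_mult a u v))\<^sup>2 = 2 * pi * (\<Sum>\<xi>\<in>(\<lambda>(k, m). k + m) ` (K\<^sub>1 \<times> K\<^sub>2).
    (norm (\<Sum>k\<in>{k\<in>K\<^sub>1. \<xi> - k \<in> K\<^sub>2}. a (of_int k, of_int (\<xi> - k)) * fourier u k * fourier v (\<xi> - k)))\<^sup>2)"
proof -
  have inner: "(\<Sum>\<^sub>\<infinity>\<xi>\<^sub>1\<in>UNIV. a (of_int \<xi>\<^sub>1, of_int (\<xi> - \<xi>\<^sub>1)) * fourier u \<xi>\<^sub>1 * fourier v (\<xi> - \<xi>\<^sub>1))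
    = (\<Sum>k\<in>{k\<in>K\<^sub>1. \<xi> - k \<in> K\<^sub>2}. a (of_int k, of_int (\<xi> - k)) * fourier u k * fourier v (\<xi> - k))" for \<xi>
  proof -
    have "(\<Sum>\<^sub>\<infinity>\<xi>\<^sub>1\<in>UNIV. a (of_int \<xi>\<^sub>1, of_int (\<xi> - \<xi>\<^sub>1)) * fourier u \<xi>\<^sub>1 * fourier v (\<xi> - \<xi>\<^sub>1))
      = (\<Sum>\<^sub>\<infinity>\<xi>\<^sub>1\<in>{k\<in>K\<^sub>1. \<xi> - k \<in> K\<^sub>2}. a (of_int \<xi>\<^sub>1, of_int (\<xi> - \<xi>\<^sub>1)) * fourier u \<xi>\<^sub>1 * fourier v (\<xi> - \<xi>\<^sub>1))"
      by (rule infsum_cong_neutral) (use u v in auto)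
    then show ?thesis using fin by simp
  qed
  show ?thesis
    unfolding bilinear_mult_def inner
  proof (rule L2_norm_fourier_series)
    fix \<xi> assume \<xi>: "\<xi> \<notin> (\<lambda>(k, m). k + m) ` (K\<^sub>1 \<times> K\<^sub>2)"
    have "{k \<in> K\<^sub>1. \<xi> - k \<in> K\<^sub>2} = {}"
    proof (rule ccontr)
      assume "{k \<in> K\<^sub>1. \<xi> - k \<in> K\<^sub>2} \<noteq> {}"
      then obtain k where "k \<in> K\<^sub>1" "\<xi> - k \<in> K\<^sub>2" by blast
      then have "\<xi> \<in> (\<lambda>(k, m). k + m) ` (K\<^sub>1 \<times> K\<^sub>2)" by (intro image_eqI[of _ _ "(k, \<xi> - k)"]) auto
      then show False using \<xi> by simp
    qed
    then show "(\<Sum>k\<in>{k\<in>K\<^sub>1. \<xi> - k \<in> K\<^sub>2}. a (of_int k, of_int (\<xi> - k)) * fourier u k * fourier v (\<xi> - k)) = 0"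
      by (simp only: sum.empty)
  qed (use fin in auto)
qed

section \<open>Time norms of one localised solution and its forcing\<close>

lemma L2_time_norm_power2:
  "(L2_time_norm T w)\<^sup>2 = (LINT t|lebesgue_on {0<..<T}. (L2_norm (w t))\<^sup>2)"
  unfolding L2_time_norm_def by simp

lemma L2_norm_nonneg: "0 \<le> L2_norm g"
  unfolding L2_norm_def by simp

lemma L2_time_norm_nonneg: "0 \<le> L2_time_norm T w"
  unfolding L2_time_norm_def by simp

text \<open>By Parseval the block norm is a finite expression in single coefficients, which gives
  its measurability and essential boundedness. The bound B concerns the unprojected f and is uniform
  in k; it will serve as a truncation level.\<close>

lemma localized_forcing:
  assumes chi: "freq_cutoff chi" and T: "0 < T" and N: "N \<in> dyadic" and f: "Linf_L2 T f"
  obtains B where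
    "(\<lambda>t. L2_norm (freq_proj chi N (f t))) \<in> borel_measurable (lebesgue_on {0<..<T})"
    "AE t in lebesgue_on {0<..<T}. L2_norm (freq_proj chi N (f t)) \<le> Linf_time_norm T (\<lambda>t. freq_proj chi N (f t))"
    "0 \<le> Linf_time_norm T (\<lambda>t. freq_proj chi N (f t))"
    "integrable (lebesgue_on {0<..<T}) (\<lambda>t. (L2_norm (freq_proj chi N (f t)))\<^sup>2)"
    "AE t in lebesgue_on {0<..<T}. \<forall>k. norm (fourier (f t) k) \<le> B"
proof -
  let ?M = "lebesgue_on {0<..<T}" and ?g = "\<lambda>t. L2_norm (freq_proj chi N (f t))"
  note mf = Linf_L2_fourier_measurable[OF f]
  have sq: "?g t = sqrt (2 * pi * (\<Sum>k\<in>dyadic_shell N. (norm (complex_of_real (freq_block chi N (of_int k)) * fourier (f t) k))\<^sup>2))" for t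
  proof -
    have "?g t = sqrt ((?g t)\<^sup>2)" by (simp add: L2_norm_def)
    then show ?thesis unfolding L2_norm_freq_proj[OF chi N] fourier_freq_proj[OF chi N] .
  qed
  have mg: "?g \<in> borel_measurable ?M"
    unfolding sq using mf by measurable
  obtain B where B: "AE t in ?M. L2_norm (f t) \<le> B"
    using f unfolding Linf_L2_def by blast
  have fB: "AE t in ?M. \<forall>k. norm (fourier (f t) k) \<le> B"
    using B AE_space
  proof eventually_elim
    case (elim t)
    then have "f t \<in> L2_torus" using f by (auto simp: Linf_L2_def)
    then show ?case using elim(1) norm_fourier_le order_trans by blast
  qed
  define C where "C = sqrt (2 * pi * (\<Sum>k\<in>dyadic_shell N. (\<bar>freq_block chi N (of_int k)\<bar> * B)\<^sup>2))"
  have gC: "AE t in ?M. ?g t \<le> C"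
    using fB
  proof eventually_elim
    case (elim t)
    show ?case
      unfolding sq C_def using elim
      by (intro real_sqrt_le_mono mult_left_mono sum_mono power_mono) (auto simp: norm_mult intro: mult_left_mono)
  qed
  have fin: "finite_measure ?M" by (rule finite_measure_lebesgue_on) auto
  have ig: "integrable ?M (\<lambda>t. (?g t)\<^sup>2)"
  proof (rule finite_measure.integrable_const_bound[OF fin, of _ "C\<^sup>2"])
    show "AE t in ?M. norm ((?g t)\<^sup>2) \<le> C\<^sup>2"
      using gC
    proof eventually_elim
      case (elim t)
      then have "(?g t)\<^sup>2 \<le> C\<^sup>2" by (intro power_mono L2_norm_nonneg)
      then show ?case by simp
    qed
  qed (use mg in measurable)
  show ?thesis
    by (rule that[OF mg Linf_time_norm_bound(1)[OF T mg gC] Linf_time_norm_bound(2)[OF T mg gC] ig fB])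
qed

text \<open>Collects what the sieve needs from either factor: bounds at every time for the one taken
  out in the supremum, integrals for the one kept in L^2. For x the integral is an exact Parseval
  identity; for x' there is only an inequality, since |k| is replaced by 2 N and the forcing is
  truncated.\<close>

lemma localized_solution:
  assumes chi: "freq_cutoff chi" and T: "0 < T" and N: "N \<in> dyadic"
    and u: "continuous_L2 T u" and f: "Linf_L2 T f" and weak: "weak_solution T p u f"
  defines "Lu \<equiv> Linf_time_norm T (\<lambda>t. freq_proj chi N (u t))"
    and "Lf \<equiv> Linf_time_norm T (\<lambda>t. freq_proj chi N (f t))"
  obtains x x' where
    "\<And>k. bounded_primitive 0 T (x k) (x' k)"
    "\<And>k t. x k t = cis (- (p (of_int k) * t)) * fourier (freq_proj chi N (u t)) k"
    "\<And>t. t \<in> {0..T} \<Longrightarrow> 2 * pi * (\<Sum>k\<in>dyadic_shell N. (norm (x k t))\<^sup>2) \<le> Lu\<^sup>2"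
    "\<And>t. t \<in> {0..T} \<Longrightarrow> 2 * pi * (\<Sum>k\<in>dyadic_shell N. (norm (x' k t))\<^sup>2) \<le> (2 * N)\<^sup>2 * Lf\<^sup>2"
    "2 * pi * integral {0..T} (\<lambda>t. \<Sum>k\<in>dyadic_shell N. (norm (x k t))\<^sup>2)
      = (L2_time_norm T (\<lambda>t. freq_proj chi N (u t)))\<^sup>2"
    "2 * pi * integral {0..T} (\<lambda>t. \<Sum>k\<in>dyadic_shell N. (norm (x' k t))\<^sup>2)
      \<le> (2 * N)\<^sup>2 * (L2_time_norm T (\<lambda>t. freq_proj chi N (f t)))\<^sup>2"
    "0 \<le> Lu" "0 \<le> Lf"
proof -
  let ?M = "lebesgue_on {0<..<T}" and ?K = "dyadic_shell N"
  have finK: "finite ?K" and N1: "1 \<le> N" using dyadic_shell_finite[OF N] by auto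
  have sub: "{0<..<T} \<subseteq> {0..T}" by auto
  define b where "b = (\<lambda>k. complex_of_real (freq_block chi N (of_int k)))"
  have coef: "fourier (freq_proj chi N g) k = b k * fourier g k" for g k
    unfolding b_def by (rule fourier_freq_proj[OF chi N])
  obtain B where mg: "(\<lambda>t. L2_norm (freq_proj chi N (f t))) \<in> borel_measurable ?M"
    and gL: "AE t in ?M. L2_norm (freq_proj chi N (f t)) \<le> Lf" and Lf: "0 \<le> Lf"
    and ig: "integrable ?M (\<lambda>t. (L2_norm (freq_proj chi N (f t)))\<^sup>2)"
    and fB: "AE t in ?M. \<forall>k. norm (fourier (f t) k) \<le> B"
    using localized_forcing[OF chi T N f] unfolding Lf_def by metis
  \<comment> \<open>The truncation turns the bounds on \<open>f\<close>, valid almost everywhere, into bounds at every time.\<close>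
  define G where "G = (\<lambda>k t. if t \<in> {0<..<T} then
    (if L2_norm (freq_proj chi N (f t)) \<le> Lf \<and> norm (fourier (f t) k) \<le> B then fourier (f t) k else 0) else 0)"
  have mG: "G k \<in> borel_measurable (lebesgue_on {0..T})" for k
  proof -
    have "(\<lambda>t. if L2_norm (freq_proj chi N (f t)) \<le> Lf \<and> norm (fourier (f t) k) \<le> B then fourier (f t) k else 0) \<in> borel_measurable ?M"
      using mg Linf_L2_fourier_measurable[OF f, of k] by measurable
    then show ?thesis
      unfolding G_def by (subst borel_measurable_if_lebesgue_on) auto
  qed
  have bG: "norm (G k t) \<le> max B 0" for k t by (auto simp: G_def)
  have aeG: "AE t in ?M. G k t = fourier (f t) k" for k
    using gL fB AE_space by eventually_elim (auto simp: G_def)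
  define x where "x = (\<lambda>k t. b k * (cis (- (p (of_int k) * t)) * fourier (u t) k))"
  define x' where "x' = (\<lambda>k t. b k * (cis (- (p (of_int k) * t)) * (- \<i> * of_int k * G k t)))"
  have prim: "bounded_primitive 0 T (x k) (x' k)" for k
    unfolding x_def x'_def
    by (rule bounded_primitive_cmult[OF solution_mode_primitive[OF chi T u f weak mG bG aeG]])
  have xeq: "x k t = cis (- (p (of_int k) * t)) * fourier (freq_proj chi N (u t)) k" for k t
    by (simp add: x_def coef)
  have xsq: "2 * pi * (\<Sum>k\<in>?K. (norm (x k t))\<^sup>2) = (L2_norm (freq_proj chi N (u t)))\<^sup>2" for t
    unfolding L2_norm_freq_proj[OF chi N] by (simp add: xeq norm_mult)
  have cx: "continuous_on {0..T} (x k)" for k by (rule bounded_primitive_continuous[OF prim])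
  have cu: "continuous_on {0..T} (\<lambda>t. L2_norm (freq_proj chi N (u t)))"
  proof -
    have "(\<lambda>t. L2_norm (freq_proj chi N (u t))) = (\<lambda>t. sqrt (2 * pi * (\<Sum>k\<in>?K. (norm (x k t))\<^sup>2)))"
      unfolding xsq by (simp add: L2_norm_def)
    then show ?thesis by (simp only:) (intro continuous_intros cx)
  qed
  have mu: "(\<lambda>t. L2_norm (freq_proj chi N (u t))) \<in> borel_measurable ?M"
    by (rule measurable_restrict_mono[OF continuous_on_measurable_lebesgue_on[OF cu] sub])
  have "bounded ((\<lambda>t. L2_norm (freq_proj chi N (u t))) ` {0..T})"
    by (intro compact_imp_bounded compact_continuous_image compact_Icc cu)
  then obtain Bu where Bu: "\<And>t. t \<in> {0..T} \<Longrightarrow> \<bar>L2_norm (freq_proj chi N (u t))\<bar> \<le> Bu"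
    unfolding bounded_iff real_norm_def by blast
  have aeu: "AE t in ?M. L2_norm (freq_proj chi N (u t)) \<le> Bu"
    using Bu by (intro AE_I2) (auto simp: abs_le_iff)
  note Lu = Linf_time_norm_bound[OF T mu aeu, folded Lu_def]
  have ule: "L2_norm (freq_proj chi N (u t)) \<le> Lu" if "t \<in> {0..T}" for t
    by (rule continuous_AE_le[OF T cu Lu(1) that])
  have x'le: "2 * pi * (\<Sum>k\<in>?K. (norm (x' k t))\<^sup>2) \<le> (2 * N)\<^sup>2 * (2 * pi * (\<Sum>k\<in>?K. (norm (b k * G k t))\<^sup>2))" for t
  proof -
    have "(\<Sum>k\<in>?K. (norm (x' k t))\<^sup>2) \<le> (\<Sum>k\<in>?K. (2 * N)\<^sup>2 * (norm (b k * G k t))\<^sup>2)"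
    proof (rule sum_mono)
      fix k assume "k \<in> ?K"
      then have k: "\<bar>real_of_int k\<bar> \<le> 2 * N" by (simp add: dyadic_shell_def)
      have "norm (x' k t) = \<bar>real_of_int k\<bar> * norm (b k * G k t)"
        by (simp add: x'_def norm_mult)
      also have "\<dots> \<le> (2 * N) * norm (b k * G k t)" by (rule mult_right_mono[OF k]) simp
      finally have "(norm (x' k t))\<^sup>2 \<le> ((2 * N) * norm (b k * G k t))\<^sup>2" by (intro power_mono) auto
      then show "(norm (x' k t))\<^sup>2 \<le> (2 * N)\<^sup>2 * (norm (b k * G k t))\<^sup>2" by (simp only: power_mult_distrib)
    qed
    then show ?thesis by (simp add: sum_distrib_left[symmetric] mult_ac)
  qed
  have Gf: "2 * pi * (\<Sum>k\<in>?K. (norm (b k * G k t))\<^sup>2) \<le> (L2_norm (freq_proj chi N (f t)))\<^sup>2" for t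
    unfolding L2_norm_freq_proj[OF chi N] coef
    by (intro mult_left_mono sum_mono power_mono) (auto simp: G_def)
  \<comment> \<open>The truncation by the block norm does not depend on k. At a time where that norm
    exceeds \<open>Lf\<close>, all coefficients vanish together, so the sum over the shell obeys the
    bound too.\<close>
  have GL: "2 * pi * (\<Sum>k\<in>?K. (norm (b k * G k t))\<^sup>2) \<le> Lf\<^sup>2" for t
  proof (cases "t \<in> {0<..<T} \<and> L2_norm (freq_proj chi N (f t)) \<le> Lf")
    case True
    then have "(L2_norm (freq_proj chi N (f t)))\<^sup>2 \<le> Lf\<^sup>2" by (intro power_mono) (auto simp: L2_norm_def)
    then show ?thesis using Gf[of t] by linarith
  next
    case False
    then have "G k t = 0" for k by (auto simp: G_def)
    then show ?thesis by simp
  qed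
  have ix: "(\<lambda>t. (L2_norm (freq_proj chi N (u t)))\<^sup>2) \<in> borel_measurable (lebesgue_on {0..T})"
    by (intro continuous_on_measurable_lebesgue_on continuous_intros cu)
  have bx: "norm ((L2_norm (freq_proj chi N (u t)))\<^sup>2) \<le> Bu\<^sup>2" if "t \<in> {0..T}" for t
    using power_mono[OF Bu[OF that], of 2] by simp
  have intu: "2 * pi * integral {0..T} (\<lambda>t. \<Sum>k\<in>?K. (norm (x k t))\<^sup>2) = (L2_time_norm T (\<lambda>t. freq_proj chi N (u t)))\<^sup>2"
  proof -
    have "2 * pi * integral {0..T} (\<lambda>t. \<Sum>k\<in>?K. (norm (x k t))\<^sup>2) = integral {0..T} (\<lambda>t. (L2_norm (freq_proj chi N (u t)))\<^sup>2)"
      unfolding xsq[symmetric] by simp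
    also have "\<dots> = (LINT t|?M. (L2_norm (freq_proj chi N (u t)))\<^sup>2)"
      by (rule bounded_integral_open_interval[OF ix bx, symmetric])
    finally show ?thesis by (simp only: L2_time_norm_power2)
  qed
  have intf: "2 * pi * integral {0..T} (\<lambda>t. \<Sum>k\<in>?K. (norm (x' k t))\<^sup>2) \<le> (2 * N)\<^sup>2 * (L2_time_norm T (\<lambda>t. freq_proj chi N (f t)))\<^sup>2"
  proof -
    define h where "h = (\<lambda>t. \<Sum>k\<in>?K. (norm (x' k t))\<^sup>2)"
    have mx': "x' k \<in> borel_measurable (lebesgue_on {0..T})" for k
      using prim[of k] by (simp add: bounded_primitive_def)
    have mh: "h \<in> borel_measurable (lebesgue_on {0..T})"
      unfolding h_def using mx' by measurable
    have hle: "2 * pi * h t \<le> (2 * N)\<^sup>2 * (2 * pi * (\<Sum>k\<in>?K. (norm (b k * G k t))\<^sup>2))" for t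
      unfolding h_def by (rule x'le)
    have hL: "2 * pi * h t \<le> (2 * N)\<^sup>2 * Lf\<^sup>2" for t
      by (rule order_trans[OF hle mult_left_mono[OF GL]]) simp
    have h0: "0 \<le> h t" for t unfolding h_def by (simp add: sum_nonneg)
    have bh: "norm (h t) \<le> (2 * N)\<^sup>2 * Lf\<^sup>2" for t
    proof -
      have "1 * h t \<le> 2 * pi * h t" using pi_gt3 h0 by (intro mult_right_mono) auto
      then have "h t \<le> (2 * N)\<^sup>2 * Lf\<^sup>2" using hL[of t] by linarith
      then show ?thesis using h0[of t] by simp
    qed
    have fin: "finite_measure ?M" by (rule finite_measure_lebesgue_on) auto
    have ihM: "integrable ?M h"
      by (rule finite_measure.integrable_const_bound[OF fin, of _ "(2 * N)\<^sup>2 * Lf\<^sup>2"])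
        (use bh measurable_restrict_mono[OF mh sub] in auto)
    have "2 * pi * integral {0..T} h = (LINT t|?M. 2 * pi * h t)"
      using bounded_integral_open_interval[OF mh bh] by simp
    also have "\<dots> \<le> (LINT t|?M. (2 * N)\<^sup>2 * (L2_norm (freq_proj chi N (f t)))\<^sup>2)"
      by (intro integral_mono integrable_mult_right ihM ig order_trans[OF hle mult_left_mono[OF Gf]]) simp
    also have "\<dots> = (2 * N)\<^sup>2 * (L2_time_norm T (\<lambda>t. freq_proj chi N (f t)))\<^sup>2"
      unfolding L2_time_norm_power2 by simp
    finally show ?thesis by (simp only: h_def)
  qed
  show ?thesis
  proof (rule that[of x x'])
    show "2 * pi * (\<Sum>k\<in>?K. (norm (x k t))\<^sup>2) \<le> Lu\<^sup>2" if "t \<in> {0..T}" for t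
      unfolding xsq using ule[OF that] by (intro power_mono) (auto simp: L2_norm_def)
    show "2 * pi * (\<Sum>k\<in>?K. (norm (x' k t))\<^sup>2) \<le> (2 * N)\<^sup>2 * Lf\<^sup>2" for t
      by (rule order_trans[OF x'le mult_left_mono[OF GL]]) simp
  qed (use prim xeq intu intf Lu Lf in auto)
qed

section \<open>The bilinear estimate\<close>

text \<open>Both hypotheses bound S^2 by Q times the minimum of 1 / T and m, and a minimum lies
  below every weighted geometric mean, here (1 / T)^(1 - \<theta>) * m^\<theta>.\<close>

lemma le_interpolated:
  fixes S Q T m \<theta> :: real
  assumes "S\<^sup>2 \<le> Q / T" "S\<^sup>2 \<le> Q * m" "0 \<le> Q" "0 < T" "0 < m" "0 \<le> \<theta>" "\<theta> \<le> 1"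
  shows "S \<le> sqrt Q * T powr ((\<theta> - 1) / 2) * m powr (\<theta> / 2)"
proof -
  have "min (1 / T) m \<le> T powr (\<theta> - 1) * m powr \<theta>"
  proof -
    let ?q = "min (1 / T) m"
    have q: "0 < ?q" using assms by simp
    have "?q = ?q powr (1 - \<theta>) * ?q powr \<theta>" using q by (simp add: powr_add[symmetric])
    also have "\<dots> \<le> (1 / T) powr (1 - \<theta>) * m powr \<theta>"
      using assms q by (intro mult_mono powr_mono2) auto
    also have "(1 / T) powr (1 - \<theta>) = T powr (\<theta> - 1)"
      using assms by (simp add: powr_divide powr_minus_divide[symmetric])
    finally show ?thesis .
  qed
  moreover have "S\<^sup>2 \<le> Q * min (1 / T) m" using assms by (simp add: min_def)
  ultimately have "S\<^sup>2 \<le> Q * (T powr (\<theta> - 1) * m powr \<theta>)"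
    using assms(3) mult_left_mono order_trans by blast
  also have "\<dots> = (sqrt Q * T powr ((\<theta> - 1) / 2) * m powr (\<theta> / 2))\<^sup>2"
  proof -
    have "(x powr (e / 2))\<^sup>2 = x powr e" for x e :: real
      by (simp add: power2_eq_square powr_add[symmetric])
    then show ?thesis using assms by (simp only: power_mult_distrib real_sqrt_pow2 mult.assoc)
  qed
  finally show ?thesis
    by (rule power2_le_imp_le) (use assms in auto)
qed

text \<open>Cauchy-Schwarz for each output: k and \<xi> - k determine each other, so the number of
  interacting pairs is at most the cardinality of either set, and the smaller one may be
  used.\<close>

lemma bilinear_pointwise:
  fixes K\<^sub>1 K\<^sub>2 :: "int set" and a :: "int \<Rightarrow> int \<Rightarrow> complex" and U V :: "int \<Rightarrow> complex"
  assumes fin: "finite K\<^sub>1" "finite K\<^sub>2" and a: "\<And>k m. norm (a k m) \<le> A"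
    and c: "real (card K\<^sub>1) \<le> c \<or> real (card K\<^sub>2) \<le> c"
  shows "(\<Sum>\<xi>\<in>(\<lambda>(k, m). k + m) ` (K\<^sub>1 \<times> K\<^sub>2).
      (norm (\<Sum>k\<in>{k\<in>K\<^sub>1. \<xi> - k \<in> K\<^sub>2}. a k (\<xi> - k) * U k * V (\<xi> - k)))\<^sup>2)
    \<le> c * A\<^sup>2 * ((\<Sum>k\<in>K\<^sub>1. (norm (U k))\<^sup>2) * (\<Sum>m\<in>K\<^sub>2. (norm (V m))\<^sup>2))"
proof -
  define J where "J = (\<lambda>\<xi>. {k\<in>K\<^sub>1. \<xi> - k \<in> K\<^sub>2})"
  have finJ: "finite (J \<xi>)" for \<xi> using fin by (simp add: J_def)
  have cJ: "real (card (J \<xi>)) \<le> c" for \<xi>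
  proof -
    have "card (J \<xi>) \<le> card K\<^sub>1" by (rule card_mono[OF fin(1)]) (auto simp: J_def)
    moreover have "card (J \<xi>) \<le> card K\<^sub>2"
      by (rule card_inj_on_le[of "\<lambda>k. \<xi> - k", OF _ _ fin(2)]) (auto simp: J_def inj_on_def)
    ultimately show ?thesis using c by linarith
  qed
  have one: "(norm (\<Sum>k\<in>J \<xi>. a k (\<xi> - k) * U k * V (\<xi> - k)))\<^sup>2
      \<le> (\<Sum>k\<in>J \<xi>. c * A\<^sup>2 * ((norm (U k))\<^sup>2 * (norm (V (\<xi> - k)))\<^sup>2))" for \<xi>
  proof -
    have "(norm (\<Sum>k\<in>J \<xi>. a k (\<xi> - k) * U k * V (\<xi> - k)))\<^sup>2 \<le> (\<Sum>k\<in>J \<xi>. norm (a k (\<xi> - k) * U k * V (\<xi> - k)))\<^sup>2"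
      by (intro power_mono norm_sum) auto
    also have "\<dots> \<le> real (card (J \<xi>)) * (\<Sum>k\<in>J \<xi>. (norm (a k (\<xi> - k) * U k * V (\<xi> - k)))\<^sup>2)"
      using sum_squared_le_sum_of_squares by (simp add: mult.commute)
    also have "\<dots> \<le> c * (\<Sum>k\<in>J \<xi>. (norm (a k (\<xi> - k) * U k * V (\<xi> - k)))\<^sup>2)"
      by (intro mult_right_mono cJ sum_nonneg) auto
    also have "\<dots> \<le> c * (\<Sum>k\<in>J \<xi>. A\<^sup>2 * ((norm (U k))\<^sup>2 * (norm (V (\<xi> - k)))\<^sup>2))"
    proof (intro mult_left_mono sum_mono)
      fix k
      have "(norm (a k (\<xi> - k)))\<^sup>2 \<le> A\<^sup>2" using a by (intro power_mono) auto
      then show "(norm (a k (\<xi> - k) * U k * V (\<xi> - k)))\<^sup>2 \<le> A\<^sup>2 * ((norm (U k))\<^sup>2 * (norm (V (\<xi> - k)))\<^sup>2)"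
        unfolding norm_mult power_mult_distrib mult.assoc by (intro mult_right_mono) auto
    qed (use cJ[of \<xi>] order_trans[OF of_nat_0_le_iff] in blast)
    finally show ?thesis by (simp only: sum_distrib_left mult.assoc)
  qed
  have "(\<Sum>\<xi>\<in>(\<lambda>(k, m). k + m) ` (K\<^sub>1 \<times> K\<^sub>2). (norm (\<Sum>k\<in>J \<xi>. a k (\<xi> - k) * U k * V (\<xi> - k)))\<^sup>2)
    \<le> (\<Sum>\<xi>\<in>(\<lambda>(k, m). k + m) ` (K\<^sub>1 \<times> K\<^sub>2). \<Sum>k\<in>J \<xi>. c * A\<^sup>2 * ((norm (U k))\<^sup>2 * (norm (V (\<xi> - k)))\<^sup>2))"
    by (intro sum_mono one)
  also have "\<dots> = (\<Sum>k\<in>K\<^sub>1. \<Sum>m\<in>K\<^sub>2. c * A\<^sup>2 * ((norm (U k))\<^sup>2 * (norm (V m))\<^sup>2))"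
    unfolding J_def by (rule sum_over_outputs[OF fin])
  also have "\<dots> = c * A\<^sup>2 * ((\<Sum>k\<in>K\<^sub>1. (norm (U k))\<^sup>2) * (\<Sum>m\<in>K\<^sub>2. (norm (V m))\<^sup>2))"
    by (simp only: sum_product) (simp only: sum_distrib_left)
  finally show ?thesis by (simp only: J_def)
qed

text \<open>The constant 864 is 108 * 8: the sieve gives 108, and 8 = 2 * 4 combines the squared
  product rule with the 4 in (2 N)^2, the cost of the derivative on a shell. The 5 comes from the
  cardinality of the smaller shell.\<close>

lemma bilinear_estimates:
  fixes a :: "real \<times> real \<Rightarrow> complex"
  assumes chi: "freq_cutoff chi" and T: "0 < T" "T < 1"
    and N: "N\<^sub>1 \<in> dyadic" "N\<^sub>2 \<in> dyadic" and a: "\<And>z. norm (a z) \<le> A"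
    and c: "0 < c" "c \<le> 1"
    and sep: "\<And>\<xi> k l. k \<in> dyadic_shell N\<^sub>1 \<Longrightarrow> l \<in> dyadic_shell N\<^sub>1 \<Longrightarrow>
      \<xi> - k \<in> dyadic_shell N\<^sub>2 \<Longrightarrow> \<xi> - l \<in> dyadic_shell N\<^sub>2 \<Longrightarrow>
      c * max N\<^sub>1 N\<^sub>2 * \<bar>real_of_int (k - l)\<bar>
        \<le> \<bar>(p (of_int k) + p (of_int (\<xi> - k))) - (p (of_int l) + p (of_int (\<xi> - l)))\<bar>"
    and u\<^sub>1: "continuous_L2 T u\<^sub>1" and f\<^sub>1: "Linf_L2 T f\<^sub>1" and w\<^sub>1: "weak_solution T p u\<^sub>1 f\<^sub>1"
    and u\<^sub>2: "continuous_L2 T u\<^sub>2" and f\<^sub>2: "Linf_L2 T f\<^sub>2" and w\<^sub>2: "weak_solution T p u\<^sub>2 f\<^sub>2"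
  defines "S \<equiv> L2_time_norm T (\<lambda>t. bilinear_mult a (freq_proj chi N\<^sub>1 (u\<^sub>1 t)) (freq_proj chi N\<^sub>2 (u\<^sub>2 t)))"
    and "R \<equiv> (L2_time_norm T (\<lambda>t. freq_proj chi N\<^sub>1 (u\<^sub>1 t)) + L2_time_norm T (\<lambda>t. freq_proj chi N\<^sub>1 (f\<^sub>1 t)))
      * (Linf_time_norm T (\<lambda>t. freq_proj chi N\<^sub>2 (u\<^sub>2 t)) + Linf_time_norm T (\<lambda>t. freq_proj chi N\<^sub>2 (f\<^sub>2 t)))"
  shows "S\<^sup>2 \<le> 864 / c * A\<^sup>2 * R\<^sup>2 / T" "S\<^sup>2 \<le> 5 * A\<^sup>2 * R\<^sup>2 * min N\<^sub>1 N\<^sub>2" "0 \<le> R"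
proof -
  let ?K1 = "dyadic_shell N\<^sub>1" and ?K2 = "dyadic_shell N\<^sub>2"
  note fin = dyadic_shell_finite(1)[OF N(1)] dyadic_shell_finite(1)[OF N(2)]
  note N1 = dyadic_shell_finite(3)[OF N(1)] dyadic_shell_finite(3)[OF N(2)]
  define U where "U = L2_time_norm T (\<lambda>t. freq_proj chi N\<^sub>1 (u\<^sub>1 t))"
  define F where "F = L2_time_norm T (\<lambda>t. freq_proj chi N\<^sub>1 (f\<^sub>1 t))"
  define V where "V = Linf_time_norm T (\<lambda>t. freq_proj chi N\<^sub>2 (u\<^sub>2 t))"
  define G where "G = Linf_time_norm T (\<lambda>t. freq_proj chi N\<^sub>2 (f\<^sub>2 t))"
  have R: "R = (U + F) * (V + G)" by (simp add: R_def U_def F_def V_def G_def)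
  obtain x x' where x: "\<And>k. bounded_primitive 0 T (x k) (x' k)"
    and xeq: "\<And>k t. x k t = cis (- (p (of_int k) * t)) * fourier (freq_proj chi N\<^sub>1 (u\<^sub>1 t)) k"
    and "\<And>t. t \<in> {0..T} \<Longrightarrow> 2 * pi * (\<Sum>k\<in>?K1. (norm (x k t))\<^sup>2) \<le> (Linf_time_norm T (\<lambda>t. freq_proj chi N\<^sub>1 (u\<^sub>1 t)))\<^sup>2"
    and "\<And>t. t \<in> {0..T} \<Longrightarrow> 2 * pi * (\<Sum>k\<in>?K1. (norm (x' k t))\<^sup>2) \<le> (2 * N\<^sub>1)\<^sup>2 * (Linf_time_norm T (\<lambda>t. freq_proj chi N\<^sub>1 (f\<^sub>1 t)))\<^sup>2"
    and xU: "2 * pi * integral {0..T} (\<lambda>t. \<Sum>k\<in>?K1. (norm (x k t))\<^sup>2) = U\<^sup>2"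
    and xF: "2 * pi * integral {0..T} (\<lambda>t. \<Sum>k\<in>?K1. (norm (x' k t))\<^sup>2) \<le> (2 * N\<^sub>1)\<^sup>2 * F\<^sup>2"
    and "0 \<le> Linf_time_norm T (\<lambda>t. freq_proj chi N\<^sub>1 (u\<^sub>1 t))" "0 \<le> Linf_time_norm T (\<lambda>t. freq_proj chi N\<^sub>1 (f\<^sub>1 t))"
  proof (rule localized_solution[OF chi T(1) N(1) u\<^sub>1 f\<^sub>1 w\<^sub>1, folded U_def F_def], goal_cases)
    case (1 x x')
    show ?case by (rule 1(1)[OF 1(2-9)])
  qed
  obtain y y' where y: "\<And>k. bounded_primitive 0 T (y k) (y' k)"
    and yeq: "\<And>k t. y k t = cis (- (p (of_int k) * t)) * fourier (freq_proj chi N\<^sub>2 (u\<^sub>2 t)) k"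
    and yV: "\<And>t. t \<in> {0..T} \<Longrightarrow> 2 * pi * (\<Sum>k\<in>?K2. (norm (y k t))\<^sup>2) \<le> V\<^sup>2"
    and yG: "\<And>t. t \<in> {0..T} \<Longrightarrow> 2 * pi * (\<Sum>k\<in>?K2. (norm (y' k t))\<^sup>2) \<le> (2 * N\<^sub>2)\<^sup>2 * G\<^sup>2"
    and "2 * pi * integral {0..T} (\<lambda>t. \<Sum>k\<in>?K2. (norm (y k t))\<^sup>2) = (L2_time_norm T (\<lambda>t. freq_proj chi N\<^sub>2 (u\<^sub>2 t)))\<^sup>2"
    and "2 * pi * integral {0..T} (\<lambda>t. \<Sum>k\<in>?K2. (norm (y' k t))\<^sup>2) \<le> (2 * N\<^sub>2)\<^sup>2 * (L2_time_norm T (\<lambda>t. freq_proj chi N\<^sub>2 (f\<^sub>2 t)))\<^sup>2"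
    and V0: "0 \<le> V" and G0: "0 \<le> G"
  proof (rule localized_solution[OF chi T(1) N(2) u\<^sub>2 f\<^sub>2 w\<^sub>2, folded V_def G_def], goal_cases)
    case (1 y y')
    show ?case by (rule 1(1)[OF 1(2-9)])
  qed
  have U0: "0 \<le> U" "0 \<le> F" by (simp_all add: U_def F_def L2_time_norm_nonneg)
  show R0: "0 \<le> R" unfolding R using U0 V0 G0 by simp
  define b where "b = (\<lambda>k m. a (of_int k, of_int m))"
  have b: "norm (b k m) \<le> A" for k m by (simp add: b_def a)
  define w where "w = (\<lambda>k. p (of_int k))"
  let ?X = "(\<lambda>(k, m). k + m) ` (?K1 \<times> ?K2)" and ?J = "\<lambda>\<xi>. {k\<in>?K1. \<xi> - k \<in> ?K2}"
  define D where "D = (\<lambda>t. \<Sum>\<xi>\<in>?X.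
    (norm (\<Sum>k\<in>?J \<xi>. b k (\<xi> - k) * (x k t * y (\<xi> - k) t) * cis ((w k + w (\<xi> - k)) * t)))\<^sup>2)"
  have cx: "continuous_on {0..T} (x k)" and cy: "continuous_on {0..T} (y k)" for k
    by (rule bounded_primitive_continuous[OF x], rule bounded_primitive_continuous[OF y])
  have cD: "continuous_on {0..T} D" unfolding D_def by (intro continuous_intros cx cy)
  have off: "fourier (freq_proj chi N g) k = 0" if "N \<in> dyadic" "k \<notin> dyadic_shell N" for N g k
    using freq_block_support[OF chi _ that(2)] dyadic_shell_finite(3)[OF that(1)]
    by (simp add: fourier_freq_proj[OF chi that(1)])
  \<comment> \<open>Restoring the phases undoes the passage to x and y, so D measures the original
    bilinear expression.\<close>
  have SD: "(L2_norm (bilinear_mult a (freq_proj chi N\<^sub>1 (u\<^sub>1 t)) (freq_proj chi N\<^sub>2 (u\<^sub>2 t))))\<^sup>2 = 2 * pi * D t" for t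
  proof -
    have "b k (\<xi> - k) * (x k t * y (\<xi> - k) t) * cis ((w k + w (\<xi> - k)) * t)
      = a (of_int k, of_int (\<xi> - k)) * fourier (freq_proj chi N\<^sub>1 (u\<^sub>1 t)) k * fourier (freq_proj chi N\<^sub>2 (u\<^sub>2 t)) (\<xi> - k)" for k \<xi>
    proof -
      have "cis (- (w k * t)) * cis (- (w (\<xi> - k) * t)) * cis ((w k + w (\<xi> - k)) * t) = 1"
        by (simp add: cis_mult algebra_simps)
      moreover have "b k (\<xi> - k) * (x k t * y (\<xi> - k) t) * cis ((w k + w (\<xi> - k)) * t)
        = (cis (- (w k * t)) * cis (- (w (\<xi> - k) * t)) * cis ((w k + w (\<xi> - k)) * t)) *
          (a (of_int k, of_int (\<xi> - k)) * fourier (freq_proj chi N\<^sub>1 (u\<^sub>1 t)) k * fourier (freq_proj chi N\<^sub>2 (u\<^sub>2 t)) (\<xi> - k))"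
        unfolding xeq yeq b_def w_def by (simp only: mult_ac)
      ultimately show ?thesis by simp
    qed
    then show ?thesis
      unfolding D_def
    proof (simp only:, intro L2_norm_bilinear_mult fin)
      show "fourier (freq_proj chi N\<^sub>1 (u\<^sub>1 t)) k = 0" if "k \<notin> ?K1" for k by (rule off[OF N(1) that])
      show "fourier (freq_proj chi N\<^sub>2 (u\<^sub>2 t)) k = 0" if "k \<notin> ?K2" for k by (rule off[OF N(2) that])
    qed
  qed
  have S2: "S\<^sup>2 = 2 * pi * integral {0..T} D"
  proof -
    obtain B where B: "\<And>t. t \<in> {0..T} \<Longrightarrow> norm (D t) \<le> B"
      using compact_imp_bounded[OF compact_continuous_image[OF cD compact_Icc]] unfolding bounded_iff by blast
    have "S\<^sup>2 = 2 * pi * (LINT t|lebesgue_on {0<..<T}. D t)"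
      unfolding S_def L2_time_norm_power2 SD by simp
    then show ?thesis
      using bounded_integral_open_interval[OF continuous_on_measurable_lebesgue_on[OF cD] B] by simp
  qed
  define X X' where "X = (\<lambda>t. \<Sum>k\<in>?K1. (norm (x k t))\<^sup>2)" and "X' = (\<lambda>t. \<Sum>k\<in>?K1. (norm (x' k t))\<^sup>2)"
  have iX: "X integrable_on {0..T}" unfolding X_def by (intro integrable_continuous_real continuous_intros cx)
  have iX': "X' integrable_on {0..T}"
    unfolding X'_def by (intro integrable_sum fin bounded_primitive_norm_sq_integrable[OF x])
  have X0: "0 \<le> X t" for t unfolding X_def by (simp add: sum_nonneg)
  have UF: "(U\<^sup>2 + F\<^sup>2) * (V\<^sup>2 + G\<^sup>2) \<le> R\<^sup>2"
  proof -
    have "U\<^sup>2 + F\<^sup>2 \<le> (U + F)\<^sup>2" "V\<^sup>2 + G\<^sup>2 \<le> (V + G)\<^sup>2"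
      using U0 V0 G0 by (simp_all add: power2_sum)
    then show ?thesis unfolding R power_mult_distrib by (intro mult_mono) auto
  qed
  \<comment> \<open>Only one factor 2 pi is needed, the one that recreates \<open>U\<^sup>2\<close>
    from the integral of X. In the bounds for the second family it is discarded, being at least
    1.\<close>
  have drop: "q \<le> r" if "0 \<le> q" "2 * pi * q \<le> r" for q r :: real
  proof -
    have "1 * q \<le> 2 * pi * q" using pi_gt3 that(1) by (intro mult_right_mono) auto
    then show ?thesis using that(2) by linarith
  qed
  have yV': "(\<Sum>k\<in>?K2. (norm (y k t))\<^sup>2) \<le> V\<^sup>2" if "t \<in> {0..T}" for t
    by (rule drop[OF _ yV[OF that]]) (simp add: sum_nonneg)
  have UV: "U\<^sup>2 * V\<^sup>2 \<le> R\<^sup>2"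
  proof -
    have "U\<^sup>2 * V\<^sup>2 \<le> (U\<^sup>2 + F\<^sup>2) * (V\<^sup>2 + G\<^sup>2)" by (intro mult_mono) auto
    then show ?thesis using UF by linarith
  qed
  show "S\<^sup>2 \<le> 5 * A\<^sup>2 * R\<^sup>2 * min N\<^sub>1 N\<^sub>2"
  proof -
    let ?m = "min N\<^sub>1 N\<^sub>2"
    have m0: "0 \<le> 5 * ?m * A\<^sup>2" using N1 by simp
    have le: "D t \<le> 5 * ?m * A\<^sup>2 * V\<^sup>2 * X t" if t: "t \<in> {0..T}" for t
    proof -
      \<comment> \<open>The phases have modulus one and are absorbed into the multiplier, whose
        bound A is unchanged.\<close>
      have "D t = (\<Sum>\<xi>\<in>?X. (norm (\<Sum>k\<in>?J \<xi>. (b k (\<xi> - k) * cis ((w k + w (\<xi> - k)) * t)) * x k t * y (\<xi> - k) t))\<^sup>2)"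
        unfolding D_def by (simp only: mult_ac)
      also have "\<dots> \<le> 5 * ?m * A\<^sup>2 * (X t * (\<Sum>k\<in>?K2. (norm (y k t))\<^sup>2))"
        unfolding X_def
        by (rule bilinear_pointwise[OF fin, of "\<lambda>k m. b k m * cis ((w k + w m) * t)"])
          (use b dyadic_shell_finite(2)[OF N(1)] dyadic_shell_finite(2)[OF N(2)] in \<open>auto simp: norm_mult min_def\<close>)
      also have "\<dots> \<le> 5 * ?m * A\<^sup>2 * (X t * V\<^sup>2)"
        by (intro mult_left_mono yV'[OF t] X0 m0)
      finally show ?thesis by (simp only: mult_ac)
    qed
    have "integral {0..T} D \<le> integral {0..T} (\<lambda>t. 5 * ?m * A\<^sup>2 * V\<^sup>2 * X t)"
      by (intro integral_le integrable_continuous_real[OF cD] integrable_on_mult_right iX le)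
    then have "S\<^sup>2 \<le> 2 * pi * (5 * ?m * A\<^sup>2 * V\<^sup>2 * integral {0..T} X)"
      unfolding S2 by (intro mult_left_mono) auto
    also have "\<dots> = 5 * ?m * A\<^sup>2 * (U\<^sup>2 * V\<^sup>2)"
      unfolding xU[folded X_def, symmetric] by (simp only: mult_ac)
    also have "\<dots> \<le> 5 * ?m * A\<^sup>2 * R\<^sup>2" by (intro mult_left_mono UV m0)
    finally show ?thesis by (simp only: mult_ac)
  qed
  show "S\<^sup>2 \<le> 864 / c * A\<^sup>2 * R\<^sup>2 / T"
  proof -
    define M where "M = max N\<^sub>1 N\<^sub>2"
    have "M \<in> dyadic" using N by (simp add: M_def max_def)
    then obtain l :: nat where l: "M = 2 ^ l" by (auto simp: dyadic_def)
    \<comment> \<open>The number of windows is M itself, which as a power of two is a natural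
      number.\<close>
    define n :: nat where "n = 2 ^ l"
    have n: "real n = M" "0 < n" by (simp_all add: n_def l)
    have M1: "1 \<le> M" using N1 by (simp add: M_def)
    have Y': "(\<Sum>k\<in>?K2. (norm (y' k t))\<^sup>2) \<le> 4 * M\<^sup>2 * G\<^sup>2" if t: "t \<in> {0..T}" for t
    proof (rule drop)
      have "N\<^sub>2\<^sup>2 \<le> M\<^sup>2" using N1 by (intro power_mono) (auto simp: M_def)
      then have "(2 * N\<^sub>2)\<^sup>2 * G\<^sup>2 \<le> 4 * M\<^sup>2 * G\<^sup>2" by (intro mult_right_mono) (auto simp: power_mult_distrib)
      then show "2 * pi * (\<Sum>k\<in>?K2. (norm (y' k t))\<^sup>2) \<le> 4 * M\<^sup>2 * G\<^sup>2" using yG[OF t] by linarith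
    qed (simp add: sum_nonneg)
    \<comment> \<open>The windows must not exceed the inverse gap; this is where c \<le> 1 is used,
      together with T < 1.\<close>
    have Tg: "T / real n \<le> 1 / (c * M)"
    proof -
      have "c * T \<le> 1" using c T by (simp add: mult_le_one)
      then show ?thesis using c T M1 by (simp add: n field_simps)
    qed
    have cM: "0 < c * M" using c M1 by simp
    have sep': "c * M * \<bar>real_of_int (k - l)\<bar> \<le> \<bar>(w k + w (\<xi> - k)) - (w l + w (\<xi> - l))\<bar>"
      if "k \<in> ?K1" "l \<in> ?K1" "\<xi> - k \<in> ?K2" "\<xi> - l \<in> ?K2" for \<xi> k l
      unfolding w_def M_def by (rule sep[OF that])
    define \<beta> \<gamma> where "\<beta> = M / T * V\<^sup>2 + 2 * T / M * (4 * M\<^sup>2 * G\<^sup>2)" and "\<gamma> = 2 * T / M * V\<^sup>2"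
    have core: "integral {0..T} D \<le> 108 * A\<^sup>2 / (c * M) * integral {0..T} (\<lambda>t. \<beta> * X t + \<gamma> * X' t)"
      unfolding D_def X_def X'_def \<beta>_def \<gamma>_def n(1)[symmetric]
      by (rule bilinear_estimate_phases[OF fin b cM[folded n(1)] n(2) T(1) Tg[unfolded n(1)[symmetric]] sep'[folded n(1)] x y yV' Y'[folded n(1)]])
    have \<gamma>0: "0 \<le> \<gamma>" using T M1 by (simp add: \<gamma>_def)
    \<comment> \<open>Since T < 1, the derivative terms, of size T * M, are absorbed into the
      zero-order size M / T.\<close>
    have MT: "T * M \<le> M / T"
    proof -
      have "T * T \<le> 1" using T by (simp add: mult_le_one)
      then have "T * T * M \<le> 1 * M" using M1 by (intro mult_right_mono) auto
      then show ?thesis using T(1) by (simp add: pos_le_divide_eq mult_ac)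
    qed
    have MT0: "0 \<le> M / T" using T M1 by simp
    have "2 * pi * integral {0..T} (\<lambda>t. \<beta> * X t + \<gamma> * X' t) = \<beta> * (2 * pi * integral {0..T} X) + \<gamma> * (2 * pi * integral {0..T} X')"
      by (simp only: integral_linear_combination[OF iX iX'] distrib_left mult_ac)
    also have "\<dots> \<le> \<beta> * U\<^sup>2 + \<gamma> * ((2 * N\<^sub>1)\<^sup>2 * F\<^sup>2)"
      unfolding X_def X'_def xU by (intro add_left_mono mult_left_mono xF \<gamma>0)
    also have "\<dots> \<le> \<beta> * U\<^sup>2 + \<gamma> * (4 * M\<^sup>2 * F\<^sup>2)"
    proof (intro add_left_mono mult_left_mono[OF _ \<gamma>0])
      have "N\<^sub>1\<^sup>2 \<le> M\<^sup>2" using N1 by (intro power_mono) (auto simp: M_def)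
      then show "(2 * N\<^sub>1)\<^sup>2 * F\<^sup>2 \<le> 4 * M\<^sup>2 * F\<^sup>2" by (intro mult_right_mono) (auto simp: power_mult_distrib)
    qed
    also have "\<dots> = M / T * (U\<^sup>2 * V\<^sup>2) + 8 * (T * M) * (U\<^sup>2 * G\<^sup>2 + F\<^sup>2 * V\<^sup>2)"
      using M1 by (simp add: \<beta>_def \<gamma>_def power2_eq_square field_simps)
    also have "\<dots> \<le> M / T * (8 * (U\<^sup>2 * V\<^sup>2)) + 8 * (M / T) * (U\<^sup>2 * G\<^sup>2 + F\<^sup>2 * V\<^sup>2)"
      using MT MT0 by (intro add_mono mult_left_mono mult_right_mono) auto
    also have "\<dots> \<le> 8 * (M / T) * ((U\<^sup>2 + F\<^sup>2) * (V\<^sup>2 + G\<^sup>2))"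
    proof -
      have "M / T * (8 * (U\<^sup>2 * V\<^sup>2)) + 8 * (M / T) * (U\<^sup>2 * G\<^sup>2 + F\<^sup>2 * V\<^sup>2)
          = 8 * (M / T) * (U\<^sup>2 * V\<^sup>2 + U\<^sup>2 * G\<^sup>2 + F\<^sup>2 * V\<^sup>2)" by (simp add: distrib_left)
      also have "\<dots> \<le> 8 * (M / T) * ((U\<^sup>2 + F\<^sup>2) * (V\<^sup>2 + G\<^sup>2))"
        by (intro mult_left_mono mult_nonneg_nonneg MT0) (simp_all add: algebra_simps)
      finally show ?thesis .
    qed
    also have "\<dots> \<le> 8 * (M / T) * R\<^sup>2" by (intro mult_left_mono UF mult_nonneg_nonneg MT0) simp
    finally have Q: "2 * pi * integral {0..T} (\<lambda>t. \<beta> * X t + \<gamma> * X' t) \<le> 8 * (M / T) * R\<^sup>2" .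
    have "S\<^sup>2 \<le> 2 * pi * (108 * A\<^sup>2 / (c * M) * integral {0..T} (\<lambda>t. \<beta> * X t + \<gamma> * X' t))"
      unfolding S2 using core by (intro mult_left_mono) auto
    also have "\<dots> = 108 * A\<^sup>2 / (c * M) * (2 * pi * integral {0..T} (\<lambda>t. \<beta> * X t + \<gamma> * X' t))"
      by (simp only: mult_ac)
    also have "\<dots> \<le> 108 * A\<^sup>2 / (c * M) * (8 * (M / T) * R\<^sup>2)"
      using cM by (intro mult_left_mono Q) auto
    \<comment> \<open>The M from the window count cancels against the M in the gap, so the bound is
      uniform in the frequencies.\<close>
    also have "\<dots> = 864 / c * A\<^sup>2 * R\<^sup>2 / T"
      using c M1 T by (simp add: field_simps)
    finally show ?thesis .
  qed
qed

theorem proposition3p2: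
  fixes \<alpha> :: real and p chi :: "real \<Rightarrow> real"
  assumes "1 \<le> \<alpha>" and "\<alpha> \<le> 2"
    and "dispersion_hyp \<alpha> p"
    and "freq_cutoff chi"
  shows "\<exists>C\<^sub>0>0. \<forall>A::real. \<exists>C>0.
    \<forall>(T::real) (N\<^sub>1::real) (N\<^sub>2::real) (a :: real \<times> real \<Rightarrow> complex)
      (f\<^sub>1 :: real \<Rightarrow> real \<Rightarrow> complex) (f\<^sub>2 :: real \<Rightarrow> real \<Rightarrow> complex)
      (u\<^sub>1 :: real \<Rightarrow> real \<Rightarrow> complex) (u\<^sub>2 :: real \<Rightarrow> real \<Rightarrow> complex) (\<theta>::real).
      0 < T \<and> T < 1 \<and>
      N\<^sub>1 \<in> dyadic \<and> N\<^sub>2 \<in> dyadic \<and> max N\<^sub>1 N\<^sub>2 \<ge> C\<^sub>0 * min N\<^sub>1 N\<^sub>2 \<and>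
      Linf_L2 T f\<^sub>1 \<and> Linf_L2 T f\<^sub>2 \<and>
      bounded (range a) \<and> (SUP z. cmod (a z)) \<le> A \<and>
      continuous_L2 T u\<^sub>1 \<and> continuous_L2 T u\<^sub>2 \<and>
      weak_solution T p u\<^sub>1 f\<^sub>1 \<and> weak_solution T p u\<^sub>2 f\<^sub>2 \<and>
      0 \<le> \<theta> \<and> \<theta> \<le> 1
      \<longrightarrow>
      L2_time_norm T (\<lambda>t. bilinear_mult a (freq_proj chi N\<^sub>1 (u\<^sub>1 t)) (freq_proj chi N\<^sub>2 (u\<^sub>2 t)))
        \<le> C * T powr ((\<theta> - 1) / 2) * (min N\<^sub>1 N\<^sub>2) powr (\<theta> / 2)
          * (L2_time_norm T (\<lambda>t. freq_proj chi N\<^sub>1 (u\<^sub>1 t)) + L2_time_norm T (\<lambda>t. freq_proj chi N\<^sub>1 (f\<^sub>1 t)))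
          * (Linf_time_norm T (\<lambda>t. freq_proj chi N\<^sub>2 (u\<^sub>2 t)) + Linf_time_norm T (\<lambda>t. freq_proj chi N\<^sub>2 (f\<^sub>2 t)))"
proof -
  obtain C\<^sub>0 c where C0: "0 < C\<^sub>0" and c: "0 < c" and sep:
    "\<And>N\<^sub>1 N\<^sub>2 \<xi> k l. 1 \<le> N\<^sub>1 \<Longrightarrow> 1 \<le> N\<^sub>2 \<Longrightarrow> C\<^sub>0 * min N\<^sub>1 N\<^sub>2 \<le> max N\<^sub>1 N\<^sub>2 \<Longrightarrow>
      k \<in> dyadic_shell N\<^sub>1 \<Longrightarrow> l \<in> dyadic_shell N\<^sub>1 \<Longrightarrow>
      \<xi> - k \<in> dyadic_shell N\<^sub>2 \<Longrightarrow> \<xi> - l \<in> dyadic_shell N\<^sub>2 \<Longrightarrow>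
      c * max N\<^sub>1 N\<^sub>2 * \<bar>real_of_int (k - l)\<bar>
        \<le> \<bar>(p (of_int k) + p (of_int (\<xi> - k))) - (p (of_int l) + p (of_int (\<xi> - l)))\<bar>"
    using phase_separation[OF assms(3,1)] by metis
  \<comment> \<open>The window condition requires a separation constant of at most 1; decreasing c
    only weakens the separation.\<close>
  define d where "d = min c 1"
  have d: "0 < d" "d \<le> 1" "d \<le> c" using c by (auto simp: d_def)
  show ?thesis
  proof (rule exI[of _ C\<^sub>0], intro conjI C0 allI)
    fix A :: real
    \<comment> \<open>K dominates the constants of both endpoint bounds, as the interpolation
      requires. The 1 added to its root below keeps the final constant positive when A = 0.\<close>
    define K where "K = (864 / d + 5) * A\<^sup>2"
    have K0: "0 \<le> K" using d by (simp add: K_def)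
    let ?C = "sqrt K + 1"
    show "\<exists>C>0. \<forall>(T::real) (N\<^sub>1::real) (N\<^sub>2::real) (a :: real \<times> real \<Rightarrow> complex)
      (f\<^sub>1 :: real \<Rightarrow> real \<Rightarrow> complex) (f\<^sub>2 :: real \<Rightarrow> real \<Rightarrow> complex)
      (u\<^sub>1 :: real \<Rightarrow> real \<Rightarrow> complex) (u\<^sub>2 :: real \<Rightarrow> real \<Rightarrow> complex) (\<theta>::real).
      0 < T \<and> T < 1 \<and>
      N\<^sub>1 \<in> dyadic \<and> N\<^sub>2 \<in> dyadic \<and> max N\<^sub>1 N\<^sub>2 \<ge> C\<^sub>0 * min N\<^sub>1 N\<^sub>2 \<and>
      Linf_L2 T f\<^sub>1 \<and> Linf_L2 T f\<^sub>2 \<and>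
      bounded (range a) \<and> (SUP z. cmod (a z)) \<le> A \<and>
      continuous_L2 T u\<^sub>1 \<and> continuous_L2 T u\<^sub>2 \<and>
      weak_solution T p u\<^sub>1 f\<^sub>1 \<and> weak_solution T p u\<^sub>2 f\<^sub>2 \<and>
      0 \<le> \<theta> \<and> \<theta> \<le> 1
      \<longrightarrow>
      L2_time_norm T (\<lambda>t. bilinear_mult a (freq_proj chi N\<^sub>1 (u\<^sub>1 t)) (freq_proj chi N\<^sub>2 (u\<^sub>2 t)))
        \<le> C * T powr ((\<theta> - 1) / 2) * (min N\<^sub>1 N\<^sub>2) powr (\<theta> / 2)
          * (L2_time_norm T (\<lambda>t. freq_proj chi N\<^sub>1 (u\<^sub>1 t)) + L2_time_norm T (\<lambda>t. freq_proj chi N\<^sub>1 (f\<^sub>1 t)))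
          * (Linf_time_norm T (\<lambda>t. freq_proj chi N\<^sub>2 (u\<^sub>2 t)) + Linf_time_norm T (\<lambda>t. freq_proj chi N\<^sub>2 (f\<^sub>2 t)))"
    proof (intro exI[of _ ?C] conjI allI impI, goal_cases)
      case 1
      show ?case using K0 by (simp add: add_nonneg_pos)
    next
      case (2 T N\<^sub>1 N\<^sub>2 a f\<^sub>1 f\<^sub>2 u\<^sub>1 u\<^sub>2 \<theta>)
      then have T: "0 < T" "T < 1" and N: "N\<^sub>1 \<in> dyadic" "N\<^sub>2 \<in> dyadic" "C\<^sub>0 * min N\<^sub>1 N\<^sub>2 \<le> max N\<^sub>1 N\<^sub>2"
        and f: "Linf_L2 T f\<^sub>1" "Linf_L2 T f\<^sub>2" and a: "bounded (range a)" "(SUP z. cmod (a z)) \<le> A"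
        and u: "continuous_L2 T u\<^sub>1" "continuous_L2 T u\<^sub>2" and w: "weak_solution T p u\<^sub>1 f\<^sub>1" "weak_solution T p u\<^sub>2 f\<^sub>2"
        and \<theta>: "0 \<le> \<theta>" "\<theta> \<le> 1"
        by auto
      note N1 = dyadic_shell_finite(3)[OF N(1)] dyadic_shell_finite(3)[OF N(2)]
      have aA: "cmod (a z) \<le> A" for z
      proof -
        have "bdd_above (range (\<lambda>z. cmod (a z)))"
          using a(1) by (auto simp: bounded_iff bdd_above_def)
        then have "cmod (a z) \<le> (SUP z. cmod (a z))" by (intro cSUP_upper) auto
        then show ?thesis using a(2) by linarith
      qed
      have sep': "d * max N\<^sub>1 N\<^sub>2 * \<bar>real_of_int (k - l)\<bar>
          \<le> \<bar>(p (of_int k) + p (of_int (\<xi> - k))) - (p (of_int l) + p (of_int (\<xi> - l)))\<bar>"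
        if "k \<in> dyadic_shell N\<^sub>1" "l \<in> dyadic_shell N\<^sub>1" "\<xi> - k \<in> dyadic_shell N\<^sub>2" "\<xi> - l \<in> dyadic_shell N\<^sub>2" for \<xi> k l
      proof -
        have "d * max N\<^sub>1 N\<^sub>2 * \<bar>real_of_int (k - l)\<bar> \<le> c * max N\<^sub>1 N\<^sub>2 * \<bar>real_of_int (k - l)\<bar>"
          using d N1 by (intro mult_right_mono) auto
        then show ?thesis using sep[OF N1 N(3) that] by linarith
      qed
      define S where "S = L2_time_norm T (\<lambda>t. bilinear_mult a (freq_proj chi N\<^sub>1 (u\<^sub>1 t)) (freq_proj chi N\<^sub>2 (u\<^sub>2 t)))"
      define R where "R = (L2_time_norm T (\<lambda>t. freq_proj chi N\<^sub>1 (u\<^sub>1 t)) + L2_time_norm T (\<lambda>t. freq_proj chi N\<^sub>1 (f\<^sub>1 t)))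
        * (Linf_time_norm T (\<lambda>t. freq_proj chi N\<^sub>2 (u\<^sub>2 t)) + Linf_time_norm T (\<lambda>t. freq_proj chi N\<^sub>2 (f\<^sub>2 t)))"
      note rule = bilinear_estimates[OF assms(4) T N(1,2) _ d(1,2) _ u(1) f(1) w(1) u(2) f(2) w(2), of a A]
      have est: "S\<^sup>2 \<le> 864 / d * A\<^sup>2 * R\<^sup>2 / T" "S\<^sup>2 \<le> 5 * A\<^sup>2 * R\<^sup>2 * min N\<^sub>1 N\<^sub>2" "0 \<le> R"
        unfolding S_def R_def by (rule rule; fact aA sep')+
      let ?\<Theta> = "T powr ((\<theta> - 1) / 2) * (min N\<^sub>1 N\<^sub>2) powr (\<theta> / 2)"
      have "S \<le> sqrt (K * R\<^sup>2) * T powr ((\<theta> - 1) / 2) * (min N\<^sub>1 N\<^sub>2) powr (\<theta> / 2)"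
      proof (rule le_interpolated)
        have "864 / d * A\<^sup>2 \<le> K" "5 * A\<^sup>2 \<le> K" using d by (auto simp: K_def distrib_right)
        then have "864 / d * A\<^sup>2 * R\<^sup>2 / T \<le> K * R\<^sup>2 / T" "5 * A\<^sup>2 * R\<^sup>2 * min N\<^sub>1 N\<^sub>2 \<le> K * R\<^sup>2 * min N\<^sub>1 N\<^sub>2"
          using T N1 by (intro divide_right_mono mult_right_mono, simp_all)+
        then show "S\<^sup>2 \<le> K * R\<^sup>2 / T" "S\<^sup>2 \<le> K * R\<^sup>2 * min N\<^sub>1 N\<^sub>2" using est(1,2) by linarith+
      qed (use T N1 \<theta> K0 in auto)
      also have "\<dots> = sqrt K * (?\<Theta> * R)" using est(3) by (simp add: real_sqrt_mult mult_ac)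
      also have "\<dots> \<le> ?C * (?\<Theta> * R)" using est(3) by (intro mult_right_mono) auto
      also have "\<dots> = ?C * T powr ((\<theta> - 1) / 2) * (min N\<^sub>1 N\<^sub>2) powr (\<theta> / 2) * R" by (simp only: mult_ac)
      finally show ?case unfolding S_def R_def by (simp only: mult.assoc)
    qed
  qed
qed

end
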